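(* Let $\sigma,p,\rho,a>0$, $0\le\nu<p$, $l\ge16$, $m\ge32$ integers, $d,\eta,\tau,\Lambda\ge1$, and let $\kappa(t)=t^{(p-\nu)/(a+\nu)}$. Let $\widehat\beta_\nu$ be the estimator defined in the context, based on an i.i.d. $n$-sample of $(Y,X,W)$ with $Y=\int_0^1\beta(t)X(t)\,dt+\sigma U$ and $\mathbb E[UW(t)]=0$, $t\in[0,1]$, with threshold $\alpha=c\,n^{-2(a+\nu)/[2(p+a)+1]}$ for some $c>0$. Then, as $n\to\infty$, $$\sup_{\beta\in\mathcal W_p^\rho,\ (X,W)\in\mathcal F^m_\kappa,\ U\in\mathcal E^l_\eta}\mathbb E\|\widehat\beta_\nu-\beta\|_\nu^2=O\bigl(n^{-2(p-\nu)/[2(p+a)+1]}\bigr).$$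
   Context: Basic notation. $L^2[0,1]$ is the Hilbert space of square integrable complex-valued functions with $\langle f,g\rangle=\int_0^1 f(t)\overline{g(t)}dt$, $\|f\|=\langle f,f\rangle^{1/2}$; $\phi_k(t)=\exp(2\pi i k t)$, $k\in\mathbb Z$. Weights: $\gamma_k=1+|2\pi k|^2$. For $\nu\in\mathbb R$, $\|f\|_\nu^2=\sum_{k\in\mathbb Z}\gamma_k^\nu|\langle f,\phi_k\rangle|^2$ and $\mathcal W_\nu=\{f\in L^2[0,1]:\|f\|_\nu<\infty\}$, $\mathcal W_\nu^\rho=\{f\in\mathcal W_\nu:\|f\|_\nu^2\le\rho\}$. Model. $X,W$ are real-valued centered random functions on $[0,1]$ with $\mathbb E\|X\|^2<\infty$, $\mathbb E\|W\|^2<\infty$; $Y$ is real-valued, and the slope function $\beta$ is real-valued. Second order stationarity. $\mathcal F$ is the set of all centered second order stationary pairs $(X,W)$: covariances depend only on differences of arguments, in particular $\mathrm{Cov}(X(t),W(s))=c_{WX}(s-t)$. It is a standing property that the $\phi_k$ diagonalize the cross-covariance operator $[T_{WX}f](s)=\int_0^1 f(t)\,\mathrm{Cov}(X(t),W(s))dt$, i.e. $T_{WX}\phi_k=c_k\phi_k$; equivalently, with $c_k=\mathbb E[\langle\phi_k,X\rangle\langle W,\phi_k\rangle]$, one has $\mathbb E[\langle\phi_k,X\rangle\langle W,\phi_j\rangle]=0$ for $j\neq k$. It is also a standing assumption that $T_{WX}$ is injective, i.e. $c_k\ne0$ for all $k$. Put $x_k=\mathrm{Var}\langle X,\phi_k\rangle$,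 $w_k=\mathrm{Var}\langle W,\phi_k\rangle$ (variance of a complex variable meaning $\mathbb E|\cdot|^2$ after centering), $\lambda_k=|c_k|^2/w_k$. Moment classes. For $m\in\mathbb N$, $\eta,\tau\ge1$: $\mathcal F^m_{\eta,\tau}$ is the set of $(X,W)\in\mathcal F$ with $\sup_k\mathbb E|\langle X,\phi_k\rangle/\sqrt{x_k}|^m\le\eta$, $\sup_k\mathbb E|\langle W,\phi_k\rangle/\sqrt{w_k}|^m\le\eta$ and $\max(1,\sup_k\lambda_k/w_k)\le\tau$. $\mathcal E^m_\eta$ is the set of centered real random variables $U$ with variance one and $\mathbb E|U|^m\le\eta$. Link condition. For a nonnegative summable sequence $(\lambda_k)_{k\in\mathbb Z}$ let $\lambda_+=\max(1,\max_k\lambda_k)$. For $\kappa$ continuous strictly increasing with $\kappa(0+)=0$ and inverse $\varphi$, and $d\ge1$, $\mathcal S_{\kappa,d}$ is the set of nonnegative summable $(\lambda_k)$ with $\kappa\bigl(\frac{\lambda_k}{d\gamma_k^\nu\lambda_+}\bigr)\le\gamma_k^{\nu-p}\le\kappa\bigl(\frac{d\lambda_k}{\gamma_k^\nu\lambda_+}\bigr)$ for all $k$, understood as $d^{-1}\varphi(\gamma_k^{\nu-p})\le\frac{\lambda_k}{\gamma_k^\nu\lambda_+}\le d\,\varphi(\gamma_k^{\nu-p})$ for all $k\in\mathbb Z$. Finally, $\mathcal F^m_\kappa$ is the set of $(X,W)\in\mathcal F^m_{\eta,\tau}$ whose associated values satisfy $(\lambda_k)_{k\in\mathbb Z}\in\mathcal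 S_{\kappa,d}$ and with $\mathbb E\|X\|^2\le\Lambda$, $\mathbb E\|W\|^2\le\Lambda$. Estimator. Given the sample $(Y_i,X_i,W_i)_{1\le i\le n}$ and a threshold $\alpha>0$, for $k\in\mathbb Z$ let $\widehat c_k=\frac1n\sum_{i=1}^n\langle\phi_k,X_i\rangle\langle W_i,\phi_k\rangle$, $\widehat w_k=\frac1n\sum_{i=1}^n|\langle W_i,\phi_k\rangle|^2$, $\widehat W_i=\sum_{k}\frac{\overline{\widehat c_k}}{\widehat w_k}\mathbf 1\{\widehat w_k\ge\alpha\}\langle W_i,\phi_k\rangle\phi_k$, $\widehat\lambda_k=\frac1n\sum_{i=1}^n|\langle\widehat W_i,\phi_k\rangle|^2$, $\widehat g_k=\frac1n\sum_{i=1}^nY_i\langle\widehat W_i,\phi_k\rangle$, and $$\widehat\beta_\nu=\sum_{k\in\mathbb Z}\frac{\widehat g_k}{\widehat\lambda_k}\mathbf 1\{\widehat\lambda_k/\gamma_k^\nu\ge\alpha\}\,\phi_k .$$ *)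

theory Defs
  imports "HOL-Probability.Probability"
begin

section \<open>The Hilbert space L2 on the unit interval and the weighted norms\<close>

abbreviation unit_leb :: "real measure" where
  "unit_leb \<equiv> lebesgue_on {0..1}"

definition L2 :: "(real \<Rightarrow> complex) set" where
  "L2 = {f. f \<in> borel_measurable unit_leb \<and> integrable unit_leb (\<lambda>t. (cmod (f t))\<^sup>2)}"

definition l2_inner :: "(real \<Rightarrow> complex) \<Rightarrow> (real \<Rightarrow> complex) \<Rightarrow> complex" where
  "l2_inner f g = (\<integral>t. f t * cnj (g t) \<partial>unit_leb)"

abbreviation cfun :: "(real \<Rightarrow> real) \<Rightarrow> real \<Rightarrow> complex" where
  "cfun f \<equiv> (\<lambda>t. complex_of_real (f t))"

definition \<phi> :: "int \<Rightarrow> real \<Rightarrow> complex" where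
  "\<phi> k t = exp (2 * of_real pi * \<i> * of_int k * of_real t)"

definition \<gamma> :: "int \<Rightarrow> real" where
  "\<gamma> k = 1 + \<bar>2 * pi * of_int k\<bar>\<^sup>2"

text \<open>The squared norm is extended-valued, so that it is infinite outside the space it defines.\<close>

definition norm2 :: "real \<Rightarrow> (real \<Rightarrow> complex) \<Rightarrow> ennreal" where
  "norm2 \<nu> f = (\<Sum>\<^sub>\<infinity>k::int. ennreal (\<gamma> k powr \<nu> * (cmod (l2_inner f (\<phi> k)))\<^sup>2))"

definition sobolev :: "real \<Rightarrow> (real \<Rightarrow> complex) set" where
  "sobolev \<nu> = {f \<in> L2. norm2 \<nu> f < \<infinity>}"

definition sobolev_ball :: "real \<Rightarrow> real \<Rightarrow> (real \<Rightarrow> complex) set" where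
  "sobolev_ball \<nu> \<rho> = {f \<in> sobolev \<nu>. norm2 \<nu> f \<le> ennreal \<rho>}"

section \<open>Random functions and second order stationarity\<close>

text \<open>A random function is a jointly measurable real process indexed by the unit interval. Values
  at times outside the interval never matter. Moments that need not be finite a priori are
  nonnegative integrals; Bochner integrals are used only for quantities whose integrability
  follows from the other conditions.\<close>

definition mean_sq_norm :: "'a measure \<Rightarrow> ('a \<Rightarrow> real \<Rightarrow> real) \<Rightarrow> ennreal" where
  "mean_sq_norm M X = (\<integral>\<^sup>+\<omega>. (\<integral>\<^sup>+t. ennreal ((X \<omega> t)\<^sup>2) \<partial>unit_leb) \<partial>M)"

definition random_function :: "'a measure \<Rightarrow> ('a \<Rightarrow> real \<Rightarrow> real) \<Rightarrow> bool" where
  "random_function M X \<longleftrightarrow>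
     (\<lambda>(\<omega>, t). X \<omega> t) \<in> borel_measurable (M \<Otimes>\<^sub>M unit_leb) \<and> mean_sq_norm M X < \<infinity>"

definition cov :: "'a measure \<Rightarrow> ('a \<Rightarrow> real) \<Rightarrow> ('a \<Rightarrow> real) \<Rightarrow> real" where
  "cov M A B = (\<integral>\<omega>. (A \<omega> - (\<integral>\<omega>'. A \<omega>' \<partial>M)) * (B \<omega> - (\<integral>\<omega>'. B \<omega>' \<partial>M)) \<partial>M)"

definition cvar :: "'a measure \<Rightarrow> ('a \<Rightarrow> complex) \<Rightarrow> real" where
  "cvar M Z = (\<integral>\<omega>. (cmod (Z \<omega> - (\<integral>\<omega>'. Z \<omega>' \<partial>M)))\<^sup>2 \<partial>M)"

definition centered_second_order :: "'a measure \<Rightarrow> ('a \<Rightarrow> real \<Rightarrow> real) \<Rightarrow> bool" where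
  "centered_second_order M X \<longleftrightarrow>
     (\<forall>t\<in>{0..1}. integrable M (\<lambda>\<omega>. (X \<omega> t)\<^sup>2) \<and> (\<integral>\<omega>. X \<omega> t \<partial>M) = 0)"

definition second_order_stationary ::
  "'a measure \<Rightarrow> ('a \<Rightarrow> real \<Rightarrow> real) \<Rightarrow> ('a \<Rightarrow> real \<Rightarrow> real) \<Rightarrow> bool" where
  "second_order_stationary M X W \<longleftrightarrow>
     (\<exists>c\<^sub>X c\<^sub>W c\<^sub>W\<^sub>X :: real \<Rightarrow> real. \<forall>s\<in>{0..1}. \<forall>t\<in>{0..1}.
        cov M (\<lambda>\<omega>. X \<omega> t) (\<lambda>\<omega>. X \<omega> s) = c\<^sub>X (s - t) \<and>
        cov M (\<lambda>\<omega>. W \<omega> t) (\<lambda>\<omega>. W \<omega> s) = c\<^sub>W (s - t) \<and>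
        cov M (\<lambda>\<omega>. X \<omega> t) (\<lambda>\<omega>. W \<omega> s) = c\<^sub>W\<^sub>X (s - t))"

definition T_WX ::
  "'a measure \<Rightarrow> ('a \<Rightarrow> real \<Rightarrow> real) \<Rightarrow> ('a \<Rightarrow> real \<Rightarrow> real)
     \<Rightarrow> (real \<Rightarrow> complex) \<Rightarrow> real \<Rightarrow> complex" where
  "T_WX M X W f s =
     (\<integral>t. f t * complex_of_real (cov M (\<lambda>\<omega>. X \<omega> t) (\<lambda>\<omega>. W \<omega> s)) \<partial>unit_leb)"

definition c_coef ::
  "'a measure \<Rightarrow> ('a \<Rightarrow> real \<Rightarrow> real) \<Rightarrow> ('a \<Rightarrow> real \<Rightarrow> real) \<Rightarrow> int \<Rightarrow> complex" where
  "c_coef M X W k = (\<integral>\<omega>. l2_inner (\<phi> k) (cfun (X \<omega>)) * l2_inner (cfun (W \<omega>)) (\<phi> k) \<partial>M)"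

text \<open>Covariances depending only on differences of arguments in the unit interval do not by
  themselves make the exponentials eigenfunctions of the operator (the covariance function would
  also have to be periodic), so this property, like injectivity, is part of the definition.\<close>

definition stationary_pairs ::
  "'a measure \<Rightarrow> (('a \<Rightarrow> real \<Rightarrow> real) \<times> ('a \<Rightarrow> real \<Rightarrow> real)) set" where
  "stationary_pairs M = {(X, W).
     random_function M X \<and> random_function M W \<and>
     centered_second_order M X \<and> centered_second_order M W \<and>
     second_order_stationary M X W \<and>
     (\<forall>k. AE s in unit_leb. T_WX M X W (\<phi> k) s = c_coef M X W k * \<phi> k s) \<and>
     (\<forall>f\<in>L2. (AE s in unit_leb. T_WX M X W f s = 0) \<longrightarrow> (AE t in unit_leb. f t = 0))}"

section \<open>Moment classes and the link condition\<close>

definition var_coef :: "'a measure \<Rightarrow> ('a \<Rightarrow> real \<Rightarrow> real) \<Rightarrow> int \<Rightarrow> real" where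
  "var_coef M X k = cvar M (\<lambda>\<omega>. l2_inner (cfun (X \<omega>)) (\<phi> k))"

definition lam ::
  "'a measure \<Rightarrow> ('a \<Rightarrow> real \<Rightarrow> real) \<Rightarrow> ('a \<Rightarrow> real \<Rightarrow> real) \<Rightarrow> int \<Rightarrow> real" where
  "lam M X W k = (cmod (c_coef M X W k))\<^sup>2 / var_coef M W k"

definition max_std_moment :: "'a measure \<Rightarrow> nat \<Rightarrow> ('a \<Rightarrow> real \<Rightarrow> real) \<Rightarrow> ennreal" where
  "max_std_moment M m X =
     (SUP k::int. \<integral>\<^sup>+\<omega>. ennreal (cmod (l2_inner (cfun (X \<omega>)) (\<phi> k)
                              / complex_of_real (sqrt (var_coef M X k))) ^ m) \<partial>M)"

definition pair_class ::
  "'a measure \<Rightarrow> nat \<Rightarrow> real \<Rightarrow> real \<Rightarrow> (('a \<Rightarrow> real \<Rightarrow> real) \<times> ('a \<Rightarrow> real \<Rightarrow> real)) set" where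
  "pair_class M m \<eta> \<tau> = {(X, W) \<in> stationary_pairs M.
     max_std_moment M m X \<le> ennreal \<eta> \<and> max_std_moment M m W \<le> ennreal \<eta> \<and>
     max 1 (SUP k. ennreal (lam M X W k / var_coef M W k)) \<le> ennreal \<tau>}"

definition error_class :: "'a measure \<Rightarrow> nat \<Rightarrow> real \<Rightarrow> ('a \<Rightarrow> real) set" where
  "error_class M l \<eta> = {U. U \<in> borel_measurable M \<and> integrable M (\<lambda>\<omega>. (U \<omega>)\<^sup>2) \<and>
     (\<integral>\<omega>. U \<omega> \<partial>M) = 0 \<and> cov M U U = 1 \<and>
     (\<integral>\<^sup>+\<omega>. ennreal (\<bar>U \<omega>\<bar> ^ l) \<partial>M) \<le> ennreal \<eta>}"

definition lam_plus :: "(int \<Rightarrow> real) \<Rightarrow> real" where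
  "lam_plus r = max 1 (SUP k. r k)"

text \<open>The function \<open>\<kappa>\<close> is an increasing function on the nonnegative half-line, and the inverse is
  taken there.\<close>

definition link_class ::
  "(real \<Rightarrow> real) \<Rightarrow> real \<Rightarrow> real \<Rightarrow> real \<Rightarrow> (int \<Rightarrow> real) set" where
  "link_class \<kappa> d \<nu> p = {r. (\<forall>k. 0 \<le> r k) \<and> r summable_on UNIV \<and>
     (\<forall>k. the_inv_into {0..} \<kappa> (\<gamma> k powr (\<nu> - p)) / d \<le> r k / (\<gamma> k powr \<nu> * lam_plus r) \<and>
          r k / (\<gamma> k powr \<nu> * lam_plus r) \<le> d * the_inv_into {0..} \<kappa> (\<gamma> k powr (\<nu> - p)))}"

definition pair_link_class ::
  "'a measure \<Rightarrow> nat \<Rightarrow> real \<Rightarrow> real \<Rightarrow> (real \<Rightarrow> real) \<Rightarrow> real \<Rightarrow> real \<Rightarrow> real \<Rightarrow> real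
     \<Rightarrow> (('a \<Rightarrow> real \<Rightarrow> real) \<times> ('a \<Rightarrow> real \<Rightarrow> real)) set" where
  "pair_link_class M m \<eta> \<tau> \<kappa> d \<nu> p \<Lambda> = {(X, W) \<in> pair_class M m \<eta> \<tau>.
     lam M X W \<in> link_class \<kappa> d \<nu> p \<and>
     mean_sq_norm M X \<le> ennreal \<Lambda> \<and> mean_sq_norm M W \<le> ennreal \<Lambda>}"

section \<open>The estimator\<close>

text \<open>The sample is indexed by \<open>i < n\<close>. The series defining \<open>W_hat\<close> and \<open>beta_hat\<close> have only
  finitely many nonzero terms as soon as the sample functions are square integrable, because the
  \<open>w_hat\<close> are then summable over the frequencies; hence they are taken pointwise.\<close>

definition c_hat ::
  "nat \<Rightarrow> (nat \<Rightarrow> real \<Rightarrow> real) \<Rightarrow> (nat \<Rightarrow> real \<Rightarrow> real) \<Rightarrow> int \<Rightarrow> complex" where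
  "c_hat n X W k =
     (\<Sum>i<n. l2_inner (\<phi> k) (cfun (X i)) * l2_inner (cfun (W i)) (\<phi> k)) / of_nat n"

definition w_hat :: "nat \<Rightarrow> (nat \<Rightarrow> real \<Rightarrow> real) \<Rightarrow> int \<Rightarrow> real" where
  "w_hat n W k = (\<Sum>i<n. (cmod (l2_inner (cfun (W i)) (\<phi> k)))\<^sup>2) / real n"

definition W_hat ::
  "nat \<Rightarrow> real \<Rightarrow> (nat \<Rightarrow> real \<Rightarrow> real) \<Rightarrow> (nat \<Rightarrow> real \<Rightarrow> real) \<Rightarrow> nat \<Rightarrow> real \<Rightarrow> complex" where
  "W_hat n \<alpha> X W i t = (\<Sum>\<^sub>\<infinity>k::int.
     cnj (c_hat n X W k) / complex_of_real (w_hat n W k) * of_bool (w_hat n W k \<ge> \<alpha>)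
       * l2_inner (cfun (W i)) (\<phi> k) * \<phi> k t)"

definition lam_hat ::
  "nat \<Rightarrow> real \<Rightarrow> (nat \<Rightarrow> real \<Rightarrow> real) \<Rightarrow> (nat \<Rightarrow> real \<Rightarrow> real) \<Rightarrow> int \<Rightarrow> real" where
  "lam_hat n \<alpha> X W k = (\<Sum>i<n. (cmod (l2_inner (W_hat n \<alpha> X W i) (\<phi> k)))\<^sup>2) / real n"

definition g_hat ::
  "nat \<Rightarrow> real \<Rightarrow> (nat \<Rightarrow> real) \<Rightarrow> (nat \<Rightarrow> real \<Rightarrow> real) \<Rightarrow> (nat \<Rightarrow> real \<Rightarrow> real)
     \<Rightarrow> int \<Rightarrow> complex" where
  "g_hat n \<alpha> Y X W k =
     (\<Sum>i<n. complex_of_real (Y i) * l2_inner (W_hat n \<alpha> X W i) (\<phi> k)) / of_nat n"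

definition beta_hat ::
  "real \<Rightarrow> nat \<Rightarrow> real \<Rightarrow> (nat \<Rightarrow> real) \<Rightarrow> (nat \<Rightarrow> real \<Rightarrow> real) \<Rightarrow> (nat \<Rightarrow> real \<Rightarrow> real)
     \<Rightarrow> real \<Rightarrow> complex" where
  "beta_hat \<nu> n \<alpha> Y X W t = (\<Sum>\<^sub>\<infinity>k::int.
     g_hat n \<alpha> Y X W k / complex_of_real (lam_hat n \<alpha> X W k)
       * of_bool (lam_hat n \<alpha> X W k / \<gamma> k powr \<nu> \<ge> \<alpha>) * \<phi> k t)"

definition response ::
  "real \<Rightarrow> (real \<Rightarrow> real) \<Rightarrow> ('a \<Rightarrow> real \<Rightarrow> real) \<Rightarrow> ('a \<Rightarrow> real) \<Rightarrow> 'a \<Rightarrow> real" where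
  "response \<sigma> \<beta> X U \<omega> = (\<integral>t. \<beta> t * X \<omega> t \<partial>unit_leb) + \<sigma> * U \<omega>"

text \<open>The i.i.d. sample is realised canonically, as the coordinates of the n-fold product of the
  probability space on which (X, W, U) lives; the risk depends on the law of the sample only.\<close>

definition risk ::
  "real \<Rightarrow> nat \<Rightarrow> real \<Rightarrow> real \<Rightarrow> 'a measure \<Rightarrow> (real \<Rightarrow> real)
     \<Rightarrow> ('a \<Rightarrow> real \<Rightarrow> real) \<Rightarrow> ('a \<Rightarrow> real \<Rightarrow> real) \<Rightarrow> ('a \<Rightarrow> real) \<Rightarrow> ennreal" where
  "risk \<nu> n \<alpha> \<sigma> M \<beta> X W U =
     (\<integral>\<^sup>+\<omega>. norm2 \<nu> (\<lambda>t. beta_hat \<nu> n \<alpha> (\<lambda>i. response \<sigma> \<beta> X U (\<omega> i))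
                         (\<lambda>i. X (\<omega> i)) (\<lambda>i. W (\<omega> i)) t - complex_of_real (\<beta> t))
        \<partial>(\<Pi>\<^sub>M i\<in>{..<n}. M))"

end

theory Submission
  imports Defs
begin

text \<open>The \<open>k\<close>-th coefficient of the estimator is \<open>G\<^sub>k / c_hat k\<close>, with \<open>G\<^sub>k\<close> the empirical mean of
  \<open>Y \<langle>W, \<phi>\<^sub>k\<rangle>\<close>, on the event where both thresholds are passed, and \<open>0\<close> otherwise. Its error is
  controlled by three empirical means of centred variables: \<open>G\<^sub>k - \<beta>\<^sub>k c_hat k\<close>,
  \<open>c_hat k - c\<^sub>k\<close> and \<open>w_hat k - w\<^sub>k\<close>. The threshold itself bounds the variance contribution of a
  kept coefficient by \<open>1 / (n \<alpha>)\<close>, and only \<open>O(n powr (1 / (2 * (p + a) + 1)))\<close> frequencies satisfy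
  \<open>\<lambda>\<^sub>k > \<alpha> \<gamma>\<^sub>k powr \<nu> / 8\<close>; keeping one of the others, or dropping a low one, forces a deviation of
  \<open>c_hat\<close> or \<open>w_hat\<close>, which costs a further factor. Fourth moments of the
  empirical means are all that is needed. The high frequencies dropped contribute the usual
  bias. Completeness of the exponentials enters twice: it centres \<open>G\<^sub>k - \<beta>\<^sub>k c_hat k\<close>, and it turns
  the moment conditions on the coefficients of \<open>X\<close> into a moment of its norm.\<close>

section \<open>Trigonometric polynomials\<close>

text \<open>The thresholds are random, so the expected error has to be summed over all frequencies,
  and a variance of order 1 / (n \<alpha>) for each of them is not summable. In the variance part,
  every deviation that is paid for leaves a factor \<open>w k\<close> or \<open>x k\<close>, whose
  sums over the frequencies are at most \<Lambda>. The price is a second factor 1 / (n \<alpha>),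
  which is harmless for this threshold. Squared relative deviations, as in Chebyshev's inequality,
  take the place of tail bounds.

  A product of two squared deviations needs fourth moments of both empirical means. Their summands
  are themselves products of two variables, so eighth moments of the coefficients and of the
  response residual are required.

  The constants 8 and \<open>8 * \<tau>\<close> in the two cut-offs leave a constant factor of room:
  a wrong decision of the estimator then forces a relative deviation that is bounded below.\<close>

lemma phi_continuous: "continuous_on S (\<phi> k)"
  unfolding \<phi>_def by (intro continuous_intros)

lemma phi_measurable [measurable]: "\<phi> k \<in> borel_measurable borel"
  by (intro borel_measurable_continuous_onI phi_continuous)

lemma phi_measurable_unit [measurable]: "\<phi> k \<in> borel_measurable unit_leb"
  by (rule measurable_restrict_space1, rule measurable_completion) simp

lemma norm_phi [simp]: "cmod (\<phi> k t) = 1"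
  unfolding \<phi>_def by (simp add: norm_exp_eq_Re)

lemma cnj_phi: "cnj (\<phi> k t) = \<phi> (- k) t"
  unfolding \<phi>_def by (simp add: exp_cnj)

lemma phi_mult: "\<phi> j t * \<phi> k t = \<phi> (j + k) t"
  unfolding \<phi>_def by (simp add: exp_add [symmetric] algebra_simps)

lemma prob_space_unit: "prob_space unit_leb"
  by standard (simp add: emeasure_restrict_space)

interpretation unit: prob_space unit_leb
  by (rule prob_space_unit)

lemma AE_unit_interior: "AE t in unit_leb. t \<noteq> 0 \<and> t \<noteq> 1"
proof -
  have "AE t in lebesgue. t \<noteq> (0::real) \<and> t \<noteq> 1"
    by (intro AE_completion AE_conjI AE_lborel_singleton)
  then show ?thesis by (subst AE_restrict_space_iff) (auto elim: eventually_mono)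
qed

lemma integral_phi: "(\<integral>t. \<phi> k t \<partial>unit_leb) = of_bool (k = 0)"
proof (cases "k = 0")
  case True
  then show ?thesis
    using unit.prob_space by (simp add: \<phi>_def)
next
  case False
  define z where "z = 2 * of_real pi * \<i> * (of_int k :: complex)"
  have z: "z \<noteq> 0" using False by (simp add: z_def)
  have e: "exp z = 1"
    unfolding z_def using exp_integer_2pi[of "of_int k"] by (simp add: mult_ac)
  have "((\<lambda>t. exp (z * of_real t)) has_integral (exp (z * of_real 1) / z - exp (z * of_real 0) / z)) {0..1}"
    by (rule fundamental_theorem_of_calculus)
       (auto intro!: derivative_eq_intros has_vector_derivative_real_field simp: z)
  then have "((\<lambda>t. exp (z * of_real t)) has_integral 0) {0..1}"
    using e by simp
  moreover have "(\<lambda>t. exp (z * of_real t)) = \<phi> k"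
    by (simp add: \<phi>_def z_def fun_eq_iff)
  ultimately have "integral {0..1} (\<phi> k) = 0"
    by (simp add: integral_unique)
  moreover have "integrable unit_leb (\<phi> k)"
    by (rule unit.integrable_const_bound[of _ 1]) auto
  ultimately show ?thesis
    using False by (subst lebesgue_integral_eq_integral) auto
qed

lemma cauchy_schwarz_integral:
  fixes f g :: "'b \<Rightarrow> complex"
  assumes [measurable]: "f \<in> borel_measurable N" "g \<in> borel_measurable N"
    and f: "integrable N (\<lambda>x. (cmod (f x))\<^sup>2)" and g: "integrable N (\<lambda>x. (cmod (g x))\<^sup>2)"
  shows "integrable N (\<lambda>x. f x * g x)"
    and "(\<integral>x. cmod (f x) * cmod (g x) \<partial>N)\<^sup>2
           \<le> (\<integral>x. (cmod (f x))\<^sup>2 \<partial>N) * (\<integral>x. (cmod (g x))\<^sup>2 \<partial>N)"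
    and "(cmod (\<integral>x. f x * g x \<partial>N))\<^sup>2
           \<le> (\<integral>x. (cmod (f x))\<^sup>2 \<partial>N) * (\<integral>x. (cmod (g x))\<^sup>2 \<partial>N)"
proof -
  have ab: "a * b \<le> a\<^sup>2 + b\<^sup>2" if "a \<ge> 0" "b \<ge> 0" for a b :: real
    using sum_squares_bound[of a b] mult_nonneg_nonneg[OF that] by linarith
  show int: "integrable N (\<lambda>x. f x * g x)"
    by (rule Bochner_Integration.integrable_bound[OF Bochner_Integration.integrable_add[OF f g]])
       (auto simp: norm_mult intro!: AE_I2 ab)
  then have intn: "integrable N (\<lambda>x. cmod (f x) * cmod (g x))"
    using integrable_norm[OF int] by (simp add: norm_mult)
  let ?I = "\<integral>x. cmod (f x) * cmod (g x) \<partial>N"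
  have "(\<integral>\<^sup>+x. ennreal (cmod (f x)) * ennreal (cmod (g x)) \<partial>N)\<^sup>2
      \<le> (\<integral>\<^sup>+x. ennreal (cmod (f x)) ^ 2 \<partial>N) * (\<integral>\<^sup>+x. ennreal (cmod (g x)) ^ 2 \<partial>N)"
    by (rule Cauchy_Schwarz_nn_integral) auto
  then have "ennreal (?I\<^sup>2) \<le> ennreal ((\<integral>x. (cmod (f x))\<^sup>2 \<partial>N) * (\<integral>x. (cmod (g x))\<^sup>2 \<partial>N))"
    by (simp add: ennreal_power ennreal_mult[symmetric] nn_integral_eq_integral f g intn)
  then show cs: "?I\<^sup>2 \<le> (\<integral>x. (cmod (f x))\<^sup>2 \<partial>N) * (\<integral>x. (cmod (g x))\<^sup>2 \<partial>N)"
    by (subst (asm) ennreal_le_iff) auto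
  have "cmod (\<integral>x. f x * g x \<partial>N) \<le> ?I"
    using integral_norm_bound[of N "\<lambda>x. f x * g x"] by (simp add: norm_mult)
  then have "(cmod (\<integral>x. f x * g x \<partial>N))\<^sup>2 \<le> ?I\<^sup>2"
    by (rule power_mono) simp
  with cs show "(cmod (\<integral>x. f x * g x \<partial>N))\<^sup>2
           \<le> (\<integral>x. (cmod (f x))\<^sup>2 \<partial>N) * (\<integral>x. (cmod (g x))\<^sup>2 \<partial>N)"
    by linarith
qed

lemma L2D:
  assumes "f \<in> L2"
  shows "f \<in> borel_measurable unit_leb" "integrable unit_leb (\<lambda>t. (cmod (f t))\<^sup>2)"
  using assms by (auto simp: L2_def)

lemma integrable_times_phi:
  assumes "f \<in> L2"
  shows "integrable unit_leb (\<lambda>t. f t * \<phi> k t)"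
  by (rule cauchy_schwarz_integral(1)) (use L2D[OF assms] in auto)

lemma integrable_times_cnj_phi:
  assumes "f \<in> L2"
  shows "integrable unit_leb (\<lambda>t. f t * cnj (\<phi> k t))"
  using integrable_times_phi[OF assms, of "-k"] by (simp add: cnj_phi)

lemma phi_in_L2: "\<phi> k \<in> L2"
  by (simp add: L2_def)

lemma l2_inner_phi: "l2_inner (\<phi> j) (\<phi> k) = of_bool (j = k)"
  unfolding l2_inner_def cnj_phi phi_mult integral_phi by simp

lemma l2_inner_trig_phi:
  assumes "finite F"
  shows "l2_inner (\<lambda>t. \<Sum>j\<in>F. a j * \<phi> j t) (\<phi> k) = (if k \<in> F then a k else 0)"
proof -
  have "l2_inner (\<lambda>t. \<Sum>j\<in>F. a j * \<phi> j t) (\<phi> k) = (\<Sum>j\<in>F. a j * l2_inner (\<phi> j) (\<phi> k))"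
    unfolding l2_inner_def sum_distrib_right mult.assoc
    by (subst Bochner_Integration.integral_sum)
       (auto intro!: integrable_times_cnj_phi phi_in_L2)
  then show ?thesis
    using assms by (simp add: l2_inner_phi of_bool_def if_distrib sum.delta cong: if_cong)
qed

lemma trig_in_L2: "(\<lambda>t. \<Sum>j\<in>F. a j * \<phi> j t) \<in> L2"
proof -
  have "cmod (\<Sum>j\<in>F. a j * \<phi> j t) \<le> (\<Sum>j\<in>F. cmod (a j))" for t
    by (rule order_trans[OF norm_sum]) (simp add: norm_mult)
  then have "(cmod (\<Sum>j\<in>F. a j * \<phi> j t))\<^sup>2 \<le> (\<Sum>j\<in>F. cmod (a j))\<^sup>2" for t
    by (intro power_mono) auto
  then have "integrable unit_leb (\<lambda>t. (cmod (\<Sum>j\<in>F. a j * \<phi> j t))\<^sup>2)"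
    by (intro unit.integrable_const_bound[of _ "(\<Sum>j\<in>F. cmod (a j))\<^sup>2"]) auto
  then show ?thesis by (simp add: L2_def)
qed

lemma L2_diff:
  assumes f: "f \<in> L2" and g: "g \<in> L2"
  shows "(\<lambda>t. f t - g t) \<in> L2"
proof -
  note [measurable] = L2D(1)[OF f] L2D(1)[OF g]
  have "(cmod (x - y))\<^sup>2 \<le> 2 * (cmod x)\<^sup>2 + 2 * (cmod y)\<^sup>2" for x y
  proof -
    have "(cmod (x - y))\<^sup>2 \<le> (cmod x + cmod y)\<^sup>2"
      by (intro power_mono norm_triangle_ineq4) auto
    also have "\<dots> \<le> 2 * (cmod x)\<^sup>2 + 2 * (cmod y)\<^sup>2"
      using sum_squares_bound[of "cmod x" "cmod y"] by (simp add: power2_sum)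
    finally show ?thesis .
  qed
  then have le: "norm ((cmod (f t - g t))\<^sup>2) \<le> norm (2 * (cmod (f t))\<^sup>2 + 2 * (cmod (g t))\<^sup>2)" for t
    by simp
  have "integrable unit_leb (\<lambda>t. 2 * (cmod (f t))\<^sup>2 + 2 * (cmod (g t))\<^sup>2)"
    using L2D(2)[OF f] L2D(2)[OF g] by simp
  then have "integrable unit_leb (\<lambda>t. (cmod (f t - g t))\<^sup>2)"
    by (rule Bochner_Integration.integrable_bound) (simp, intro AE_I2 le)
  then show ?thesis by (simp add: L2_def)
qed

lemma l2_inner_diff_phi:
  assumes "f \<in> L2" "g \<in> L2"
  shows "l2_inner (\<lambda>t. f t - g t) (\<phi> k) = l2_inner f (\<phi> k) - l2_inner g (\<phi> k)"
  unfolding l2_inner_def left_diff_distrib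
  by (rule Bochner_Integration.integral_diff) (intro integrable_times_cnj_phi assms)+

text \<open>Expanding the square and completing it coefficient by coefficient isolates the mismatch
  of the coefficients in the last sum. Fourier coefficients make that sum vanish, so this one
  formula yields Bessel's inequality, the optimality of Fourier partial sums and the limit in
  Parseval's identity.\<close>

lemma trig_approx_error:
  assumes f: "f \<in> L2" and F: "finite F"
  shows "(\<integral>t. (cmod (f t - (\<Sum>k\<in>F. a k * \<phi> k t)))\<^sup>2 \<partial>unit_leb)
       = (\<integral>t. (cmod (f t))\<^sup>2 \<partial>unit_leb) - (\<Sum>k\<in>F. (cmod (l2_inner f (\<phi> k)))\<^sup>2)
         + (\<Sum>k\<in>F. (cmod (l2_inner f (\<phi> k) - a k))\<^sup>2)"
proof -
  define q where "q = (\<lambda>t. \<Sum>k\<in>F. a k * \<phi> k t)"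
  note [measurable] = L2D(1)[OF f]
  have q: "q \<in> L2" unfolding q_def by (rule trig_in_L2)
  have cq: "cnj (q t) = (\<Sum>k\<in>F. cnj (a k) * cnj (\<phi> k t))" for t
    by (simp add: q_def)
  have inner: "(\<integral>t. g t * cnj (q t) \<partial>unit_leb) = (\<Sum>k\<in>F. cnj (a k) * l2_inner g (\<phi> k))"
    and inti: "integrable unit_leb (\<lambda>t. g t * cnj (q t))" if "g \<in> L2" for g
  proof -
    have e: "g t * cnj (q t) = (\<Sum>k\<in>F. cnj (a k) * (g t * cnj (\<phi> k t)))" for t
      by (simp add: cq sum_distrib_left mult_ac)
    show "(\<integral>t. g t * cnj (q t) \<partial>unit_leb) = (\<Sum>k\<in>F. cnj (a k) * l2_inner g (\<phi> k))"
      unfolding e l2_inner_def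
      by (subst Bochner_Integration.integral_sum)
         (auto intro!: integrable_times_cnj_phi that)
    show "integrable unit_leb (\<lambda>t. g t * cnj (q t))"
      unfolding e by (auto intro!: integrable_times_cnj_phi that)
  qed
  have qq: "(\<integral>t. q t * cnj (q t) \<partial>unit_leb) = (\<Sum>k\<in>F. cnj (a k) * a k)"
    unfolding inner[OF q] unfolding q_def l2_inner_trig_phi[OF F] by (auto intro!: sum.cong)
  have qq': "q t * cnj (q t) = of_real ((cmod (q t))\<^sup>2)" for t
    by (metis complex_norm_square)
  have Q: "(\<integral>t. (cmod (q t))\<^sup>2 \<partial>unit_leb) = (\<Sum>k\<in>F. (cmod (a k))\<^sup>2)"
  proof -
    have "complex_of_real (\<integral>t. (cmod (q t))\<^sup>2 \<partial>unit_leb) = (\<Sum>k\<in>F. cnj (a k) * a k)"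
      unfolding qq[symmetric] qq' by (rule integral_complex_of_real[symmetric])
    also have "\<dots> = of_real (\<Sum>k\<in>F. (cmod (a k))\<^sup>2)"
      unfolding of_real_sum complex_norm_square by (simp add: mult.commute)
    finally show ?thesis by (simp only: of_real_eq_iff)
  qed
  have ex: "(cmod (x - y))\<^sup>2 = (cmod x)\<^sup>2 - 2 * Re (x * cnj y) + (cmod y)\<^sup>2" for x y
    unfolding cmod_power2 by (simp add: power2_eq_square algebra_simps)
  have "(\<integral>t. (cmod (f t - q t))\<^sup>2 \<partial>unit_leb)
      = (\<integral>t. (cmod (f t))\<^sup>2 \<partial>unit_leb) - 2 * Re (\<integral>t. f t * cnj (q t) \<partial>unit_leb)
        + (\<integral>t. (cmod (q t))\<^sup>2 \<partial>unit_leb)"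
    unfolding ex integral_Re[OF inti[OF f], symmetric]
    using L2D(2)[OF f] L2D(2)[OF q] integrable_Re[OF inti[OF f]] by (simp del: times_complex.sel)
  also have "\<dots> = (\<integral>t. (cmod (f t))\<^sup>2 \<partial>unit_leb)
      + (\<Sum>k\<in>F. (cmod (a k))\<^sup>2 - 2 * Re (cnj (a k) * l2_inner f (\<phi> k)))"
    unfolding inner[OF f] Q by (simp add: sum_subtractf sum_distrib_left)
  also have "(\<lambda>k. (cmod (a k))\<^sup>2 - 2 * Re (cnj (a k) * l2_inner f (\<phi> k)))
      = (\<lambda>k. (cmod (l2_inner f (\<phi> k) - a k))\<^sup>2 - (cmod (l2_inner f (\<phi> k)))\<^sup>2)"
    unfolding ex by (simp add: mult.commute fun_eq_iff)
  finally show ?thesis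
    by (simp add: q_def sum_subtractf)
qed

lemma bessel:
  assumes f: "f \<in> L2" and F: "finite F"
  shows "(\<Sum>k\<in>F. (cmod (l2_inner f (\<phi> k)))\<^sup>2) \<le> (\<integral>t. (cmod (f t))\<^sup>2 \<partial>unit_leb)"
proof -
  have "0 \<le> (\<integral>t. (cmod (f t - (\<Sum>k\<in>F. l2_inner f (\<phi> k) * \<phi> k t)))\<^sup>2 \<partial>unit_leb)"
    by simp
  then show ?thesis
    unfolding trig_approx_error[OF assms] by simp
qed

section \<open>Uniform approximation by trigonometric polynomials\<close>

text \<open>\<open>\<phi> 1\<close> wraps the interval onto the unit circle and identifies only the
  endpoints. A continuous map from a compact space to a Hausdorff space is closed, hence a quotient
  map onto its image, so \<open>g\<close> descends to the circle.\<close>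

lemma circle_continuous:
  fixes g :: "real \<Rightarrow> real"
  assumes g: "continuous_on {0..1} g" and g01: "g 0 = g 1"
  obtains G where "continuous_on (sphere 0 1) G" "\<And>t. t \<in> {0..1} \<Longrightarrow> G (\<phi> 1 t) = g t"
proof -
  have ph: "\<phi> 1 t = cis (2 * pi * t)" for t
    unfolding \<phi>_def cis_conv_exp by (simp add: mult_ac)
  have inj: "g s = g t" if "s \<in> {0..1}" "t \<in> {0..1}" "\<phi> 1 s = \<phi> 1 t" for s t
  proof -
    have "cis (2 * pi * (s - t)) = 1"
      using that(3) by (simp add: ph right_diff_distrib cis_divide[symmetric])
    then have "sin (2 * pi * (s - t)) = 0 \<and> cos (2 * pi * (s - t)) = 1"
      by (simp add: complex_eq_iff)
    then obtain m :: int where "2 * pi * (s - t) = of_int m * 2 * pi"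
      using cos_one_2pi_int by metis
    then have m: "s - t = of_int m" by simp
    then have "\<bar>of_int m\<bar> \<le> (1::real)" using that by auto
    then have "m = 0 \<or> m = 1 \<or> m = -1" by linarith
    then have "s = t \<or> s = 1 \<and> t = 0 \<or> s = 0 \<and> t = 1" using m that by auto
    then show ?thesis using g01 by auto
  qed
  \<comment> \<open>Any preimage will do: by \<open>inj\<close> the value of \<open>g\<close> does
    not depend on the choice.\<close>
  define G where "G = (\<lambda>z. g (SOME t. t \<in> {0..1} \<and> \<phi> 1 t = z))"
  have G: "G (\<phi> 1 t) = g t" if "t \<in> {0..1}" for t
    unfolding G_def using someI[of "\<lambda>s. s \<in> {0..1} \<and> \<phi> 1 s = \<phi> 1 t" t] that inj by metis
  have im: "\<phi> 1 ` {0..1} = sphere 0 1"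
  proof
    show "sphere 0 1 \<subseteq> \<phi> 1 ` {0..1}"
    proof
      fix z :: complex assume "z \<in> sphere 0 1"
      then have "z = cis (Arg2pi z)"
        using Arg2pi_eq[of z] by (simp add: cis_conv_exp)
      then have "z = \<phi> 1 (Arg2pi z / (2 * pi))" by (simp add: ph)
      moreover have "Arg2pi z / (2 * pi) \<in> {0..1}"
        using Arg2pi_ge_0[of z] Arg2pi_lt_2pi[of z] by (auto simp: divide_simps)
      ultimately show "z \<in> \<phi> 1 ` {0..1}" by blast
    qed
  qed auto
  have "continuous_on (\<phi> 1 ` {0..1}) G"
    unfolding continuous_on_closed_invariant
  proof (intro allI impI)
    fix B :: "real set" assume "closed B"
    then have "closed ({0..1} \<inter> g -` B)"
      using continuous_closed_preimage[OF g] by (simp add: Int_commute)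
    then have "compact ({0..1} \<inter> g -` B)"
      by (simp add: compact_eq_bounded_closed bounded_Int)
    then have "compact (\<phi> 1 ` ({0..1} \<inter> g -` B))"
      by (rule compact_continuous_image[OF phi_continuous])
    moreover have "\<phi> 1 ` ({0..1} \<inter> g -` B) \<inter> \<phi> 1 ` {0..1} = G -` B \<inter> \<phi> 1 ` {0..1}"
    proof (intro equalityI subsetI)
      fix z assume "z \<in> G -` B \<inter> \<phi> 1 ` {0..1}"
      then obtain t where "t \<in> {0..1}" "z = \<phi> 1 t" "g t \<in> B" using G by auto
      then show "z \<in> \<phi> 1 ` ({0..1} \<inter> g -` B) \<inter> \<phi> 1 ` {0..1}" by auto
    next
      fix z assume "z \<in> \<phi> 1 ` ({0..1} \<inter> g -` B) \<inter> \<phi> 1 ` {0..1}"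
      then show "z \<in> G -` B \<inter> \<phi> 1 ` {0..1}" using G by fastforce
    qed
    ultimately show "\<exists>A. closed A \<and> A \<inter> \<phi> 1 ` {0..1} = G -` B \<inter> \<phi> 1 ` {0..1}"
      using compact_imp_closed by blast
  qed
  then show ?thesis using that G im by simp
qed

definition trig_poly :: "(real \<Rightarrow> complex) \<Rightarrow> bool" where
  "trig_poly q \<longleftrightarrow> (\<exists>F a. finite F \<and> q = (\<lambda>t. \<Sum>k\<in>F. a k * \<phi> k t))"

lemma trig_poly_cmult_phi: "trig_poly (\<lambda>t. a * \<phi> k t)"
  unfolding trig_poly_def by (rule exI[of _ "{k}"], rule exI[of _ "\<lambda>_. a"]) simp

lemma trig_poly_add:
  assumes "trig_poly p" "trig_poly q"
  shows "trig_poly (\<lambda>t. p t + q t)"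
proof -
  obtain F a G b where F: "finite F" "p = (\<lambda>t. \<Sum>k\<in>F. a k * \<phi> k t)"
    and G: "finite G" "q = (\<lambda>t. \<Sum>k\<in>G. b k * \<phi> k t)"
    using assms by (auto simp: trig_poly_def)
  have "p t + q t = (\<Sum>k\<in>F \<union> G. (of_bool (k \<in> F) * a k + of_bool (k \<in> G) * b k) * \<phi> k t)" for t
  proof -
    have "p t = (\<Sum>k\<in>F \<union> G. of_bool (k \<in> F) * a k * \<phi> k t)"
      unfolding F(2) by (rule sum.mono_neutral_cong_left) (use F G in auto)
    moreover have "q t = (\<Sum>k\<in>F \<union> G. of_bool (k \<in> G) * b k * \<phi> k t)"
      unfolding G(2) by (rule sum.mono_neutral_cong_left) (use F G in auto)
    ultimately show ?thesis by (simp add: sum.distrib distrib_right)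
  qed
  then show ?thesis unfolding trig_poly_def
    by (intro exI[of _ "F \<union> G"] exI[of _ "\<lambda>k. of_bool (k \<in> F) * a k + of_bool (k \<in> G) * b k"])
       (simp add: F(1) G(1))
qed

lemma trig_poly_sum:
  assumes "\<And>i. i \<in> I \<Longrightarrow> trig_poly (f i)"
  shows "trig_poly (\<lambda>t. \<Sum>i\<in>I. f i t)"
  using assms
proof (induction I rule: infinite_finite_induct)
  case (insert i I)
  then show ?case using trig_poly_add[of "f i" "\<lambda>t. \<Sum>i\<in>I. f i t"] by simp
qed (use trig_poly_cmult_phi[of 0 0] in auto)

lemma trig_poly_mult:
  assumes "trig_poly p" "trig_poly q"
  shows "trig_poly (\<lambda>t. p t * q t)"
proof -
  obtain F a G b where F: "finite F" "p = (\<lambda>t. \<Sum>k\<in>F. a k * \<phi> k t)"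
    and G: "finite G" "q = (\<lambda>t. \<Sum>k\<in>G. b k * \<phi> k t)"
    using assms by (auto simp: trig_poly_def)
  have "p t * q t = (\<Sum>j\<in>F. \<Sum>k\<in>G. (a j * b k) * \<phi> (j + k) t)" for t
    unfolding F G sum_product phi_mult[symmetric] by (simp only: mult_ac)
  then show ?thesis
    by (simp add: trig_poly_sum trig_poly_cmult_phi)
qed

text \<open>On the circle \<open>Re z\<close> and \<open>Im z\<close> are linear combinations of
  \<open>z\<close> and \<open>cnj z\<close>, that is, of \<open>\<phi> 1\<close> and
  \<open>\<phi> (-1)\<close>. The other cases of the induction are closure under sums and
  products.\<close>

lemma trig_poly_real_polynomial:
  fixes P :: "complex \<Rightarrow> real"
  assumes "real_polynomial_function P"
  shows "trig_poly (\<lambda>t. of_real (P (\<phi> 1 t)))"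
  using assms
proof induction
  case (linear f)
  interpret bounded_linear f by fact
  have lin: "f z = Re z * f 1 + Im z * f \<i>" for z
  proof -
    have "f z = f (Re z *\<^sub>R 1 + Im z *\<^sub>R \<i>)"
      by (rule arg_cong[of _ _ f]) (simp add: complex_eq_iff)
    also have "\<dots> = Re z * f 1 + Im z * f \<i>"
      unfolding add scaleR by simp
    finally show ?thesis .
  qed
  have alg: "of_real (Re z * u + Im z * v)
      = ((of_real u - \<i> * of_real v) / 2) * z + ((of_real u + \<i> * of_real v) / 2) * cnj z"
    for z and u v :: real
    by (simp add: complex_eq_iff field_simps)
  have "of_real (f (\<phi> 1 t)) = ((of_real (f 1) - \<i> * of_real (f \<i>)) / 2) * \<phi> 1 t
      + ((of_real (f 1) + \<i> * of_real (f \<i>)) / 2) * \<phi> (-1) t" for t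
    unfolding cnj_phi[symmetric] lin[of "\<phi> 1 t"] by (rule alg)
  then show ?case
    by (simp only: trig_poly_add[OF trig_poly_cmult_phi trig_poly_cmult_phi])
next
  case (const c)
  show ?case using trig_poly_cmult_phi[of "of_real c" 0] by (simp add: \<phi>_def)
next
  case (add f g)
  show ?case using trig_poly_add[OF add.IH] by simp
next
  case (mult f g)
  show ?case using trig_poly_mult[OF mult.IH] by simp
qed

lemma trig_poly_uniform_approx:
  fixes g :: "real \<Rightarrow> real"
  assumes g: "continuous_on {0..1} g" and g01: "g 0 = g 1" and e: "e > 0"
  shows "\<exists>q. trig_poly q \<and> (\<forall>t\<in>{0..1}. cmod (of_real (g t) - q t) < e)"
proof -
  obtain G where G: "continuous_on (sphere 0 1) G" "\<And>t. t \<in> {0..1} \<Longrightarrow> G (\<phi> 1 t) = g t"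
    using circle_continuous[OF g g01] by blast
  obtain P where P: "real_polynomial_function P" "\<And>z. z \<in> sphere 0 1 \<Longrightarrow> \<bar>G z - P z\<bar> < e"
    using Stone_Weierstrass_real_polynomial_function[OF compact_sphere G(1) e] by metis
  have "cmod (of_real (g t) - of_real (P (\<phi> 1 t))) < e" if "t \<in> {0..1}" for t
  proof -
    have "\<bar>g t - P (\<phi> 1 t)\<bar> < e" using P(2)[of "\<phi> 1 t"] G(2)[OF that] by simp
    then show ?thesis unfolding of_real_diff[symmetric] norm_of_real .
  qed
  then show ?thesis
    by (intro exI[of _ "\<lambda>t. of_real (P (\<phi> 1 t))"] conjI ballI trig_poly_real_polynomial P(1))
qed

section \<open>Density in mean square and Parseval's identity\<close>

lemma borel_measurable_unit:
  fixes f :: "real \<Rightarrow> 'b::topological_space"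
  assumes "f \<in> borel_measurable borel"
  shows "f \<in> borel_measurable unit_leb"
  using assms by (intro measurable_restrict_space1 measurable_completion) simp

lemma truncation_approx:
  fixes f :: "real \<Rightarrow> real"
  assumes [measurable]: "f \<in> borel_measurable unit_leb"
    and f2: "integrable unit_leb (\<lambda>t. (f t)\<^sup>2)" and e: "e > 0"
  shows "\<exists>B>0. (\<integral>t. (f t - max (- B) (min B (f t)))\<^sup>2 \<partial>unit_leb) < e"
proof -
  let ?s = "\<lambda>n t. (f t - max (- real n) (min (real n) (f t)))\<^sup>2"
  have lim: "(\<lambda>n. ?s n t) \<longlonglongrightarrow> 0" for t
  proof -
    obtain N where N: "\<bar>f t\<bar> \<le> real N" using real_arch_simple by blast
    then have "eventually (\<lambda>n. ?s n t = 0) sequentially"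
      by (intro eventually_sequentiallyI[of N]) auto
    then show ?thesis by (rule tendsto_eventually)
  qed
  have bound: "norm (?s n t) \<le> (f t)\<^sup>2" for n t
  proof -
    have "\<bar>f t - max (- real n) (min (real n) (f t))\<bar> \<le> \<bar>f t\<bar>" by linarith
    then show ?thesis by (simp add: abs_le_square_iff)
  qed
  have "(\<lambda>n. \<integral>t. ?s n t \<partial>unit_leb) \<longlonglongrightarrow> (\<integral>t. 0 \<partial>unit_leb)"
    by (rule integral_dominated_convergence[where w = "\<lambda>t. (f t)\<^sup>2"])
       (use f2 lim bound in auto)
  then have "eventually (\<lambda>n. (\<integral>t. ?s n t \<partial>unit_leb) < e) sequentially"
    using e by (intro order_tendstoD(2)[where y = "\<integral>t. 0 \<partial>unit_leb"]) auto
  then have "eventually (\<lambda>n. (\<integral>t. ?s n t \<partial>unit_leb) < e \<and> n > 0) sequentially"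
    by (intro eventually_conj eventually_gt_at_top)
  then obtain n where "(\<integral>t. ?s n t \<partial>unit_leb) < e" "n > 0"
    by (auto simp: eventually_sequentially)
  then show ?thesis by (intro exI[of _ "real n"]) auto
qed

text \<open>A measurable function is almost everywhere a limit of continuous ones. Clipping these at
  \<open>B\<close> supplies the domination, and a factor vanishing at 0 and 1 makes the two end
  values agree, as the passage to the circle requires.\<close>

lemma continuous_approx_bounded:
  fixes h :: "real \<Rightarrow> real"
  assumes h [measurable]: "h \<in> borel_measurable unit_leb" and B: "\<And>t. \<bar>h t\<bar> \<le> B" and e: "e > 0"
  shows "\<exists>g. continuous_on UNIV g \<and> g 0 = 0 \<and> g 1 = 0 \<and> (\<integral>t. (h t - g t)\<^sup>2 \<partial>unit_leb) < e"
proof -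
  have B0: "0 \<le> B" using B[of 0] by linarith
  have "h measurable_on {0..1}"
    using measurable_on_iff_borel_measurable[of "{0..1}" h] h by simp
  then obtain N u where N: "negligible N" and u: "\<And>n. continuous_on UNIV (u n)"
    and lim: "\<And>t. t \<notin> N \<Longrightarrow> (\<lambda>n. u n t) \<longlonglongrightarrow> (if t \<in> {0..1} then h t else 0)"
    unfolding measurable_on_def by blast
  \<comment> \<open>The first factor is 0 at both endpoints for every n and tends to 1 at each
    interior point.\<close>
  define w where "w = (\<lambda>n t. max 0 (min 1 (real n * (t * (1 - t)))) * max (- B) (min B (u n t)))"
  have w_cont: "continuous_on UNIV (w n)" for n
    unfolding w_def by (intro continuous_intros u)
  have [measurable]: "w n \<in> borel_measurable unit_leb" for n
    using borel_measurable_continuous_onI[OF w_cont]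
    by (rule borel_measurable_unit)
  have wB: "\<bar>w n t\<bar> \<le> B" for n t
  proof -
    have "\<bar>w n t\<bar> \<le> 1 * B"
      unfolding w_def abs_mult using B0 by (intro mult_mono) auto
    then show ?thesis by simp
  qed
  have AEN: "AE t in unit_leb. t \<notin> N"
  proof -
    have "AE t in lebesgue. t \<notin> N"
      using N by (intro AE_not_in) (simp add: negligible_iff_null_sets)
    then show ?thesis by (subst AE_restrict_space_iff) (auto elim: eventually_mono)
  qed
  have wlim: "(\<lambda>n. w n t) \<longlonglongrightarrow> h t" if t: "0 < t" "t < 1" "t \<notin> N" for t
  proof -
    have pos: "0 < t * (1 - t)" using t by simp
    obtain M where M: "1 / (t * (1 - t)) \<le> real M" using real_arch_simple by blast
    have "max 0 (min 1 (real n * (t * (1 - t)))) = 1" if "M \<le> n" for n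
    proof -
      have "1 \<le> real M * (t * (1 - t))"
        using M unfolding pos_divide_le_eq[OF pos] .
      also have "\<dots> \<le> real n * (t * (1 - t))"
        using that pos by (intro mult_right_mono) auto
      finally show ?thesis by simp
    qed
    then have "eventually (\<lambda>n. max 0 (min 1 (real n * (t * (1 - t)))) = 1) sequentially"
      by (intro eventually_sequentiallyI[of M]) auto
    then have "(\<lambda>n. max 0 (min 1 (real n * (t * (1 - t))))) \<longlonglongrightarrow> 1"
      by (rule tendsto_eventually)
    moreover have "(\<lambda>n. max (- B) (min B (u n t))) \<longlonglongrightarrow> max (- B) (min B (h t))"
      using lim[OF t(3)] t by (intro tendsto_intros) auto
    moreover have "max (- B) (min B (h t)) = h t" using B[of t] by auto
    ultimately show ?thesis
      unfolding w_def using tendsto_mult[of _ 1 sequentially _ "h t"] by simp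
  qed
  have "(\<lambda>n. \<integral>t. (h t - w n t)\<^sup>2 \<partial>unit_leb) \<longlonglongrightarrow> (\<integral>t. 0 \<partial>unit_leb)"
  proof (rule integral_dominated_convergence[where w = "\<lambda>t. (2 * B)\<^sup>2"])
    show "AE t in unit_leb. (\<lambda>n. (h t - w n t)\<^sup>2) \<longlonglongrightarrow> 0"
      using AEN AE_unit_interior AE_space
    proof eventually_elim
      case (elim t)
      then have "(\<lambda>n. w n t) \<longlonglongrightarrow> h t" by (intro wlim) auto
      then have "(\<lambda>n. (h t - w n t)\<^sup>2) \<longlonglongrightarrow> (h t - h t)\<^sup>2" by (intro tendsto_intros)
      then show ?case by simp
    qed
    have "\<bar>h t - w n t\<bar> \<le> \<bar>2 * B\<bar>" for n t
      using B[of t] wB[of n t] by linarith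
    then show "AE t in unit_leb. norm ((h t - w n t)\<^sup>2) \<le> (2 * B)\<^sup>2" for n
      unfolding abs_le_square_iff by simp
  qed auto
  then have "eventually (\<lambda>n. (\<integral>t. (h t - w n t)\<^sup>2 \<partial>unit_leb) < e) sequentially"
    using e by (intro order_tendstoD(2)[where y = "\<integral>t. 0 \<partial>unit_leb"]) auto
  then obtain n where "(\<integral>t. (h t - w n t)\<^sup>2 \<partial>unit_leb) < e"
    by (auto simp: eventually_sequentially)
  then show ?thesis using w_cont by (intro exI[of _ "w n"]) (simp add: w_def)
qed

lemma trig_poly_in_L2: "trig_poly q \<Longrightarrow> q \<in> L2"
  unfolding trig_poly_def using trig_in_L2 by blast

lemma cfun_L2D:
  assumes "cfun f \<in> L2"
  shows "f \<in> borel_measurable unit_leb" "integrable unit_leb (\<lambda>t. (f t)\<^sup>2)"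
  using L2D[OF assms] measurable_compose[OF L2D(1)[OF assms] borel_measurable_Re] by simp_all

lemma trig_poly_dense:
  assumes f: "cfun f \<in> L2" and e: "e > 0"
  shows "\<exists>q. trig_poly q \<and> (\<integral>t. (cmod (cfun f t - q t))\<^sup>2 \<partial>unit_leb) < e"
proof -
  note fD = cfun_L2D[OF f]
  note [measurable] = fD(1)
  \<comment> \<open>Truncation, smoothing and trigonometric approximation each contribute a mean
    square error of at most e / 9, and \<open>sq3\<close> multiplies each of them by 3.\<close>
  have e9: "e / 9 > 0" using e by simp
  obtain B where B: "B > 0" "(\<integral>t. (f t - max (- B) (min B (f t)))\<^sup>2 \<partial>unit_leb) < e / 9"
    using truncation_approx[OF fD e9] by blast
  define h where "h = (\<lambda>t. max (- B) (min B (f t)))"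
  have [measurable]: "h \<in> borel_measurable unit_leb" unfolding h_def by measurable
  have hB: "\<bar>h t\<bar> \<le> B" for t unfolding h_def using B(1) by auto
  obtain g where g: "continuous_on UNIV g" "g 0 = 0" "g 1 = 0"
      "(\<integral>t. (h t - g t)\<^sup>2 \<partial>unit_leb) < e / 9"
    using continuous_approx_bounded[where h = h and B = B, OF _ hB e9] by auto
  have [measurable]: "g \<in> borel_measurable unit_leb"
    using borel_measurable_continuous_onI[OF g(1)]
    by (rule borel_measurable_unit)
  have "compact (g ` {0..1})"
    by (rule compact_continuous_image) (auto intro: continuous_on_subset[OF g(1)])
  then obtain K where "\<forall>x\<in>g ` {0..1}. norm x \<le> K"
    using compact_imp_bounded[of "g ` {0..1}"] unfolding bounded_iff by blast
  then have K: "\<bar>g t\<bar> \<le> K" if "t \<in> {0..1}" for t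
    using that by auto
  obtain q where q: "trig_poly q" "\<And>t. t \<in> {0..1} \<Longrightarrow> cmod (of_real (g t) - q t) < sqrt (e / 9)"
    using trig_poly_uniform_approx[of g "sqrt (e / 9)"] g e continuous_on_subset[OF g(1)] by auto
  note [measurable] = L2D(1)[OF trig_poly_in_L2[OF q(1)]]
  have gq: "(cmod (of_real (g t) - q t))\<^sup>2 \<le> e / 9" if "t \<in> {0..1}" for t
  proof -
    have "(cmod (of_real (g t) - q t))\<^sup>2 \<le> (sqrt (e / 9))\<^sup>2"
      using q(2)[OF that] by (intro power_mono) auto
    then show ?thesis using e by simp
  qed
  have sq3: "(a + b + c)\<^sup>2 \<le> 3 * a\<^sup>2 + 3 * b\<^sup>2 + 3 * c\<^sup>2" for a b c :: real
    using sum_squares_bound[of a b] sum_squares_bound[of a c] sum_squares_bound[of b c]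
    by (simp add: power2_eq_square algebra_simps)
  have le: "(cmod (cfun f t - q t))\<^sup>2 \<le> 3 * (f t - h t)\<^sup>2 + 3 * (h t - g t)\<^sup>2 + 3 * (e / 9)"
    if "t \<in> {0..1}" for t
  proof -
    have "cfun f t - q t = of_real (f t - h t) + of_real (h t - g t) + (of_real (g t) - q t)"
      by simp
    moreover have "cmod (x + y + z) \<le> cmod x + cmod y + cmod z" for x y z :: complex
      using norm_triangle_ineq[of "x + y" z] norm_triangle_ineq[of x y] by linarith
    ultimately have "cmod (cfun f t - q t) \<le> \<bar>f t - h t\<bar> + \<bar>h t - g t\<bar> + cmod (of_real (g t) - q t)"
      by (metis norm_of_real)
    then have "(cmod (cfun f t - q t))\<^sup>2
        \<le> (\<bar>f t - h t\<bar> + \<bar>h t - g t\<bar> + cmod (of_real (g t) - q t))\<^sup>2"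
      by (intro power_mono) auto
    also note sq3
    also have "3 * \<bar>f t - h t\<bar>\<^sup>2 + 3 * \<bar>h t - g t\<bar>\<^sup>2 + 3 * (cmod (of_real (g t) - q t))\<^sup>2
        \<le> 3 * (f t - h t)\<^sup>2 + 3 * (h t - g t)\<^sup>2 + 3 * (e / 9)"
      using gq[OF that] by simp
    finally show ?thesis .
  qed
  have i1: "integrable unit_leb (\<lambda>t. (f t - h t)\<^sup>2)"
  proof (rule Bochner_Integration.integrable_bound[OF fD(2)])
    have "\<bar>f t - h t\<bar> \<le> \<bar>f t\<bar>" for t unfolding h_def using B(1) by linarith
    then show "AE t in unit_leb. norm ((f t - h t)\<^sup>2) \<le> norm ((f t)\<^sup>2)"
      unfolding abs_le_square_iff by simp
  qed simp
  have i2: "integrable unit_leb (\<lambda>t. (h t - g t)\<^sup>2)"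
  proof (rule unit.integrable_const_bound[of _ "(B + K)\<^sup>2"])
    show "AE t in unit_leb. norm ((h t - g t)\<^sup>2) \<le> (B + K)\<^sup>2"
    proof (rule AE_I2)
      fix t :: real assume "t \<in> space unit_leb"
      then have "\<bar>h t - g t\<bar> \<le> \<bar>B + K\<bar>" using hB[of t] K[of t] by auto
      then show "norm ((h t - g t)\<^sup>2) \<le> (B + K)\<^sup>2" unfolding abs_le_square_iff by simp
    qed
  qed simp
  have "(\<integral>t. (cmod (cfun f t - q t))\<^sup>2 \<partial>unit_leb)
      \<le> (\<integral>t. 3 * (f t - h t)\<^sup>2 + 3 * (h t - g t)\<^sup>2 + 3 * (e / 9) \<partial>unit_leb)"
  proof (rule integral_mono)
    show "integrable unit_leb (\<lambda>t. (cmod (cfun f t - q t))\<^sup>2)"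
      by (rule L2D(2)[OF L2_diff[OF f trig_poly_in_L2[OF q(1)]]])
    show "integrable unit_leb (\<lambda>t. 3 * (f t - h t)\<^sup>2 + 3 * (h t - g t)\<^sup>2 + 3 * (e / 9))"
      using i1 i2 by simp
    show "(cmod (cfun f t - q t))\<^sup>2 \<le> 3 * (f t - h t)\<^sup>2 + 3 * (h t - g t)\<^sup>2 + 3 * (e / 9)"
      if "t \<in> space unit_leb" for t
      using that by (intro le) simp
  qed
  also have "\<dots> = 3 * (\<integral>t. (f t - h t)\<^sup>2 \<partial>unit_leb) + 3 * (\<integral>t. (h t - g t)\<^sup>2 \<partial>unit_leb) + 3 * (e / 9)"
    using i1 i2 unit.prob_space by simp
  also have "\<dots> < e"
    using B(2) g(4) unfolding h_def by linarith
  finally show ?thesis using q(1) by blast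
qed

lemma finite_subset_int_interval:
  fixes F :: "int set"
  assumes "finite F"
  shows "\<exists>J. F \<subseteq> {-int J..int J}"
proof -
  obtain B where B: "\<And>k. k \<in> F \<Longrightarrow> \<bar>k\<bar> \<le> B"
    using bdd_above_finite[of "abs ` F"] assms by (auto simp: bdd_above_def)
  have "F \<subseteq> {-int (nat B)..int (nat B)}"
  proof
    fix k assume "k \<in> F"
    then have "\<bar>k\<bar> \<le> B" by (rule B)
    then show "k \<in> {-int (nat B)..int (nat B)}" by auto
  qed
  then show ?thesis by blast
qed

text \<open>Density only provides some trigonometric polynomial \<open>q\<close> close to
  \<open>f\<close>. Once J covers the frequencies of \<open>q\<close>, the Fourier partial sum is at
  least as close, because it minimises the error among polynomials with those frequencies.\<close>

lemma trig_approx_tendsto: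
  assumes f: "cfun f \<in> L2"
  shows "(\<lambda>J. \<integral>t. (cmod (cfun f t - (\<Sum>k\<in>{-int J..int J}. l2_inner (cfun f) (\<phi> k) * \<phi> k t)))\<^sup>2 \<partial>unit_leb)
           \<longlonglongrightarrow> 0" (is "?d \<longlonglongrightarrow> 0")
proof (rule LIMSEQ_I)
  fix e :: real assume e: "e > 0"
  obtain q where "trig_poly q" and q: "(\<integral>t. (cmod (cfun f t - q t))\<^sup>2 \<partial>unit_leb) < e"
    using trig_poly_dense[OF f e] by blast
  then obtain F a where F: "finite F" "q = (\<lambda>t. \<Sum>k\<in>F. a k * \<phi> k t)"
    by (auto simp: trig_poly_def)
  obtain N where N: "F \<subseteq> {-int N..int N}"
    using finite_subset_int_interval[OF F(1)] by blast
  have "norm (?d J - 0) < e" if "J \<ge> N" for J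
  proof -
    have sub: "F \<subseteq> {-int J..int J}" using N that by auto
    have "?d J = (\<integral>t. (cmod (cfun f t))\<^sup>2 \<partial>unit_leb)
        - (\<Sum>k\<in>{-int J..int J}. (cmod (l2_inner (cfun f) (\<phi> k)))\<^sup>2)"
      by (subst trig_approx_error[OF f]) auto
    also have "\<dots> \<le> (\<integral>t. (cmod (cfun f t))\<^sup>2 \<partial>unit_leb)
        - (\<Sum>k\<in>F. (cmod (l2_inner (cfun f) (\<phi> k)))\<^sup>2)"
      using sub by (intro diff_left_mono sum_mono2) auto
    also have "\<dots> \<le> (\<integral>t. (cmod (cfun f t - q t))\<^sup>2 \<partial>unit_leb)"
      unfolding F(2) trig_approx_error[OF f F(1)] by (simp add: sum_nonneg)
    also note q
    finally have "?d J < e" .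
    moreover have "0 \<le> ?d J" by simp
    ultimately show ?thesis by simp
  qed
  then show "\<exists>N. \<forall>J\<ge>N. norm (?d J - 0) < e" by blast
qed

lemma parseval:
  assumes f: "cfun f \<in> L2"
  shows "(\<lambda>J. \<Sum>k\<in>{-int J..int J}. (cmod (l2_inner (cfun f) (\<phi> k)))\<^sup>2)
           \<longlonglongrightarrow> (\<integral>t. (f t)\<^sup>2 \<partial>unit_leb)"
proof -
  have "(\<lambda>J. (\<integral>t. (f t)\<^sup>2 \<partial>unit_leb)
      - (\<integral>t. (cmod (cfun f t - (\<Sum>k\<in>{-int J..int J}. l2_inner (cfun f) (\<phi> k) * \<phi> k t)))\<^sup>2 \<partial>unit_leb))
      \<longlonglongrightarrow> (\<integral>t. (f t)\<^sup>2 \<partial>unit_leb) - 0"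
    by (intro tendsto_intros trig_approx_tendsto f)
  then show ?thesis
    by (simp add: trig_approx_error[OF f])
qed

section \<open>Fourier coefficients of random functions\<close>

lemma l2_inner_cfun_phi: "l2_inner (cfun f) (\<phi> k) = (\<integral>t. cfun f t * cnj (\<phi> k t) \<partial>unit_leb)"
  by (simp add: l2_inner_def)

lemma borel_measurable_cnj [measurable (raw)]:
  "f \<in> borel_measurable N \<Longrightarrow> (\<lambda>x. cnj (f x)) \<in> borel_measurable N"
  by (rule borel_measurable_continuous_on[of cnj]) (intro continuous_intros)

lemma l2_inner_commute: "l2_inner g f = cnj (l2_inner f g)"
proof -
  have "cnj (l2_inner f g) = (\<integral>t. cnj (f t * cnj (g t)) \<partial>unit_leb)"
    unfolding l2_inner_def by (rule Bochner_Integration.integral_cnj[symmetric])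
  then show ?thesis unfolding l2_inner_def by (simp add: mult.commute)
qed

lemma norm_l2_inner_commute: "cmod (l2_inner g f) = cmod (l2_inner f g)"
  by (subst l2_inner_commute) simp

context prob_space
begin

lemma pair_unit: "pair_sigma_finite M unit_leb"
  by (intro pair_sigma_finite.intro sigma_finite_measure_axioms unit.sigma_finite_measure_axioms)

context
  fixes X :: "'a \<Rightarrow> real \<Rightarrow> real"
  assumes rf: "random_function M X"
begin

lemma random_function_measurable [measurable]:
  "(\<lambda>(\<omega>, t). X \<omega> t) \<in> borel_measurable (M \<Otimes>\<^sub>M unit_leb)"
  using rf by (simp add: random_function_def)

lemma random_function_section:
  "\<omega> \<in> space M \<Longrightarrow> X \<omega> \<in> borel_measurable unit_leb"
  "t \<in> {0..1} \<Longrightarrow> (\<lambda>\<omega>. X \<omega> t) \<in> borel_measurable M"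
  using measurable_Pair2[OF random_function_measurable, of \<omega>]
    measurable_Pair1[OF random_function_measurable, of t] by simp_all

lemma random_function_integrable:
  "integrable (M \<Otimes>\<^sub>M unit_leb) (\<lambda>(\<omega>, t). (X \<omega> t)\<^sup>2)"
proof (rule integrableI_nonneg)
  interpret pair_sigma_finite M unit_leb by (rule pair_unit)
  have "(\<integral>\<^sup>+z. ennreal (case z of (\<omega>, t) \<Rightarrow> (X \<omega> t)\<^sup>2) \<partial>(M \<Otimes>\<^sub>M unit_leb)) = mean_sq_norm M X"
    unfolding mean_sq_norm_def
    by (subst unit.nn_integral_fst[symmetric]) auto
  then show "(\<integral>\<^sup>+z. ennreal (case z of (\<omega>, t) \<Rightarrow> (X \<omega> t)\<^sup>2) \<partial>(M \<Otimes>\<^sub>M unit_leb)) < \<infinity>"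
    using rf by (simp add: random_function_def)
qed auto

lemma random_function_L2: "AE \<omega> in M. cfun (X \<omega>) \<in> L2"
proof -
  interpret pair_sigma_finite M unit_leb by (rule pair_unit)
  have "AE \<omega> in M. integrable unit_leb (\<lambda>t. (X \<omega> t)\<^sup>2)"
    using AE_integrable_fst[OF random_function_integrable] .
  then show ?thesis
    using AE_space
    by eventually_elim (auto simp: L2_def intro!: borel_measurable_of_real random_function_section)
qed

lemma sq_norm_measurable [measurable]: "(\<lambda>\<omega>. \<integral>t. (X \<omega> t)\<^sup>2 \<partial>unit_leb) \<in> borel_measurable M"
  by (rule unit.borel_measurable_lebesgue_integral) measurable

lemma sq_norm_nn: "(\<integral>\<^sup>+\<omega>. ennreal (\<integral>t. (X \<omega> t)\<^sup>2 \<partial>unit_leb) \<partial>M) = mean_sq_norm M X"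
  unfolding mean_sq_norm_def
proof (rule nn_integral_cong_AE)
  show "AE \<omega> in M. ennreal (\<integral>t. (X \<omega> t)\<^sup>2 \<partial>unit_leb) = (\<integral>\<^sup>+t. ennreal ((X \<omega> t)\<^sup>2) \<partial>unit_leb)"
    using random_function_L2
    by eventually_elim (subst nn_integral_eq_integral, auto dest: cfun_L2D(2))
qed

lemma coef_measurable [measurable]: "(\<lambda>\<omega>. l2_inner (cfun (X \<omega>)) (\<phi> k)) \<in> borel_measurable M"
  unfolding l2_inner_def by (rule unit.borel_measurable_lebesgue_integral) measurable

lemma sq_norm_integrable: "integrable M (\<lambda>\<omega>. \<integral>t. (X \<omega> t)\<^sup>2 \<partial>unit_leb)"
  using rf by (intro integrableI_nonneg) (auto simp: sq_norm_nn random_function_def)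

lemma coef_sq_le: "AE \<omega> in M. (cmod (l2_inner (cfun (X \<omega>)) (\<phi> k)))\<^sup>2 \<le> (\<integral>t. (X \<omega> t)\<^sup>2 \<partial>unit_leb)"
  using random_function_L2
proof eventually_elim
  case (elim \<omega>)
  then show ?case using bessel[OF elim, of "{k}"] by simp
qed

lemma coef_sq_integrable: "integrable M (\<lambda>\<omega>. (cmod (l2_inner (cfun (X \<omega>)) (\<phi> k)))\<^sup>2)"
  by (rule Bochner_Integration.integrable_bound[OF sq_norm_integrable]) (use coef_sq_le in auto)

text \<open>The hypotheses on means and covariances are pointwise in time, whereas the estimator
  sees only Fourier coefficients. This exchange of expectation and time integral is the bridge
  between the two; the sum of the squares of \<open>V\<close> and \<open>X\<close> dominates the
  integrand.\<close>

lemma fubini_random_function: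
  fixes V :: "'a \<Rightarrow> complex" and g :: "real \<Rightarrow> complex"
  assumes [measurable]: "V \<in> borel_measurable M" "g \<in> borel_measurable unit_leb"
    and V: "integrable M (\<lambda>\<omega>. (cmod (V \<omega>))\<^sup>2)" and g: "\<And>t. cmod (g t) \<le> 1"
  shows "(\<integral>\<omega>. V \<omega> * (\<integral>t. cfun (X \<omega>) t * g t \<partial>unit_leb) \<partial>M)
       = (\<integral>t. g t * (\<integral>\<omega>. V \<omega> * of_real (X \<omega> t) \<partial>M) \<partial>unit_leb)"
proof -
  interpret pair_sigma_finite M unit_leb by (rule pair_unit)
  have "integrable (M \<Otimes>\<^sub>M unit_leb) (\<lambda>z. (cmod (V (fst z)))\<^sup>2)"
    by (rule Fubini_integrable) (use V in \<open>auto simp: unit.prob_space\<close>)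
  then have "integrable (M \<Otimes>\<^sub>M unit_leb) (\<lambda>(\<omega>, t). (cmod (V \<omega>))\<^sup>2 + (X \<omega> t)\<^sup>2)"
    using random_function_integrable by (auto simp: case_prod_beta')
  then have int: "integrable (M \<Otimes>\<^sub>M unit_leb) (\<lambda>(\<omega>, t). V \<omega> * (cfun (X \<omega>) t * g t))"
  proof (rule Bochner_Integration.integrable_bound)
    have "cmod (V \<omega> * (cfun (X \<omega>) t * g t)) \<le> (cmod (V \<omega>))\<^sup>2 + (X \<omega> t)\<^sup>2" for \<omega> t
    proof -
      have "cmod (V \<omega> * (cfun (X \<omega>) t * g t)) \<le> cmod (V \<omega>) * (\<bar>X \<omega> t\<bar> * 1)"
        unfolding norm_mult by (intro mult_left_mono mult_mono g) auto
      also have "\<dots> \<le> (cmod (V \<omega>))\<^sup>2 + (X \<omega> t)\<^sup>2"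
        using sum_squares_bound[of "cmod (V \<omega>)" "\<bar>X \<omega> t\<bar>"]
          mult_nonneg_nonneg[OF norm_ge_zero[of "V \<omega>"] abs_ge_zero[of "X \<omega> t"]]
        unfolding power2_abs mult_1_right by linarith
      finally show ?thesis .
    qed
    then show "AE z in M \<Otimes>\<^sub>M unit_leb. norm (case z of (\<omega>, t) \<Rightarrow> V \<omega> * (cfun (X \<omega>) t * g t))
        \<le> norm (case z of (\<omega>, t) \<Rightarrow> (cmod (V \<omega>))\<^sup>2 + (X \<omega> t)\<^sup>2)"
      by (intro AE_I2) (auto split: prod.splits)
  qed measurable
  have "(\<integral>\<omega>. V \<omega> * (\<integral>t. cfun (X \<omega>) t * g t \<partial>unit_leb) \<partial>M)
      = (\<integral>\<omega>. (\<integral>t. V \<omega> * (cfun (X \<omega>) t * g t) \<partial>unit_leb) \<partial>M)"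
    by simp
  also have "\<dots> = (\<integral>t. (\<integral>\<omega>. V \<omega> * (cfun (X \<omega>) t * g t) \<partial>M) \<partial>unit_leb)"
    by (rule Fubini_integral[OF int, symmetric])
  also have "\<dots> = (\<integral>t. g t * (\<integral>\<omega>. V \<omega> * of_real (X \<omega> t) \<partial>M) \<partial>unit_leb)"
  proof (rule Bochner_Integration.integral_cong[OF refl])
    fix t
    have "(\<integral>\<omega>. V \<omega> * (cfun (X \<omega>) t * g t) \<partial>M) = (\<integral>\<omega>. g t * (V \<omega> * of_real (X \<omega> t)) \<partial>M)"
      by (simp add: mult_ac)
    then show "(\<integral>\<omega>. V \<omega> * (cfun (X \<omega>) t * g t) \<partial>M) = g t * (\<integral>\<omega>. V \<omega> * of_real (X \<omega> t) \<partial>M)"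
      by simp
  qed
  finally show ?thesis .
qed

text \<open>Bessel's inequality under the expectation. These sums are the finite budgets against
  which contributions of infinitely many frequencies are summed later.\<close>

lemma sum_coef_sq_le:
  assumes L: "mean_sq_norm M X \<le> ennreal \<Lambda>" "0 \<le> \<Lambda>" and F: "finite F"
  shows "(\<Sum>k\<in>F. \<integral>\<omega>. (cmod (l2_inner (cfun (X \<omega>)) (\<phi> k)))\<^sup>2 \<partial>M) \<le> \<Lambda>"
proof -
  have "(\<Sum>k\<in>F. \<integral>\<omega>. (cmod (l2_inner (cfun (X \<omega>)) (\<phi> k)))\<^sup>2 \<partial>M)
      = (\<integral>\<omega>. (\<Sum>k\<in>F. (cmod (l2_inner (cfun (X \<omega>)) (\<phi> k)))\<^sup>2) \<partial>M)"
    by (subst Bochner_Integration.integral_sum) (auto intro: coef_sq_integrable)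
  also have "\<dots> \<le> (\<integral>\<omega>. (\<integral>t. (X \<omega> t)\<^sup>2 \<partial>unit_leb) \<partial>M)"
  proof (rule integral_mono_AE)
    show "AE \<omega> in M. (\<Sum>k\<in>F. (cmod (l2_inner (cfun (X \<omega>)) (\<phi> k)))\<^sup>2) \<le> (\<integral>t. (X \<omega> t)\<^sup>2 \<partial>unit_leb)"
      using random_function_L2
    proof eventually_elim
      case (elim \<omega>)
      then show ?case using bessel[OF elim F] by simp
    qed
  qed (auto intro: coef_sq_integrable sq_norm_integrable)
  also have "\<dots> \<le> \<Lambda>"
  proof -
    have "ennreal (\<integral>\<omega>. (\<integral>t. (X \<omega> t)\<^sup>2 \<partial>unit_leb) \<partial>M) = mean_sq_norm M X"
      by (subst sq_norm_nn[symmetric], rule nn_integral_eq_integral[symmetric])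
         (auto intro: sq_norm_integrable)
    with L(1) have "ennreal (\<integral>\<omega>. (\<integral>t. (X \<omega> t)\<^sup>2 \<partial>unit_leb) \<partial>M) \<le> ennreal \<Lambda>" by simp
    with L(2) show ?thesis by simp
  qed
  finally show ?thesis .
qed

lemma coef_centered:
  assumes cso: "centered_second_order M X"
  shows "(\<integral>\<omega>. l2_inner (cfun (X \<omega>)) (\<phi> k) \<partial>M) = 0"
proof -
  have "(\<integral>\<omega>. l2_inner (cfun (X \<omega>)) (\<phi> k) \<partial>M)
      = (\<integral>t. cnj (\<phi> k t) * (\<integral>\<omega>. 1 * of_real (X \<omega> t) \<partial>M) \<partial>unit_leb)"
    unfolding l2_inner_def by (subst fubini_random_function[symmetric]) auto
  also have "\<dots> = (\<integral>t. 0 \<partial>unit_leb)"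
    using cso by (intro Bochner_Integration.integral_cong)
      (auto simp: centered_second_order_def)
  finally show ?thesis by simp
qed

lemma var_coef_eq:
  assumes cso: "centered_second_order M X"
  shows "var_coef M X k = (\<integral>\<omega>. (cmod (l2_inner (cfun (X \<omega>)) (\<phi> k)))\<^sup>2 \<partial>M)"
  unfolding var_coef_def cvar_def coef_centered[OF cso] by simp

lemma section_sq_integrable:
  assumes cso: "centered_second_order M X" and "t \<in> {0..1}"
  shows "integrable M (\<lambda>\<omega>. (cmod (complex_of_real (X \<omega> t)))\<^sup>2)"
  using assms by (simp add: centered_second_order_def)

end

declare random_function_measurable [measurable del]
declare sq_norm_measurable [measurable del]
declare coef_measurable [measurable del]

lemma uncorrelated_coef:
  fixes U :: "'a \<Rightarrow> real"
  assumes X: "random_function M X" and [measurable]: "U \<in> borel_measurable M"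
    and U: "integrable M (\<lambda>\<omega>. (U \<omega>)\<^sup>2)"
    and UX: "\<And>t. t \<in> {0..1} \<Longrightarrow> (\<integral>\<omega>. U \<omega> * X \<omega> t \<partial>M) = 0"
  shows "(\<integral>\<omega>. of_real (U \<omega>) * l2_inner (cfun (X \<omega>)) (\<phi> k) \<partial>M) = 0"
proof -
  have "(\<integral>\<omega>. of_real (U \<omega>) * l2_inner (cfun (X \<omega>)) (\<phi> k) \<partial>M)
      = (\<integral>t. cnj (\<phi> k t) * (\<integral>\<omega>. of_real (U \<omega>) * of_real (X \<omega> t) \<partial>M) \<partial>unit_leb)"
    unfolding l2_inner_def using U by (subst fubini_random_function[OF X]) auto
  also have "\<dots> = (\<integral>t. 0 \<partial>unit_leb)"
  proof (rule Bochner_Integration.integral_cong[OF refl])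
    fix t assume "t \<in> space unit_leb"
    then have "t \<in> {0..1}" by simp
    then have "(\<integral>\<omega>. complex_of_real (U \<omega> * X \<omega> t) \<partial>M) = 0"
      unfolding integral_complex_of_real using UX by simp
    then show "cnj (\<phi> k t) * (\<integral>\<omega>. of_real (U \<omega>) * of_real (X \<omega> t) \<partial>M) = 0" by simp
  qed
  finally show ?thesis by simp
qed

text \<open>Exchanging the expectation with the integral over t identifies the expectation of
  \<open>l2_inner (\<phi> j) (cfun (X \<omega>))\<close> times W at time s with \<open>T_WX\<close>.
  There the eigenfunction property applies, and a second exchange, over s, pairs the result with
  \<open>\<phi> k\<close>. Orthonormality removes all pairs with j \<noteq> k.\<close>

lemma cross_coef:
  assumes XW: "(X, W) \<in> stationary_pairs M"
  shows "(\<integral>\<omega>. l2_inner (\<phi> j) (cfun (X \<omega>)) * l2_inner (cfun (W \<omega>)) (\<phi> k) \<partial>M)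
       = of_bool (j = k) * c_coef M X W k"
proof -
  have rX: "random_function M X" and rW: "random_function M W"
    and cX: "centered_second_order M X" and cW: "centered_second_order M W"
    and T: "AE s in unit_leb. T_WX M X W (\<phi> j) s = c_coef M X W j * \<phi> j s"
    using XW by (auto simp: stationary_pairs_def)
  note [measurable] = coef_measurable[OF rX] coef_measurable[OF rW]
  have ji: "l2_inner (\<phi> j) (cfun (X \<omega>)) = (\<integral>t. cfun (X \<omega>) t * \<phi> j t \<partial>unit_leb)" for \<omega>
    by (simp add: l2_inner_def mult.commute)
  have [measurable]: "(\<lambda>\<omega>. l2_inner (\<phi> j) (cfun (X \<omega>))) \<in> borel_measurable M"
    by (subst l2_inner_commute) measurable
  let ?h = "\<lambda>s. \<integral>\<omega>. l2_inner (\<phi> j) (cfun (X \<omega>)) * of_real (W \<omega> s) \<partial>M"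
  have hT: "?h s = T_WX M X W (\<phi> j) s" if s: "s \<in> {0..1}" for s
  proof -
    have [measurable]: "(\<lambda>\<omega>. W \<omega> s) \<in> borel_measurable M"
      using random_function_section(2)[OF rW s] .
    have "(\<integral>\<omega>. l2_inner (\<phi> j) (cfun (X \<omega>)) * of_real (W \<omega> s) \<partial>M)
        = (\<integral>\<omega>. of_real (W \<omega> s) * (\<integral>t. cfun (X \<omega>) t * \<phi> j t \<partial>unit_leb) \<partial>M)"
      by (simp add: ji mult.commute)
    also have "\<dots> = (\<integral>t. \<phi> j t * (\<integral>\<omega>. of_real (W \<omega> s) * of_real (X \<omega> t) \<partial>M) \<partial>unit_leb)"
      using section_sq_integrable[OF rW cW s] by (intro fubini_random_function[OF rX]) auto
    also have "\<dots> = T_WX M X W (\<phi> j) s"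
      unfolding T_WX_def
    proof (rule Bochner_Integration.integral_cong[OF refl])
      fix t assume "t \<in> space unit_leb"
      then have t: "t \<in> {0..1}" by simp
      have "cov M (\<lambda>\<omega>. X \<omega> t) (\<lambda>\<omega>. W \<omega> s) = (\<integral>\<omega>. W \<omega> s * X \<omega> t \<partial>M)"
        using cX cW s t by (simp add: cov_def centered_second_order_def mult.commute)
      then have "complex_of_real (cov M (\<lambda>\<omega>. X \<omega> t) (\<lambda>\<omega>. W \<omega> s))
          = (\<integral>\<omega>. of_real (W \<omega> s * X \<omega> t) \<partial>M)"
        by (simp only: integral_complex_of_real)
      then show "\<phi> j t * (\<integral>\<omega>. of_real (W \<omega> s) * of_real (X \<omega> t) \<partial>M)
          = \<phi> j t * complex_of_real (cov M (\<lambda>\<omega>. X \<omega> t) (\<lambda>\<omega>. W \<omega> s))" by simp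
    qed
    finally show ?thesis .
  qed
  have "(\<lambda>(s, \<omega>). W \<omega> s) \<in> borel_measurable (unit_leb \<Otimes>\<^sub>M M)"
    using measurable_compose[OF measurable_pair_swap' random_function_measurable[OF rW]]
    by (simp add: case_prod_beta')
  note [measurable] = this
  \<comment> \<open>The eigenfunction replaces \<open>?h\<close> only almost everywhere, and the
    corresponding congruence of integrals asks for measurability.\<close>
  have [measurable]: "?h \<in> borel_measurable unit_leb"
    by (intro borel_measurable_lebesgue_integral) measurable
  have "(\<integral>\<omega>. l2_inner (\<phi> j) (cfun (X \<omega>)) * l2_inner (cfun (W \<omega>)) (\<phi> k) \<partial>M)
      = (\<integral>s. cnj (\<phi> k s) * (\<integral>\<omega>. l2_inner (\<phi> j) (cfun (X \<omega>)) * of_real (W \<omega> s) \<partial>M) \<partial>unit_leb)"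
    unfolding l2_inner_cfun_phi[of "W _"] using coef_sq_integrable[OF rX]
    by (intro fubini_random_function[OF rW]) (auto simp: norm_l2_inner_commute)
  also have "\<dots> = (\<integral>s. c_coef M X W j * (\<phi> j s * cnj (\<phi> k s)) \<partial>unit_leb)"
  proof (rule integral_cong_AE)
    show "AE s in unit_leb. cnj (\<phi> k s) * ?h s = c_coef M X W j * (\<phi> j s * cnj (\<phi> k s))"
      using T AE_space
    proof eventually_elim
      case (elim s)
      then have "?h s = c_coef M X W j * \<phi> j s" by (simp add: hT)
      then show ?case by (simp add: mult_ac)
    qed
  qed measurable
  also have "\<dots> = c_coef M X W j * l2_inner (\<phi> j) (\<phi> k)"
    by (simp add: l2_inner_def)
  also have "\<dots> = of_bool (j = k) * c_coef M X W k"
    by (simp add: l2_inner_phi)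
  finally show ?thesis .
qed

end

section \<open>Moments of sample means\<close>

text \<open>Used for nonnegative \<open>f\<close> only: \<open>ennreal\<close> sends negative values to \<open>0\<close>.\<close>

definition mean_le :: "'b measure \<Rightarrow> ('b \<Rightarrow> real) \<Rightarrow> real \<Rightarrow> bool" where
  "mean_le N f B \<longleftrightarrow> f \<in> borel_measurable N \<and> (\<integral>\<^sup>+x. ennreal (f x) \<partial>N) \<le> ennreal B"

section \<open>Calculus of bounds on expectations\<close>

lemma mean_le_integrable:
  assumes "mean_le N f B" and f: "\<And>x. 0 \<le> f x" and B: "0 \<le> B"
  shows "integrable N f" "(\<integral>x. f x \<partial>N) \<le> B"
proof -
  have [measurable]: "f \<in> borel_measurable N" and le: "(\<integral>\<^sup>+x. ennreal (f x) \<partial>N) \<le> ennreal B"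
    using assms by (auto simp: mean_le_def)
  show int: "integrable N f"
    using le by (intro integrableI_nonneg) (auto simp: f intro: le_less_trans)
  have "ennreal (\<integral>x. f x \<partial>N) \<le> ennreal B"
    using le nn_integral_eq_integral[OF int] f by simp
  with B show "(\<integral>x. f x \<partial>N) \<le> B" by simp
qed

lemma mean_leI_integral:
  assumes "integrable N f" "\<And>x. 0 \<le> f x" "(\<integral>x. f x \<partial>N) \<le> B"
  shows "mean_le N f B"
  using assms by (simp add: mean_le_def nn_integral_eq_integral ennreal_leI)

lemma mean_le_mono:
  assumes "mean_le N f A" "AE x in N. g x \<le> f x" "g \<in> borel_measurable N" "A \<le> B"
  shows "mean_le N g B"
proof -
  have "(\<integral>\<^sup>+x. ennreal (g x) \<partial>N) \<le> (\<integral>\<^sup>+x. ennreal (f x) \<partial>N)"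
    using assms(2) by (intro nn_integral_mono_AE) (auto elim!: eventually_mono intro: ennreal_leI)
  also have "\<dots> \<le> ennreal B"
    using assms by (auto simp: mean_le_def intro: order_trans ennreal_leI)
  finally show ?thesis using assms(3) by (simp add: mean_le_def)
qed

lemma mean_le_add:
  assumes "mean_le N f A" "mean_le N g B" "\<And>x. 0 \<le> f x" "\<And>x. 0 \<le> g x" "0 \<le> A" "0 \<le> B"
  shows "mean_le N (\<lambda>x. f x + g x) (A + B)"
  using assms by (auto simp: mean_le_def nn_integral_add intro: add_mono)

lemma mean_le_cmult:
  assumes "mean_le N f A" "0 \<le> c" "\<And>x. 0 \<le> f x" "0 \<le> A"
  shows "mean_le N (\<lambda>x. c * f x) (c * A)"
  using assms by (auto simp: mean_le_def nn_integral_cmult ennreal_mult mult_left_mono)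

lemma mean_le_sum:
  assumes "finite F" "\<And>k. k \<in> F \<Longrightarrow> mean_le N (f k) (A k)" "\<And>k x. 0 \<le> f k x" "\<And>k. 0 \<le> A k"
  shows "mean_le N (\<lambda>x. \<Sum>k\<in>F. f k x) (\<Sum>k\<in>F. A k)"
  using assms
proof (induction F)
  case (insert k F)
  then show ?case
    by (simp, intro mean_le_add) (auto intro: sum_nonneg)
qed (simp add: mean_le_def)

lemma (in prob_space) mean_le_const: "0 \<le> c \<Longrightarrow> mean_le M (\<lambda>_. c) c"
  by (simp add: mean_le_def emeasure_space_1)

lemma mean_le_mult:
  assumes f: "mean_le N (\<lambda>x. (f x)\<^sup>2) A" and g: "mean_le N (\<lambda>x. (g x)\<^sup>2) B"
    and [measurable]: "f \<in> borel_measurable N" "g \<in> borel_measurable N"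
    and nonneg: "\<And>x. 0 \<le> f x" "\<And>x. 0 \<le> g x" "0 \<le> A" "0 \<le> B"
  shows "mean_le N (\<lambda>x. f x * g x) (sqrt (A * B))"
proof (rule mean_leI_integral)
  note fi = mean_le_integrable[OF f _ nonneg(3)] and gi = mean_le_integrable[OF g _ nonneg(4)]
  have fi2: "integrable N (\<lambda>x. (cmod (of_real (f x)))\<^sup>2)" "integrable N (\<lambda>x. (cmod (of_real (g x)))\<^sup>2)"
    using fi gi by simp_all
  have m: "(\<lambda>x. complex_of_real (f x)) \<in> borel_measurable N"
    "(\<lambda>x. complex_of_real (g x)) \<in> borel_measurable N"
    by measurable
  show "integrable N (\<lambda>x. f x * g x)"
    using integrable_norm[OF cauchy_schwarz_integral(1)[OF m fi2]] nonneg by (simp add: norm_mult)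
  have "(\<integral>x. f x * g x \<partial>N)\<^sup>2 \<le> (\<integral>x. (f x)\<^sup>2 \<partial>N) * (\<integral>x. (g x)\<^sup>2 \<partial>N)"
    using cauchy_schwarz_integral(2)[OF m fi2] nonneg by simp
  also have "\<dots> \<le> A * B"
    using fi gi nonneg by (intro mult_mono) auto
  finally show "(\<integral>x. f x * g x \<partial>N) \<le> sqrt (A * B)"
    by (rule real_le_rsqrt)
qed (use nonneg in simp)

section \<open>Fourth moments of sums of independent variables\<close>

lemma power4_add_le: "(a + b) ^ 4 \<le> 8 * a ^ 4 + 8 * b ^ 4" for a b :: real
proof -
  have sq: "(a + b)\<^sup>2 \<le> 2 * a\<^sup>2 + 2 * b\<^sup>2" for a b :: real
    using sum_squares_bound[of a b] by (simp add: power2_sum)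
  have "(a + b) ^ 4 = ((a + b)\<^sup>2)\<^sup>2" by simp
  also have "\<dots> \<le> (2 * a\<^sup>2 + 2 * b\<^sup>2)\<^sup>2" by (intro power_mono sq) simp
  also have "\<dots> \<le> 2 * (2 * a\<^sup>2)\<^sup>2 + 2 * (2 * b\<^sup>2)\<^sup>2" by (rule sq)
  finally show ?thesis by simp
qed

lemma (in prob_space) integrable_PiM_component:
  fixes f :: "'a \<Rightarrow> real"
  assumes "integrable M f" and i: "i \<in> I"
  shows "integrable (\<Pi>\<^sub>M i\<in>I. M) (\<lambda>\<omega>. f (\<omega> i))"
proof -
  have "distr (\<Pi>\<^sub>M i\<in>I. M) M (\<lambda>\<omega>. \<omega> i) = M"
    using distr_PiM_component[of I "\<lambda>_. M" i] prob_space_axioms i by simp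
  then show ?thesis
    using assms i by (intro integrable_distr[of "\<lambda>\<omega>. \<omega> i" _ M]) simp_all
qed

lemma (in prob_space) integrable_sum_power4:
  fixes Z :: "'a \<Rightarrow> real"
  assumes [measurable]: "Z \<in> borel_measurable M" and Z4: "integrable M (\<lambda>x. Z x ^ 4)"
    and "finite I" "I \<subseteq> J"
  shows "integrable (\<Pi>\<^sub>M i\<in>J. M) (\<lambda>\<omega>. (\<Sum>i\<in>I. Z (\<omega> i)) ^ 4)"
  using assms(3,4)
proof (induction I)
  case (insert i I)
  have [measurable]: "(\<lambda>\<omega>. Z (\<omega> j)) \<in> borel_measurable (\<Pi>\<^sub>M i\<in>J. M)" if "j \<in> insert i I" for j
    using insert.prems that by (intro measurable_compose[OF measurable_component_singleton]) auto
  have [measurable]: "(\<lambda>\<omega>. \<Sum>i\<in>I. Z (\<omega> i)) \<in> borel_measurable (\<Pi>\<^sub>M i\<in>J. M)"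
    by (intro borel_measurable_sum) auto
  have [measurable]: "(\<lambda>\<omega>. Z (\<omega> i)) \<in> borel_measurable (\<Pi>\<^sub>M i\<in>J. M)" by simp
  have "integrable (\<Pi>\<^sub>M i\<in>J. M) (\<lambda>\<omega>. 8 * Z (\<omega> i) ^ 4 + 8 * (\<Sum>i\<in>I. Z (\<omega> i)) ^ 4)"
    using insert integrable_PiM_component[OF Z4, of i J] by simp
  then show ?case
    unfolding sum.insert[OF insert.hyps]
    by (rule Bochner_Integration.integrable_bound)
       (measurable, intro AE_I2, use power4_add_le in auto)
qed simp

lemma (in prob_space) integrable_lower_powers:
  fixes Z :: "'a \<Rightarrow> real"
  assumes [measurable]: "Z \<in> borel_measurable M" and Z4: "integrable M (\<lambda>x. Z x ^ 4)" and k: "k \<le> 4"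
  shows "integrable M (\<lambda>x. Z x ^ k)"
proof (rule Bochner_Integration.integrable_bound)
  show "integrable M (\<lambda>x. 1 + Z x ^ 4)" using Z4 by simp
  have "\<bar>z\<bar> ^ k \<le> 1 + \<bar>z\<bar> ^ 4" for z :: real
  proof (cases "\<bar>z\<bar> \<le> 1")
    case True
    then have "\<bar>z\<bar> ^ k \<le> 1" by (intro power_le_one) auto
    then show ?thesis by (smt (verit) zero_le_power abs_ge_zero)
  next
    case False
    then have "\<bar>z\<bar> ^ k \<le> \<bar>z\<bar> ^ 4" by (intro power_increasing k) auto
    then show ?thesis by simp
  qed
  then show "AE x in M. norm (Z x ^ k) \<le> norm (1 + Z x ^ 4)"
    by (intro AE_I2) (simp add: power_abs)
qed simp

text \<open>One more variable is integrated out at each step. The three moments need a common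
  induction: in the expansion of the fourth power the term with the third moment of \<open>Z\<close>
  vanishes with the mean of the old sum, and the quadratic term needs its second moment.\<close>

lemma (in prob_space) iid_sum_moments:
  fixes Z :: "'a \<Rightarrow> real"
  assumes [measurable]: "Z \<in> borel_measurable M" and Z4: "integrable M (\<lambda>x. Z x ^ 4)"
    and Z0: "(\<integral>x. Z x \<partial>M) = 0" and I: "finite I"
  shows "(\<integral>\<omega>. (\<Sum>i\<in>I. Z (\<omega> i)) \<partial>(\<Pi>\<^sub>M i\<in>I. M)) = 0
    \<and> (\<integral>\<omega>. (\<Sum>i\<in>I. Z (\<omega> i))\<^sup>2 \<partial>(\<Pi>\<^sub>M i\<in>I. M)) = real (card I) * (\<integral>x. (Z x)\<^sup>2 \<partial>M)
    \<and> (\<integral>\<omega>. (\<Sum>i\<in>I. Z (\<omega> i)) ^ 4 \<partial>(\<Pi>\<^sub>M i\<in>I. M)) \<le> 3 * (real (card I))\<^sup>2 * (\<integral>x. Z x ^ 4 \<partial>M)"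
  using I
proof (induction I)
  case empty
  interpret P: prob_space "\<Pi>\<^sub>M i\<in>({} :: 'b set). M" by (intro prob_space_PiM prob_space_axioms)
  show ?case by simp
next
  case (insert i I)
  interpret product_sigma_finite "\<lambda>_ :: 'b. M"
    by standard
  interpret P: prob_space "\<Pi>\<^sub>M i\<in>I. M" by (intro prob_space_PiM prob_space_axioms)
  interpret Q: prob_space "\<Pi>\<^sub>M i\<in>insert i I. M" by (intro prob_space_PiM prob_space_axioms)
  let ?S = "\<lambda>I \<omega>. \<Sum>j\<in>I. Z (\<omega> j)"
  have mS: "?S I \<in> borel_measurable (\<Pi>\<^sub>M i\<in>J. M)" if "I \<subseteq> J" for I J :: "'b set"
  proof (intro borel_measurable_sum)
    fix j assume "j \<in> I"
    then show "(\<lambda>\<omega>. Z (\<omega> j)) \<in> borel_measurable (\<Pi>\<^sub>M i\<in>J. M)"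
      using that by (intro measurable_compose[OF measurable_component_singleton]) auto
  qed
  have Si: "integrable (\<Pi>\<^sub>M i\<in>I. M) (\<lambda>\<omega>. ?S I \<omega> ^ k)" if "k \<le> 4" for k
    by (rule P.integrable_lower_powers[OF mS[OF order_refl] _ that])
       (rule integrable_sum_power4[OF assms(1) Z4 insert.hyps(1) order_refl])
  have Si': "integrable (\<Pi>\<^sub>M i\<in>insert i I. M) (\<lambda>\<omega>. ?S (insert i I) \<omega> ^ k)" if "k \<le> 4" for k
    by (rule Q.integrable_lower_powers[OF mS[OF order_refl] _ that])
       (rule integrable_sum_power4[OF assms(1) Z4 finite.insertI[OF insert.hyps(1)] order_refl])
  have Zi: "integrable M (\<lambda>x. Z x ^ k)" if "k \<le> 4" for k
    by (rule integrable_lower_powers[OF assms(1) Z4 that])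
  have upd: "?S (insert i I) (fun_upd \<omega> i y) = ?S I \<omega> + Z y" for \<omega> y
  proof -
    have "?S I (fun_upd \<omega> i y) = ?S I \<omega>" using insert.hyps by (intro sum.cong) auto
    then show ?thesis using insert.hyps by simp
  qed
  have step: "(\<integral>\<omega>. ?S (insert i I) \<omega> ^ k \<partial>(\<Pi>\<^sub>M i\<in>insert i I. M))
      = (\<integral>\<omega>. (\<integral>y. (?S I \<omega> + Z y) ^ k \<partial>M) \<partial>(\<Pi>\<^sub>M i\<in>I. M))" if "k \<le> 4" for k
    by (subst product_integral_insert[OF insert.hyps Si'[OF that]]) (simp only: upd)
  define m2 m3 m4 where "m2 = (\<integral>x. (Z x)\<^sup>2 \<partial>M)" and "m3 = (\<integral>x. Z x ^ 3 \<partial>M)" and "m4 = (\<integral>x. Z x ^ 4 \<partial>M)"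
  have Zint: "integrable M Z" using Zi[of 1] by simp
  have in1: "(\<integral>y. (s + Z y) \<partial>M) = s" for s
    using Zint Z0 by (simp add: prob_space)
  have in2: "(\<integral>y. (s + Z y)\<^sup>2 \<partial>M) = s\<^sup>2 + m2" for s
  proof -
    have "(s + Z y)\<^sup>2 = s\<^sup>2 + (2 * s) * Z y + (Z y)\<^sup>2" for y by (simp add: power2_sum)
    then show ?thesis using Zint Zi[of 2] Z0 by (simp add: prob_space m2_def)
  qed
  have in4: "(\<integral>y. (s + Z y) ^ 4 \<partial>M) = s ^ 4 + (6 * m2) * s\<^sup>2 + (4 * m3) * s + m4" for s
  proof -
    have "(s + Z y) ^ 4 = s ^ 4 + (4 * s ^ 3) * Z y + (6 * s\<^sup>2) * (Z y)\<^sup>2 + (4 * s) * Z y ^ 3 + Z y ^ 4" for y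
      by (simp add: power4_eq_xxxx power3_eq_cube power2_eq_square algebra_simps)
    then have "(\<integral>y. (s + Z y) ^ 4 \<partial>M) = s ^ 4 + (4 * s ^ 3) * 0 + (6 * s\<^sup>2) * m2 + (4 * s) * m3 + m4"
      using Zint Zi[of 2] Zi[of 3] Zi[of 4] Z0 by (simp add: prob_space m2_def m3_def m4_def)
    then show ?thesis by simp
  qed
  have IH: "(\<integral>\<omega>. ?S I \<omega> \<partial>(\<Pi>\<^sub>M i\<in>I. M)) = 0"
      "(\<integral>\<omega>. (?S I \<omega>)\<^sup>2 \<partial>(\<Pi>\<^sub>M i\<in>I. M)) = real (card I) * m2"
      "(\<integral>\<omega>. ?S I \<omega> ^ 4 \<partial>(\<Pi>\<^sub>M i\<in>I. M)) \<le> 3 * (real (card I))\<^sup>2 * m4"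
    using insert.IH by (auto simp: m2_def m4_def)
  have S1: "integrable (\<Pi>\<^sub>M i\<in>I. M) (?S I)" using Si[of 1] by simp
  \<comment> \<open>Jensen's inequality: it turns the quadratic term of the recursion into a
    multiple of \<open>m4\<close>.\<close>
  have "m2\<^sup>2 \<le> m4"
  proof -
    have "0 \<le> (\<integral>x. ((Z x)\<^sup>2 - m2)\<^sup>2 \<partial>M)" by simp
    also have "\<dots> = (\<integral>x. Z x ^ 4 - (2 * m2) * (Z x)\<^sup>2 + m2\<^sup>2 \<partial>M)"
      by (intro Bochner_Integration.integral_cong refl) (simp add: power2_eq_square power4_eq_xxxx algebra_simps)
    also have "\<dots> = m4 - (2 * m2) * m2 + m2\<^sup>2"
      using Zi[of 2] Zi[of 4] by (simp add: prob_space m2_def m4_def)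
    finally show ?thesis by (simp add: power2_eq_square)
  qed
  have m4: "0 \<le> m4" by (simp add: m4_def)
  have c: "real (card (insert i I)) = real (card I) + 1" using insert.hyps by simp
  have e1: "(\<integral>\<omega>. ?S (insert i I) \<omega> \<partial>(\<Pi>\<^sub>M i\<in>insert i I. M)) = 0"
    using step[of 1] IH(1) by (simp add: in1)
  have e2: "(\<integral>\<omega>. (?S (insert i I) \<omega>)\<^sup>2 \<partial>(\<Pi>\<^sub>M i\<in>insert i I. M)) = real (card (insert i I)) * m2"
    unfolding step[of 2, simplified] in2 c using Si[of 2] IH(2)
    by (simp add: P.prob_space algebra_simps)
  have "(\<integral>\<omega>. ?S (insert i I) \<omega> ^ 4 \<partial>(\<Pi>\<^sub>M i\<in>insert i I. M))
      = (\<integral>\<omega>. ?S I \<omega> ^ 4 \<partial>(\<Pi>\<^sub>M i\<in>I. M)) + (6 * m2) * (real (card I) * m2) + (4 * m3) * 0 + m4"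
    unfolding step[of 4, simplified] in4 using Si[of 4] Si[of 2] S1 IH
    by (simp add: P.prob_space)
  also have "\<dots> \<le> 3 * (real (card I))\<^sup>2 * m4 + 6 * real (card I) * m4 + m4"
    using IH(3) mult_left_mono[OF \<open>m2\<^sup>2 \<le> m4\<close>, of "6 * real (card I)"]
    by (simp add: power2_eq_square mult_ac)
  \<comment> \<open>With N the old cardinality, 3 (N + 1)^2 exceeds 3 N^2 + 6 N + 1. The leading
    constant 3 is chosen so that the term 6 N is absorbed.\<close>
  also have "\<dots> \<le> 3 * (real (card (insert i I)))\<^sup>2 * m4"
    unfolding c using m4 by (simp add: power2_eq_square algebra_simps)
  finally show ?case using e1 e2 by (simp only: m2_def m4_def)
qed

text \<open>Real and imaginary parts form two real samples. Recombining them costs a factor 2, which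
  with the 3 of \<open>iid_sum_moments\<close> makes 6; the fourth powers of the two parts add up to
  at most \<open>cmod (Z x) ^ 4\<close>, so nothing else is lost.\<close>

lemma (in prob_space) iid_mean_fourth_moment:
  fixes Z :: "'a \<Rightarrow> complex"
  assumes Z4: "mean_le M (\<lambda>x. cmod (Z x) ^ 4) B" and [measurable]: "Z \<in> borel_measurable M"
    and Z0: "(\<integral>x. Z x \<partial>M) = 0" and n: "n > 0" and B: "0 \<le> B"
  shows "mean_le (\<Pi>\<^sub>M i\<in>{..<n}. M) (\<lambda>\<omega>. cmod ((\<Sum>i<n. Z (\<omega> i)) / of_nat n) ^ 4) (6 * B / (real n)\<^sup>2)"
proof -
  note Zi = mean_le_integrable[OF Z4 _ B]
  have dom: "\<bar>Re z\<bar> ^ 4 \<le> cmod z ^ 4" "\<bar>Im z\<bar> ^ 4 \<le> cmod z ^ 4" for z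
    by (intro power_mono abs_Re_le_cmod abs_Im_le_cmod; simp)+
  have reim: "integrable M (\<lambda>x. Re (Z x) ^ 4)" "integrable M (\<lambda>x. Im (Z x) ^ 4)"
    using dom by (auto intro!: Bochner_Integration.integrable_bound[OF Zi(1)])
  have "integrable M (\<lambda>x. 1 + cmod (Z x) ^ 4)" using Zi(1) by simp
  then have Zint: "integrable M Z"
  proof (rule Bochner_Integration.integrable_bound)
    have "r \<le> 1 + r ^ 4" if "r \<ge> 0" for r :: real
    proof (cases "r \<le> 1")
      case False
      then show ?thesis using power_increasing[of 1 4 r] by simp
    qed (use that zero_le_power[of r 4] in linarith)
    then show "AE x in M. cmod (Z x) \<le> norm (1 + cmod (Z x) ^ 4)" by (intro AE_I2) auto
  qed simp
  have z0: "(\<integral>x. Re (Z x) \<partial>M) = 0" "(\<integral>x. Im (Z x) \<partial>M) = 0"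
    using Z0 Zint by simp_all
  let ?R = "\<lambda>\<omega>. \<Sum>i<n. Re (Z (\<omega> i))" and ?J = "\<lambda>\<omega>. \<Sum>i<n. Im (Z (\<omega> i))"
  let ?P = "\<Pi>\<^sub>M i\<in>{..<n}. M"
  have int: "integrable ?P (\<lambda>\<omega>. ?R \<omega> ^ 4)" "integrable ?P (\<lambda>\<omega>. ?J \<omega> ^ 4)"
    using reim by (auto intro!: integrable_sum_power4)
  have cm: "cmod z ^ 4 \<le> 2 * Re z ^ 4 + 2 * Im z ^ 4" for z
  proof -
    have "cmod z ^ 4 = ((cmod z)\<^sup>2)\<^sup>2" by simp
    also have "\<dots> = ((Re z)\<^sup>2 + (Im z)\<^sup>2)\<^sup>2" unfolding cmod_power2 ..
    also have "\<dots> \<le> 2 * ((Re z)\<^sup>2)\<^sup>2 + 2 * ((Im z)\<^sup>2)\<^sup>2"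
      using sum_squares_bound[of "(Re z)\<^sup>2" "(Im z)\<^sup>2"] by (simp add: power2_sum)
    finally show ?thesis by simp
  qed
  have Rint: "integrable ?P (\<lambda>\<omega>. (2 * ?R \<omega> ^ 4 + 2 * ?J \<omega> ^ 4) / real n ^ 4)"
    using int by simp
  have "mean_le ?P (\<lambda>\<omega>. (2 * ?R \<omega> ^ 4 + 2 * ?J \<omega> ^ 4) / real n ^ 4) (6 * B / (real n)\<^sup>2)"
  proof (rule mean_leI_integral[OF Rint])
    have "(\<integral>x. Re (Z x) ^ 4 \<partial>M) + (\<integral>x. Im (Z x) ^ 4 \<partial>M) = (\<integral>x. Re (Z x) ^ 4 + Im (Z x) ^ 4 \<partial>M)"
      using reim by simp
    also have "\<dots> \<le> (\<integral>x. cmod (Z x) ^ 4 \<partial>M)"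
    proof (rule integral_mono)
      have "Re z ^ 4 + Im z ^ 4 \<le> cmod z ^ 4" for z
      proof -
        have "cmod z ^ 4 = ((Re z)\<^sup>2 + (Im z)\<^sup>2)\<^sup>2" unfolding cmod_power2[symmetric] by simp
        also have "\<dots> = Re z ^ 4 + Im z ^ 4 + 2 * ((Re z)\<^sup>2 * (Im z)\<^sup>2)"
          by (simp add: power2_sum mult_ac)
        finally show ?thesis by simp
      qed
      then show "Re (Z x) ^ 4 + Im (Z x) ^ 4 \<le> cmod (Z x) ^ 4" for x .
    qed (use reim Zi(1) in simp_all)
    also have "\<dots> \<le> B" using Zi(2) by simp
    finally have sB: "(\<integral>x. Re (Z x) ^ 4 \<partial>M) + (\<integral>x. Im (Z x) ^ 4 \<partial>M) \<le> B" .
    have "(\<integral>\<omega>. ?R \<omega> ^ 4 \<partial>?P) \<le> 3 * (real n)\<^sup>2 * (\<integral>x. Re (Z x) ^ 4 \<partial>M)"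
      "(\<integral>\<omega>. ?J \<omega> ^ 4 \<partial>?P) \<le> 3 * (real n)\<^sup>2 * (\<integral>x. Im (Z x) ^ 4 \<partial>M)"
      using iid_sum_moments[of "\<lambda>x. Re (Z x)" "{..<n}"] iid_sum_moments[of "\<lambda>x. Im (Z x)" "{..<n}"]
        reim z0 by simp_all
    then have "(\<integral>\<omega>. ?R \<omega> ^ 4 \<partial>?P) + (\<integral>\<omega>. ?J \<omega> ^ 4 \<partial>?P) \<le> 3 * (real n)\<^sup>2 * B"
      using mult_left_mono[OF sB, of "3 * (real n)\<^sup>2"] by (simp add: distrib_left)
    then have "2 * ((\<integral>\<omega>. ?R \<omega> ^ 4 \<partial>?P) + (\<integral>\<omega>. ?J \<omega> ^ 4 \<partial>?P)) / real n ^ 4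
        \<le> 2 * (3 * (real n)\<^sup>2 * B) / real n ^ 4"
      by (intro divide_right_mono mult_left_mono) auto
    also have "\<dots> = 6 * B / (real n)\<^sup>2"
      using n by (simp add: power2_eq_square power4_eq_xxxx)
    finally show "(\<integral>\<omega>. (2 * ?R \<omega> ^ 4 + 2 * ?J \<omega> ^ 4) / real n ^ 4 \<partial>?P) \<le> 6 * B / (real n)\<^sup>2"
      using int by (simp add: distrib_left)
  qed simp
  then show ?thesis
  proof (rule mean_le_mono)
    have "cmod ((\<Sum>i<n. Z (\<omega> i)) / of_nat n) ^ 4 \<le> (2 * ?R \<omega> ^ 4 + 2 * ?J \<omega> ^ 4) / real n ^ 4" for \<omega>
      using cm[of "\<Sum>i<n. Z (\<omega> i)"] by (simp add: norm_divide power_divide divide_right_mono)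
    then show "AE \<omega> in ?P. cmod ((\<Sum>i<n. Z (\<omega> i)) / of_nat n) ^ 4
        \<le> (2 * ?R \<omega> ^ 4 + 2 * ?J \<omega> ^ 4) / real n ^ 4" by simp
  qed auto
qed

section \<open>From moments of the coefficients to a moment of the norm\<close>

text \<open>Hoelder's inequality with exponents 4 and 4/3, obtained from two weighted Cauchy-Schwarz
  steps. The weights will be the variances: if \<open>b k\<close> has fourth moment of order
  \<open>x k ^ 4\<close>, the expected right-hand side is of order \<open>L ^ 4\<close>.\<close>

lemma weighted_power4_sum:
  fixes x b :: "'b \<Rightarrow> real"
  assumes x: "\<And>k. k \<in> F \<Longrightarrow> 0 < x k" and L: "(\<Sum>k\<in>F. x k) \<le> L" and b: "\<And>k. k \<in> F \<Longrightarrow> 0 \<le> b k"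
  shows "(\<Sum>k\<in>F. b k) ^ 4 \<le> L ^ 3 * (\<Sum>k\<in>F. b k ^ 4 / x k ^ 3)"
proof -
  have L0: "0 \<le> L" using L sum_nonneg[of F x] x by (force intro: less_imp_le)
  have *: "(\<Sum>k\<in>F. b k)\<^sup>2 \<le> L * (\<Sum>k\<in>F. (b k)\<^sup>2 / x k)" for b :: "'b \<Rightarrow> real"
  proof -
    have "(\<Sum>k\<in>F. b k) = (\<Sum>k\<in>F. sqrt (x k) * (b k / sqrt (x k)))"
      using x by (intro sum.cong) force+
    then have "(\<Sum>k\<in>F. b k)\<^sup>2 \<le> (\<Sum>k\<in>F. (sqrt (x k))\<^sup>2) * (\<Sum>k\<in>F. (b k / sqrt (x k))\<^sup>2)"
      using Cauchy_Schwarz_ineq_sum[of "\<lambda>k. sqrt (x k)" "\<lambda>k. b k / sqrt (x k)" F] by simp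
    also have "\<dots> = (\<Sum>k\<in>F. x k) * (\<Sum>k\<in>F. (b k)\<^sup>2 / x k)"
      using x by (intro arg_cong2[where f = "(*)"] sum.cong) (auto simp: power_divide less_imp_le)
    also have "\<dots> \<le> L * (\<Sum>k\<in>F. (b k)\<^sup>2 / x k)"
      using x by (intro mult_right_mono L sum_nonneg) (auto simp: less_imp_le)
    finally show ?thesis .
  qed
  have "(\<Sum>k\<in>F. b k) ^ 4 = ((\<Sum>k\<in>F. b k)\<^sup>2)\<^sup>2" by simp
  also have "\<dots> \<le> (L * (\<Sum>k\<in>F. (b k)\<^sup>2 / x k))\<^sup>2" by (intro power_mono *) simp
  also have "\<dots> = L\<^sup>2 * (\<Sum>k\<in>F. (b k)\<^sup>2 / x k)\<^sup>2" by (simp add: power_mult_distrib)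
  also have "\<dots> \<le> L\<^sup>2 * (L * (\<Sum>k\<in>F. ((b k)\<^sup>2 / x k)\<^sup>2 / x k))"
    by (intro mult_left_mono *) simp
  also have "(\<Sum>k\<in>F. ((b k)\<^sup>2 / x k)\<^sup>2 / x k) = (\<Sum>k\<in>F. b k ^ 4 / x k ^ 3)"
    by (intro sum.cong) (simp_all add: power_divide power3_eq_cube power2_eq_square power4_eq_xxxx)
  finally show ?thesis by (simp add: power3_eq_cube power2_eq_square mult_ac)
qed

lemma power8_le: "r ^ 8 \<le> 1 + r ^ m" if "m \<ge> 8" "0 \<le> r" for r :: real
proof (cases "r \<le> 1")
  case True
  then have "r ^ 8 \<le> 1" using that by (intro power_le_one) auto
  then show ?thesis using zero_le_power[OF that(2), of m] by linarith
next
  case False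
  then have "r ^ 8 \<le> r ^ m" using that by (intro power_increasing) auto
  then show ?thesis by simp
qed

context prob_space
begin

text \<open>Order 8 is what the later steps consume: fourth moments of products of two variables,
  split by Cauchy-Schwarz. Undoing the standardisation brings in the fourth power of the
  variance.\<close>

lemma std_moment8:
  assumes rf: "random_function M X" and mom: "max_std_moment M m X \<le> ennreal \<eta>"
    and m: "m \<ge> 8" and \<eta>: "0 \<le> \<eta>" and v: "0 < var_coef M X k"
  shows "mean_le M (\<lambda>\<omega>. cmod (l2_inner (cfun (X \<omega>)) (\<phi> k)) ^ 8) ((1 + \<eta>) * var_coef M X k ^ 4)"
proof -
  let ?z = "\<lambda>\<omega>. cmod (l2_inner (cfun (X \<omega>)) (\<phi> k) / complex_of_real (sqrt (var_coef M X k)))"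
  note [measurable] = coef_measurable[OF rf]
  have "mean_le M (\<lambda>\<omega>. ?z \<omega> ^ m) \<eta>"
    unfolding mean_le_def
  proof
    show "(\<integral>\<^sup>+\<omega>. ennreal (?z \<omega> ^ m) \<partial>M) \<le> ennreal \<eta>"
      by (rule order_trans[OF _ mom]) (unfold max_std_moment_def, rule SUP_upper, simp)
  qed measurable
  then have "mean_le M (\<lambda>\<omega>. 1 + ?z \<omega> ^ m) (1 + \<eta>)"
    using \<eta> by (intro mean_le_add mean_le_const) auto
  then have "mean_le M (\<lambda>\<omega>. ?z \<omega> ^ 8) (1 + \<eta>)"
    by (rule mean_le_mono) (auto intro!: AE_I2 power8_le[OF m])
  then have "mean_le M (\<lambda>\<omega>. var_coef M X k ^ 4 * ?z \<omega> ^ 8) (var_coef M X k ^ 4 * (1 + \<eta>))"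
    using \<eta> v by (intro mean_le_cmult) auto
  moreover have "var_coef M X k ^ 4 * ?z \<omega> ^ 8 = cmod (l2_inner (cfun (X \<omega>)) (\<phi> k)) ^ 8" for \<omega>
  proof -
    have "sqrt (var_coef M X k) ^ 8 = ((sqrt (var_coef M X k))\<^sup>2) ^ 4"
      by (simp only: power_mult[symmetric]) simp
    then have "sqrt (var_coef M X k) ^ 8 = var_coef M X k ^ 4" using v by simp
    then show ?thesis using v by (simp add: norm_divide power_divide)
  qed
  ultimately show ?thesis by (simp add: mult.commute)
qed

text \<open>\<open>weighted_power4_sum\<close> bounds the fourth moment of Parseval's partial sums
  uniformly in J, and Fatou's lemma passes to the norm.\<close>

lemma sq_norm_fourth_moment:
  assumes rf: "random_function M X" and cso: "centered_second_order M X"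
    and v: "\<And>k. 0 < var_coef M X k"
    and mom: "\<And>k. mean_le M (\<lambda>\<omega>. cmod (l2_inner (cfun (X \<omega>)) (\<phi> k)) ^ 8) (K * var_coef M X k ^ 4)"
    and L: "mean_sq_norm M X \<le> ennreal \<Lambda>" "0 \<le> \<Lambda>" and K: "0 \<le> K"
  shows "mean_le M (\<lambda>\<omega>. (\<integral>t. (X \<omega> t)\<^sup>2 \<partial>unit_leb) ^ 4) (K * \<Lambda> ^ 4)"
proof -
  let ?c = "\<lambda>\<omega> k. cmod (l2_inner (cfun (X \<omega>)) (\<phi> k))"
  let ?P = "\<lambda>J \<omega>. (\<Sum>k\<in>{-int J..int J}. (?c \<omega> k)\<^sup>2) ^ 4"
  note [measurable] = coef_measurable[OF rf] sq_norm_measurable[OF rf]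
  have sumv: "(\<Sum>k\<in>F. var_coef M X k) \<le> \<Lambda>" if "finite F" for F
    using sum_coef_sq_le[OF rf L that] by (simp add: var_coef_eq[OF rf cso])
  have P: "mean_le M (?P J) (K * \<Lambda> ^ 4)" for J
  proof -
    let ?F = "{-int J..int J}"
    have "mean_le M (\<lambda>\<omega>. \<Sum>k\<in>?F. (1 / var_coef M X k ^ 3) * ?c \<omega> k ^ 8)
        (\<Sum>k\<in>?F. (1 / var_coef M X k ^ 3) * (K * var_coef M X k ^ 4))"
      using v K by (intro mean_le_sum mean_le_cmult mom) (auto simp: less_imp_le)
    then have "mean_le M (\<lambda>\<omega>. \<Lambda> ^ 3 * (\<Sum>k\<in>?F. (1 / var_coef M X k ^ 3) * ?c \<omega> k ^ 8))
        (\<Lambda> ^ 3 * (\<Sum>k\<in>?F. (1 / var_coef M X k ^ 3) * (K * var_coef M X k ^ 4)))"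
      using v K L by (intro mean_le_cmult sum_nonneg) (auto simp: less_imp_le)
    then show ?thesis
    proof (rule mean_le_mono)
      have "?P J \<omega> \<le> \<Lambda> ^ 3 * (\<Sum>k\<in>?F. (1 / var_coef M X k ^ 3) * ?c \<omega> k ^ 8)" for \<omega>
        using weighted_power4_sum[of ?F "var_coef M X" \<Lambda> "\<lambda>k. (?c \<omega> k)\<^sup>2"] v sumv[of ?F]
        by (simp add: power_mult[symmetric])
      then show "AE \<omega> in M. ?P J \<omega> \<le> \<Lambda> ^ 3 * (\<Sum>k\<in>?F. (1 / var_coef M X k ^ 3) * ?c \<omega> k ^ 8)"
        by simp
      have "(\<Sum>k\<in>?F. (1 / var_coef M X k ^ 3) * (K * var_coef M X k ^ 4)) = K * (\<Sum>k\<in>?F. var_coef M X k)"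
        unfolding sum_distrib_left
      proof (intro sum.cong refl)
        fix k
        have "var_coef M X k \<noteq> 0" using v[of k] by simp
        then show "(1 / var_coef M X k ^ 3) * (K * var_coef M X k ^ 4) = K * var_coef M X k"
          by (simp add: power3_eq_cube power4_eq_xxxx)
      qed
      also have "\<dots> \<le> K * \<Lambda>" using K sumv by (intro mult_left_mono) auto
      finally have le: "(\<Sum>k\<in>?F. (1 / var_coef M X k ^ 3) * (K * var_coef M X k ^ 4)) \<le> K * \<Lambda>" .
      have "\<Lambda> ^ 3 * (\<Sum>k\<in>?F. (1 / var_coef M X k ^ 3) * (K * var_coef M X k ^ 4)) \<le> \<Lambda> ^ 3 * (K * \<Lambda>)"
        using L(2) by (intro mult_left_mono le) simp
      also have "\<dots> = K * \<Lambda> ^ 4" by (simp add: power3_eq_cube power4_eq_xxxx)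
      finally show "\<Lambda> ^ 3 * (\<Sum>k\<in>?F. (1 / var_coef M X k ^ 3) * (K * var_coef M X k ^ 4)) \<le> K * \<Lambda> ^ 4" .
    qed measurable
  qed
  have "(\<integral>\<^sup>+\<omega>. ennreal ((\<integral>t. (X \<omega> t)\<^sup>2 \<partial>unit_leb) ^ 4) \<partial>M)
      = (\<integral>\<^sup>+\<omega>. liminf (\<lambda>J. ennreal (?P J \<omega>)) \<partial>M)"
  proof (rule nn_integral_cong_AE)
    show "AE \<omega> in M. ennreal ((\<integral>t. (X \<omega> t)\<^sup>2 \<partial>unit_leb) ^ 4) = liminf (\<lambda>J. ennreal (?P J \<omega>))"
      using random_function_L2[OF rf]
    proof eventually_elim
      case (elim \<omega>)
      have "(\<lambda>J. ennreal (?P J \<omega>)) \<longlonglongrightarrow> ennreal ((\<integral>t. (X \<omega> t)\<^sup>2 \<partial>unit_leb) ^ 4)"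
        by (intro tendsto_intros tendsto_ennrealI parseval elim)
      then show ?case by (intro lim_imp_Liminf[symmetric]) auto
    qed
  qed
  also have "\<dots> \<le> liminf (\<lambda>J. \<integral>\<^sup>+\<omega>. ennreal (?P J \<omega>) \<partial>M)"
    by (rule nn_integral_liminf) measurable
  also have "\<dots> \<le> liminf (\<lambda>J. ennreal (K * \<Lambda> ^ 4))"
    using P by (intro Liminf_mono) (auto simp: mean_le_def)
  also have "\<dots> = ennreal (K * \<Lambda> ^ 4)"
    by (simp add: Liminf_const)
  finally show ?thesis by (simp add: mean_le_def)
qed

lemma integral_mult_le:
  assumes f: "cfun f \<in> L2" and g: "cfun g \<in> L2"
  shows "\<bar>\<integral>t. f t * g t \<partial>unit_leb\<bar> \<le> sqrt (\<integral>t. (f t)\<^sup>2 \<partial>unit_leb) * sqrt (\<integral>t. (g t)\<^sup>2 \<partial>unit_leb)"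
proof -
  have "complex_of_real (\<integral>t. f t * g t \<partial>unit_leb) = (\<integral>t. cfun f t * cfun g t \<partial>unit_leb)"
    by (simp flip: integral_complex_of_real)
  then have "\<bar>\<integral>t. f t * g t \<partial>unit_leb\<bar> = cmod (\<integral>t. cfun f t * cfun g t \<partial>unit_leb)"
    by (metis norm_of_real)
  moreover have "(cmod (\<integral>t. cfun f t * cfun g t \<partial>unit_leb))\<^sup>2
      \<le> (\<integral>t. (f t)\<^sup>2 \<partial>unit_leb) * (\<integral>t. (g t)\<^sup>2 \<partial>unit_leb)"
    using cauchy_schwarz_integral(3)[OF L2D(1)[OF f] L2D(1)[OF g] L2D(2)[OF f] L2D(2)[OF g]]
    by simp
  ultimately show ?thesis
    by (simp add: real_le_rsqrt real_sqrt_mult[symmetric])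
qed

lemma inner_measurable:
  assumes rf: "random_function M X" and \<beta>: "cfun \<beta> \<in> L2"
  shows "(\<lambda>\<omega>. \<integral>t. \<beta> t * X \<omega> t \<partial>unit_leb) \<in> borel_measurable M"
proof -
  note [measurable] = random_function_measurable[OF rf] cfun_L2D(1)[OF \<beta>]
  show ?thesis by (rule unit.borel_measurable_lebesgue_integral) measurable
qed

lemma inner_sq_le:
  assumes rf: "random_function M X" and \<beta>: "cfun \<beta> \<in> L2"
  shows "AE \<omega> in M. (\<integral>t. \<beta> t * X \<omega> t \<partial>unit_leb)\<^sup>2
      \<le> (\<integral>t. (\<beta> t)\<^sup>2 \<partial>unit_leb) * (\<integral>t. (X \<omega> t)\<^sup>2 \<partial>unit_leb)"
  using random_function_L2[OF rf]
proof eventually_elim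
  case (elim \<omega>)
  have "\<bar>\<integral>t. \<beta> t * X \<omega> t \<partial>unit_leb\<bar>\<^sup>2
      \<le> (sqrt (\<integral>t. (\<beta> t)\<^sup>2 \<partial>unit_leb) * sqrt (\<integral>t. (X \<omega> t)\<^sup>2 \<partial>unit_leb))\<^sup>2"
    by (intro power_mono integral_mult_le \<beta> elim) simp
  then show ?case by (simp add: power_mult_distrib)
qed

lemma inner_sq_integrable:
  assumes rf: "random_function M X" and \<beta>: "cfun \<beta> \<in> L2"
  shows "integrable M (\<lambda>\<omega>. (\<integral>t. \<beta> t * X \<omega> t \<partial>unit_leb)\<^sup>2)"
proof (rule Bochner_Integration.integrable_bound)
  show "integrable M (\<lambda>\<omega>. (\<integral>t. (\<beta> t)\<^sup>2 \<partial>unit_leb) * (\<integral>t. (X \<omega> t)\<^sup>2 \<partial>unit_leb))"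
    using sq_norm_integrable[OF rf] by simp
  show "(\<lambda>\<omega>. (\<integral>t. \<beta> t * X \<omega> t \<partial>unit_leb)\<^sup>2) \<in> borel_measurable M"
    using inner_measurable[OF rf \<beta>] by measurable
qed (use inner_sq_le[OF rf \<beta>] in \<open>auto elim!: eventually_mono\<close>)

lemma l2_inner_phi_cfun: "l2_inner (\<phi> k) (cfun f) = (\<integral>t. \<phi> k t * cfun f t \<partial>unit_leb)"
  by (simp add: l2_inner_def)

text \<open>The expansion of \<open>\<beta>\<close> may be integrated termwise because its partial sums converge in
  mean square.\<close>

lemma expectation_inner_coef:
  assumes XW: "(X, W) \<in> stationary_pairs M" and \<beta>: "cfun \<beta> \<in> L2"
  shows "(\<integral>\<omega>. of_real (\<integral>t. \<beta> t * X \<omega> t \<partial>unit_leb) * l2_inner (cfun (W \<omega>)) (\<phi> k) \<partial>M)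
       = l2_inner (cfun \<beta>) (\<phi> k) * c_coef M X W k"
proof -
  have rX: "random_function M X" and rW: "random_function M W"
    using XW by (auto simp: stationary_pairs_def)
  note [measurable] = coef_measurable[OF rX] coef_measurable[OF rW] sq_norm_measurable[OF rX]
    inner_measurable[OF rX \<beta>]
  have xi [measurable]: "(\<lambda>\<omega>. l2_inner (\<phi> j) (cfun (X \<omega>))) \<in> borel_measurable M" for j
    by (subst l2_inner_commute) measurable
  have xi2: "integrable M (\<lambda>\<omega>. (cmod (l2_inner (\<phi> j) (cfun (X \<omega>))))\<^sup>2)" for j
    using coef_sq_integrable[OF rX, of j] by (simp add: norm_l2_inner_commute)
  note W2 = coef_sq_integrable[OF rW, of k]
  let ?b = "\<lambda>j. l2_inner (cfun \<beta>) (\<phi> j)" and ?x = "\<lambda>j \<omega>. l2_inner (\<phi> j) (cfun (X \<omega>))"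
  let ?w = "\<lambda>\<omega>. l2_inner (cfun (W \<omega>)) (\<phi> k)" and ?I = "\<lambda>\<omega>. complex_of_real (\<integral>t. \<beta> t * X \<omega> t \<partial>unit_leb)"
  let ?F = "\<lambda>J. {-int J..int J}"
  let ?d = "\<lambda>J. \<integral>t. (cmod (cfun \<beta> t - (\<Sum>j\<in>?F J. ?b j * \<phi> j t)))\<^sup>2 \<partial>unit_leb"
  let ?r = "\<lambda>\<omega>. sqrt (\<integral>t. (X \<omega> t)\<^sup>2 \<partial>unit_leb)"
  define D where "D = (\<integral>\<omega>. ?r \<omega> * cmod (?w \<omega>) \<partial>M)"
  have xw: "integrable M (\<lambda>\<omega>. ?x j \<omega> * ?w \<omega>)" for j
    by (rule cauchy_schwarz_integral(1)) (use xi2 W2 in auto)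
  have Iw: "integrable M (\<lambda>\<omega>. ?I \<omega> * ?w \<omega>)"
    by (rule cauchy_schwarz_integral(1)) (use inner_sq_integrable[OF rX \<beta>] W2 in auto)
  have rw: "integrable M (\<lambda>\<omega>. ?r \<omega> * cmod (?w \<omega>))"
  proof -
    have "integrable M (\<lambda>\<omega>. complex_of_real (?r \<omega>) * ?w \<omega>)"
      by (rule cauchy_schwarz_integral(1)) (use sq_norm_integrable[OF rX] W2 in auto)
    from integrable_norm[OF this] show ?thesis by (simp add: norm_mult)
  qed
  have diff: "AE \<omega> in M. cmod (?I \<omega> - (\<Sum>j\<in>?F J. ?b j * ?x j \<omega>)) \<le> sqrt (?d J) * ?r \<omega>" for J
    using random_function_L2[OF rX]
  proof eventually_elim
    case (elim \<omega>)
    let ?q = "\<lambda>t. cfun \<beta> t - (\<Sum>j\<in>?F J. ?b j * \<phi> j t)"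
    have q: "?q \<in> L2" by (intro L2_diff \<beta> trig_in_L2)
    have ints: "integrable unit_leb (\<lambda>t. cfun \<beta> t * cfun (X \<omega>) t)"
      by (rule cauchy_schwarz_integral(1)) (use L2D[OF \<beta>] L2D[OF elim] in auto)
    have intp: "integrable unit_leb (\<lambda>t. ?b j * (\<phi> j t * cfun (X \<omega>) t))" for j
      using integrable_times_phi[OF elim, of j] by (simp add: mult.commute)
    have "(\<integral>t. ?q t * cfun (X \<omega>) t \<partial>unit_leb)
        = (\<integral>t. cfun \<beta> t * cfun (X \<omega>) t - (\<Sum>j\<in>?F J. ?b j * (\<phi> j t * cfun (X \<omega>) t)) \<partial>unit_leb)"
      by (simp add: left_diff_distrib sum_distrib_right mult.assoc)
    also have "\<dots> = (\<integral>t. cfun \<beta> t * cfun (X \<omega>) t \<partial>unit_leb) - (\<Sum>j\<in>?F J. ?b j * ?x j \<omega>)"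
      using ints intp by (simp add: l2_inner_phi_cfun)
    also have "(\<integral>t. cfun \<beta> t * cfun (X \<omega>) t \<partial>unit_leb) = ?I \<omega>"
      by (simp flip: integral_complex_of_real)
    finally have "cmod (?I \<omega> - (\<Sum>j\<in>?F J. ?b j * ?x j \<omega>)) = cmod (\<integral>t. ?q t * cfun (X \<omega>) t \<partial>unit_leb)"
      by simp
    moreover have "(cmod (\<integral>t. ?q t * cfun (X \<omega>) t \<partial>unit_leb))\<^sup>2 \<le> ?d J * (\<integral>t. (X \<omega> t)\<^sup>2 \<partial>unit_leb)"
      using cauchy_schwarz_integral(3)[OF L2D(1)[OF q] L2D(1)[OF elim] L2D(2)[OF q] L2D(2)[OF elim]]
      by simp
    ultimately show ?case
      by (simp add: real_le_rsqrt real_sqrt_mult[symmetric])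
  qed
  have bound: "cmod ((\<integral>\<omega>. ?I \<omega> * ?w \<omega> \<partial>M) - ?b k * c_coef M X W k) \<le> sqrt (?d J) * D"
    if J: "J \<ge> nat \<bar>k\<bar>" for J
  proof -
    have "(\<integral>\<omega>. (\<Sum>j\<in>?F J. ?b j * ?x j \<omega>) * ?w \<omega> \<partial>M) = (\<Sum>j\<in>?F J. ?b j * (\<integral>\<omega>. ?x j \<omega> * ?w \<omega> \<partial>M))"
      unfolding sum_distrib_right mult.assoc using xw by simp
    also have "\<dots> = (\<Sum>j\<in>?F J. if j = k then ?b k * c_coef M X W k else 0)"
      by (intro sum.cong refl) (simp add: cross_coef[OF XW])
    also have "\<dots> = ?b k * c_coef M X W k"
      using J by (subst sum.delta) auto
    finally have "(\<integral>\<omega>. ?I \<omega> * ?w \<omega> \<partial>M) - ?b k * c_coef M X W k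
        = (\<integral>\<omega>. ?I \<omega> * ?w \<omega> \<partial>M) - (\<integral>\<omega>. (\<Sum>j\<in>?F J. ?b j * ?x j \<omega>) * ?w \<omega> \<partial>M)"
      by simp
    also have "\<dots> = (\<integral>\<omega>. (?I \<omega> - (\<Sum>j\<in>?F J. ?b j * ?x j \<omega>)) * ?w \<omega> \<partial>M)"
      unfolding left_diff_distrib
      by (rule Bochner_Integration.integral_diff[symmetric, OF Iw])
         (unfold sum_distrib_right mult.assoc, use xw in simp)
    finally have e: "(\<integral>\<omega>. ?I \<omega> * ?w \<omega> \<partial>M) - ?b k * c_coef M X W k
        = (\<integral>\<omega>. (?I \<omega> - (\<Sum>j\<in>?F J. ?b j * ?x j \<omega>)) * ?w \<omega> \<partial>M)" .
    have "integrable M (\<lambda>\<omega>. ?I \<omega> * ?w \<omega> - (\<Sum>j\<in>?F J. ?b j * (?x j \<omega> * ?w \<omega>)))"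
      using xw Iw by simp
    then have int: "integrable M (\<lambda>\<omega>. (?I \<omega> - (\<Sum>j\<in>?F J. ?b j * ?x j \<omega>)) * ?w \<omega>)"
      by (simp add: left_diff_distrib sum_distrib_right mult.assoc)
    have "cmod (\<integral>\<omega>. (?I \<omega> - (\<Sum>j\<in>?F J. ?b j * ?x j \<omega>)) * ?w \<omega> \<partial>M)
        \<le> (\<integral>\<omega>. cmod ((?I \<omega> - (\<Sum>j\<in>?F J. ?b j * ?x j \<omega>)) * ?w \<omega>) \<partial>M)"
      by (rule integral_norm_bound)
    also have "\<dots> \<le> (\<integral>\<omega>. sqrt (?d J) * (?r \<omega> * cmod (?w \<omega>)) \<partial>M)"
    proof (rule integral_mono_AE)
      show "integrable M (\<lambda>\<omega>. cmod ((?I \<omega> - (\<Sum>j\<in>?F J. ?b j * ?x j \<omega>)) * ?w \<omega>))"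
        using int by (rule integrable_norm)
      show "integrable M (\<lambda>\<omega>. sqrt (?d J) * (?r \<omega> * cmod (?w \<omega>)))"
        using rw by simp
      show "AE \<omega> in M. cmod ((?I \<omega> - (\<Sum>j\<in>?F J. ?b j * ?x j \<omega>)) * ?w \<omega>)
          \<le> sqrt (?d J) * (?r \<omega> * cmod (?w \<omega>))"
        using diff[of J]
      proof eventually_elim
        case (elim \<omega>)
        show ?case
          unfolding norm_mult mult.assoc[symmetric] by (rule mult_right_mono[OF elim]) simp
      qed
    qed
    also have "\<dots> = sqrt (?d J) * D" by (simp add: D_def)
    finally show ?thesis unfolding e .
  qed
  have "(\<lambda>J. sqrt (?d J) * D) \<longlonglongrightarrow> sqrt 0 * D"
    by (intro tendsto_intros trig_approx_tendsto \<beta>)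
  then have "cmod ((\<integral>\<omega>. ?I \<omega> * ?w \<omega> \<partial>M) - ?b k * c_coef M X W k) \<le> sqrt 0 * D"
    by (rule LIMSEQ_le_const) (use bound in blast)
  then show ?thesis by simp
qed

end

section \<open>Moments in the linear model\<close>

lemma \<gamma>_ge_1: "1 \<le> \<gamma> k"
  by (simp add: \<gamma>_def)

lemma \<gamma>_pos: "0 < \<gamma> k"
  using \<gamma>_ge_1[of k] by linarith

lemma power8_add_le: "(u + v) ^ 8 \<le> 128 * u ^ 8 + 128 * v ^ 8" for u v :: real
proof -
  have p8: "z ^ 8 = (z\<^sup>2) ^ 4" for z :: real by (simp add: power_mult[symmetric])
  have "(u + v)\<^sup>2 \<le> 2 * u\<^sup>2 + 2 * v\<^sup>2"
    using sum_squares_bound[of u v] by (simp add: power2_sum)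
  then have "((u + v)\<^sup>2) ^ 4 \<le> (2 * u\<^sup>2 + 2 * v\<^sup>2) ^ 4" by (intro power_mono) auto
  also have "\<dots> \<le> 8 * (2 * u\<^sup>2) ^ 4 + 8 * (2 * v\<^sup>2) ^ 4" by (rule power4_add_le)
  finally show ?thesis unfolding p8 by (simp add: power_mult_distrib)
qed

lemma the_inv_into_powr:
  fixes q y :: real
  assumes q: "0 < q" and y: "0 \<le> y"
  shows "the_inv_into {0..} (\<lambda>t. t powr q) y = y powr (1 / q)"
proof (rule the_inv_into_f_eq)
  show "inj_on (\<lambda>t. t powr q) {0..}"
  proof (rule inj_onI)
    fix s t :: real
    assume st: "s \<in> {0..}" "t \<in> {0..}" "s powr q = t powr q"
    have "s \<le> t \<longleftrightarrow> s powr q \<le> t powr q" and "t \<le> s \<longleftrightarrow> t powr q \<le> s powr q"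
      using st q powr_less_mono2[OF q, of t s] powr_less_mono2[OF q, of s t]
        powr_mono2[of q s t] powr_mono2[of q t s] by force+
    then show "s = t" using st(3) by auto
  qed
  show "(y powr (1 / q)) powr q = y" using q y by (simp add: powr_powr)
qed simp

section \<open>The model class and the decay of its eigenvalues\<close>

text \<open>One member of the class over which the supremum is taken. A bound proved here is uniform
  over the class when its constant mentions only the real parameters.\<close>

locale linear_model = prob_space M for M :: "'a measure" +
  fixes \<sigma> p \<rho> a \<nu> d \<eta> \<tau> \<Lambda> :: real and l m :: nat
    and \<beta> :: "real \<Rightarrow> real" and X W :: "'a \<Rightarrow> real \<Rightarrow> real" and U :: "'a \<Rightarrow> real"
  assumes pos: "\<sigma> > 0" "p > 0" "\<rho> > 0" "a > 0" "0 \<le> \<nu>" "\<nu> < p"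
    and lm: "l \<ge> 16" "m \<ge> 32"
    and ge1: "d \<ge> 1" "\<eta> \<ge> 1" "\<tau> \<ge> 1" "\<Lambda> \<ge> 1"
    and ball: "cfun \<beta> \<in> sobolev_ball p \<rho>"
    and pair: "(X, W) \<in> pair_link_class M m \<eta> \<tau> (\<lambda>t. t powr ((p - \<nu>) / (a + \<nu>))) d \<nu> p \<Lambda>"
    and err: "U \<in> error_class M l \<eta>"
    and UW: "\<And>t. t \<in> {0..1} \<Longrightarrow> (\<integral>\<omega>. U \<omega> * W \<omega> t \<partial>M) = 0"
begin

abbreviation x where "x \<equiv> var_coef M X"
abbreviation w where "w \<equiv> var_coef M W"
abbreviation c where "c \<equiv> c_coef M X W"
abbreviation lambda where "lambda \<equiv> lam M X W"
abbreviation b where "b k \<equiv> l2_inner (cfun \<beta>) (\<phi> k)"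
abbreviation xi where "xi k \<omega> \<equiv> l2_inner (\<phi> k) (cfun (X \<omega>))"
abbreviation om where "om k \<omega> \<equiv> l2_inner (cfun (W \<omega>)) (\<phi> k)"
abbreviation Y where "Y \<equiv> response \<sigma> \<beta> X U"

lemma stationary: "(X, W) \<in> stationary_pairs M"
  and momX: "max_std_moment M m X \<le> ennreal \<eta>" and momW: "max_std_moment M m W \<le> ennreal \<eta>"
  and sup_ratio: "max 1 (SUP k. ennreal (lambda k / w k)) \<le> ennreal \<tau>"
  and link: "lambda \<in> link_class (\<lambda>t. t powr ((p - \<nu>) / (a + \<nu>))) d \<nu> p"
  and normX: "mean_sq_norm M X \<le> ennreal \<Lambda>" and normW: "mean_sq_norm M W \<le> ennreal \<Lambda>"
  using pair by (auto simp: pair_link_class_def pair_class_def)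

lemma rX: "random_function M X" and rW: "random_function M W"
  and cX: "centered_second_order M X" and cW: "centered_second_order M W"
  using stationary by (auto simp: stationary_pairs_def)

lemma om_measurable [measurable]: "om k \<in> borel_measurable M"
  by (rule coef_measurable[OF rW])

lemma xi_measurable [measurable]: "xi k \<in> borel_measurable M"
proof -
  note [measurable] = coef_measurable[OF rX]
  show ?thesis by (subst l2_inner_commute) measurable
qed

lemma xi_sq_integrable: "integrable M (\<lambda>\<omega>. (cmod (xi k \<omega>))\<^sup>2)"
  using coef_sq_integrable[OF rX, of k] by (simp add: norm_l2_inner_commute)

lemma om_sq_integrable: "integrable M (\<lambda>\<omega>. (cmod (om k \<omega>))\<^sup>2)"
  by (rule coef_sq_integrable[OF rW])

lemma x_eq: "x k = (\<integral>\<omega>. (cmod (xi k \<omega>))\<^sup>2 \<partial>M)"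
  by (simp add: var_coef_eq[OF rX cX] norm_l2_inner_commute)

lemma w_eq: "w k = (\<integral>\<omega>. (cmod (om k \<omega>))\<^sup>2 \<partial>M)"
  by (rule var_coef_eq[OF rW cW])

lemma x_nonneg: "0 \<le> x k" and w_nonneg: "0 \<le> w k"
  by (simp_all add: x_eq w_eq)

lemma sum_x_le: "finite F \<Longrightarrow> (\<Sum>k\<in>F. x k) \<le> \<Lambda>"
  using sum_coef_sq_le[OF rX normX] ge1 by (simp add: var_coef_eq[OF rX cX])

lemma sum_w_le: "finite F \<Longrightarrow> (\<Sum>k\<in>F. w k) \<le> \<Lambda>"
  using sum_coef_sq_le[OF rW normW] ge1 by (simp add: var_coef_eq[OF rW cW])

lemma x_le: "x k \<le> \<Lambda>"
  using sum_x_le[of "{k}"] by simp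

lemma c_sq_le: "(cmod (c k))\<^sup>2 \<le> x k * w k"
  unfolding c_coef_def x_eq w_eq
  by (rule cauchy_schwarz_integral(3)) (simp_all add: xi_sq_integrable om_sq_integrable)

text \<open>Cauchy-Schwarz for \<open>c k\<close>, or division by zero when \<open>w k\<close> is 0.
  It passes the bound \<Lambda> from the variances of X to the eigenvalues, and positivity of the
  eigenvalues back to \<open>x k\<close>.\<close>

lemma lambda_le_x: "lambda k \<le> x k"
proof (cases "w k = 0")
  case False
  then have "0 < w k" using w_nonneg[of k] by simp
  then show ?thesis using c_sq_le[of k] by (simp add: lam_def pos_divide_le_eq)
qed (simp add: lam_def x_nonneg)

lemma lam_plus_bounds: "1 \<le> lam_plus lambda" "lam_plus lambda \<le> \<Lambda>"
proof -
  have "(SUP k. lambda k) \<le> \<Lambda>"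
    by (rule cSUP_least) (auto intro: order_trans[OF lambda_le_x x_le])
  then show "1 \<le> lam_plus lambda" "lam_plus lambda \<le> \<Lambda>"
    using ge1 by (auto simp: lam_plus_def)
qed

text \<open>For this \<kappa> the inverse at \<open>\<gamma> k powr (\<nu> - p)\<close> is
  \<open>\<gamma> k powr (- (a + \<nu>))\<close>, so the link condition says that the eigenvalues
  decay like \<open>\<gamma> k powr (- a)\<close>. Since \<open>lam_plus\<close> lies between 1 and
  \<Lambda>, only the upper bound pays for the normalisation.\<close>

lemma lambda_bounds:
  "\<gamma> k powr (- a) / d \<le> lambda k" "lambda k \<le> d * \<Lambda> * \<gamma> k powr (- a)"
proof -
  let ?g = "\<gamma> k" and ?L = "lam_plus lambda"
  have g: "0 < ?g" by (rule \<gamma>_pos)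
  have "the_inv_into {0..} (\<lambda>t. t powr ((p - \<nu>) / (a + \<nu>))) (?g powr (\<nu> - p))
      = (?g powr (\<nu> - p)) powr (1 / ((p - \<nu>) / (a + \<nu>)))"
    using pos by (intro the_inv_into_powr) auto
  also have "\<dots> = ?g powr (- (a + \<nu>))"
    unfolding powr_powr using pos by (intro arg_cong2[where f = "(powr)"] refl) (simp add: field_simps)
  finally have inv: "the_inv_into {0..} (\<lambda>t. t powr ((p - \<nu>) / (a + \<nu>))) (?g powr (\<nu> - p))
      = ?g powr (- (a + \<nu>))" .
  have L: "0 < ?g powr \<nu> * ?L" using g lam_plus_bounds by simp
  have pm: "?g powr (- (a + \<nu>)) * ?g powr \<nu> = ?g powr (- a)"
    by (simp add: powr_add[symmetric])
  have lo: "?g powr (- (a + \<nu>)) / d \<le> lambda k / (?g powr \<nu> * ?L)"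
    and hi: "lambda k / (?g powr \<nu> * ?L) \<le> d * ?g powr (- (a + \<nu>))"
    unfolding inv[symmetric] using link unfolding link_class_def by blast+
  have "?g powr (- a) / d \<le> ?g powr (- a) / d * ?L"
    using mult_left_mono[OF lam_plus_bounds(1), of "?g powr (- a) / d"] ge1 by simp
  also have "\<dots> = ?g powr (- (a + \<nu>)) / d * (?g powr \<nu> * ?L)"
    unfolding pm[symmetric] by simp
  also have "\<dots> \<le> lambda k"
    using lo unfolding pos_le_divide_eq[OF L] .
  finally show "?g powr (- a) / d \<le> lambda k" .
  have "lambda k \<le> d * ?g powr (- (a + \<nu>)) * (?g powr \<nu> * ?L)"
    using hi unfolding pos_divide_le_eq[OF L] .
  also have "\<dots> = d * ?g powr (- a) * ?L"
    unfolding pm[symmetric] by simp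
  also have "\<dots> \<le> d * ?g powr (- a) * \<Lambda>"
    using ge1 by (intro mult_left_mono lam_plus_bounds) auto
  finally show "lambda k \<le> d * \<Lambda> * ?g powr (- a)" by (simp add: mult_ac)
qed

lemma lambda_pos: "0 < lambda k"
proof -
  have "0 < \<gamma> k powr (- a) / d" using \<gamma>_pos[of k] ge1 by simp
  then show ?thesis using lambda_bounds(1)[of k] by linarith
qed

lemma w_pos: "0 < w k" and x_pos: "0 < x k"
proof -
  \<comment> \<open>\<open>lam\<close> divides by \<open>w k\<close>, and division by zero would
    make the positive \<open>lambda k\<close> equal to 0.\<close>
  have "w k \<noteq> 0" using lambda_pos[of k] by (auto simp: lam_def)
  then show "0 < w k" using w_nonneg[of k] by simp
  show "0 < x k" using lambda_pos[of k] lambda_le_x[of k] by simp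
qed

lemma c_sq_eq: "(cmod (c k))\<^sup>2 = lambda k * w k"
  using w_pos[of k] by (simp add: lam_def)

lemma lambda_le_w: "lambda k \<le> \<tau> * w k"
proof -
  have "ennreal (lambda k / w k) \<le> (SUP k. ennreal (lambda k / w k))" by (rule SUP_upper) simp
  also have "\<dots> \<le> ennreal \<tau>" using sup_ratio by (simp only: max.bounded_iff)
  finally have "lambda k / w k \<le> \<tau>" using ge1 by simp
  then show ?thesis using w_pos[of k] by (simp add: pos_divide_le_eq)
qed

lemma sum_b_le:
  assumes F: "finite F"
  shows "(\<Sum>k\<in>F. \<gamma> k powr p * (cmod (b k))\<^sup>2) \<le> \<rho>"
proof -
  have "ennreal (\<Sum>k\<in>F. \<gamma> k powr p * (cmod (b k))\<^sup>2) = (\<Sum>k\<in>F. ennreal (\<gamma> k powr p * (cmod (b k))\<^sup>2))"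
    by (subst sum_ennreal) auto
  also have "\<dots> \<le> norm2 p (cfun \<beta>)"
    unfolding norm2_def using F
    by (subst nonneg_infsum_complete) (auto intro!: SUP_upper2[of F])
  also have "\<dots> \<le> ennreal \<rho>" using ball by (simp add: sobolev_ball_def)
  finally show ?thesis using pos by simp
qed

lemma \<beta>_L2: "cfun \<beta> \<in> L2"
  using ball by (simp add: sobolev_ball_def sobolev_def)

lemma \<beta>_norm: "(\<integral>t. (\<beta> t)\<^sup>2 \<partial>unit_leb) \<le> \<rho>"
proof (rule LIMSEQ_le_const2[OF parseval[OF \<beta>_L2]])
  have "(\<Sum>k\<in>F. (cmod (b k))\<^sup>2) \<le> \<rho>" if "finite F" for F
  proof -
    have "(\<Sum>k\<in>F. (cmod (b k))\<^sup>2) \<le> (\<Sum>k\<in>F. \<gamma> k powr p * (cmod (b k))\<^sup>2)"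
    proof (rule sum_mono)
      fix k
      have "1 \<le> \<gamma> k powr p" using \<gamma>_ge_1[of k] pos by (intro ge_one_powr_ge_zero) auto
      then show "(cmod (b k))\<^sup>2 \<le> \<gamma> k powr p * (cmod (b k))\<^sup>2"
        using mult_right_mono[of 1 "\<gamma> k powr p" "(cmod (b k))\<^sup>2"] by simp
    qed
    then show ?thesis using sum_b_le[OF that] by linarith
  qed
  then show "\<exists>N. \<forall>J\<ge>N. (\<Sum>k\<in>{-int J..int J}. (cmod (b k))\<^sup>2) \<le> \<rho>" by simp
qed

lemma error_classD: "U \<in> borel_measurable M" "integrable M (\<lambda>\<omega>. (U \<omega>)\<^sup>2)"
  "(\<integral>\<^sup>+\<omega>. ennreal (\<bar>U \<omega>\<bar> ^ l) \<partial>M) \<le> ennreal \<eta>"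
  using err by (auto simp: error_class_def)

lemma Y_measurable [measurable]: "Y \<in> borel_measurable M"
proof -
  note [measurable] = error_classD(1) inner_measurable[OF rX \<beta>_L2]
  show ?thesis unfolding response_def by measurable
qed

section \<open>Moments of the three deviations\<close>

text \<open>By \<open>power8_le\<close> a bound \<eta> on a moment of order at least 8 becomes the
  bound 1 + \<eta> at order 8.\<close>

definition K :: real where "K = 1 + \<eta>"

lemma K_pos: "0 < K"
  using ge1 by (simp add: K_def)

lemma xi_moment8: "mean_le M (\<lambda>\<omega>. cmod (xi k \<omega>) ^ 8) (K * x k ^ 4)"
  using std_moment8[OF rX momX, of k] lm ge1 x_pos[of k] by (simp add: K_def norm_l2_inner_commute)

lemma om_moment8: "mean_le M (\<lambda>\<omega>. cmod (om k \<omega>) ^ 8) (K * w k ^ 4)"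
  using std_moment8[OF rW momW, of k] lm ge1 w_pos[of k] by (simp add: K_def)

lemma U_moment8: "mean_le M (\<lambda>\<omega>. \<bar>U \<omega>\<bar> ^ 8) K"
proof (rule mean_le_mono)
  have "mean_le M (\<lambda>\<omega>. \<bar>U \<omega>\<bar> ^ l) \<eta>" using error_classD by (simp add: mean_le_def)
  then show "mean_le M (\<lambda>\<omega>. 1 + \<bar>U \<omega>\<bar> ^ l) (1 + \<eta>)"
    using ge1 by (intro mean_le_add mean_le_const) auto
  show "AE \<omega> in M. \<bar>U \<omega>\<bar> ^ 8 \<le> 1 + \<bar>U \<omega>\<bar> ^ l"
    using lm by (intro AE_I2 power8_le) auto
qed (use error_classD(1) in \<open>auto simp: K_def\<close>)

text \<open>The summands whose sample means drive the error. Subtracting \<open>b k * xi k\<close>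
  from the response makes the mean of \<open>Z_resid k\<close> the numerator of the error of a kept
  coefficient. \<open>Z_w\<close> is complex-valued so that one moment bound for sample means serves
  all three.\<close>

definition Z_resid :: "int \<Rightarrow> 'a \<Rightarrow> complex" where
  "Z_resid k \<omega> = (of_real (Y \<omega>) - b k * xi k \<omega>) * om k \<omega>"
definition Z_c :: "int \<Rightarrow> 'a \<Rightarrow> complex" where
  "Z_c k \<omega> = xi k \<omega> * om k \<omega> - c k"
definition Z_w :: "int \<Rightarrow> 'a \<Rightarrow> complex" where
  "Z_w k \<omega> = of_real ((cmod (om k \<omega>))\<^sup>2 - w k)"

lemma Z_measurable [measurable]:
  "Z_resid k \<in> borel_measurable M" "Z_c k \<in> borel_measurable M" "Z_w k \<in> borel_measurable M"
  unfolding Z_resid_def Z_c_def Z_w_def by measurable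

lemma xi_om_integrable: "integrable M (\<lambda>\<omega>. xi k \<omega> * om k \<omega>)"
  by (rule cauchy_schwarz_integral(1)) (simp_all add: xi_sq_integrable om_sq_integrable)

text \<open>For the residual: the other coefficients of X are uncorrelated with \<open>om k\<close>,
  so the product of \<open>om k\<close> with the integral of \<beta> against X has mean
  \<open>b k * c k\<close>, which is exactly what the subtracted term removes. The noise part
  vanishes because U is uncorrelated with W at each time.\<close>

lemma Z_centered: "(\<integral>\<omega>. Z_resid k \<omega> \<partial>M) = 0" "(\<integral>\<omega>. Z_c k \<omega> \<partial>M) = 0" "(\<integral>\<omega>. Z_w k \<omega> \<partial>M) = 0"
proof -
  note [measurable] = error_classD(1) inner_measurable[OF rX \<beta>_L2]
  let ?I = "\<lambda>\<omega>. complex_of_real (\<integral>t. \<beta> t * X \<omega> t \<partial>unit_leb)"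
  have i1: "integrable M (\<lambda>\<omega>. ?I \<omega> * om k \<omega>)"
    by (rule cauchy_schwarz_integral(1)) (simp_all add: inner_sq_integrable[OF rX \<beta>_L2] om_sq_integrable)
  have i2: "integrable M (\<lambda>\<omega>. of_real (U \<omega>) * om k \<omega>)"
    by (rule cauchy_schwarz_integral(1)) (simp_all add: error_classD om_sq_integrable)
  have "Z_resid k \<omega> = ?I \<omega> * om k \<omega> + of_real \<sigma> * (of_real (U \<omega>) * om k \<omega>) - b k * (xi k \<omega> * om k \<omega>)" for \<omega>
    by (simp add: Z_resid_def response_def algebra_simps)
  then have "(\<integral>\<omega>. Z_resid k \<omega> \<partial>M) = (\<integral>\<omega>. ?I \<omega> * om k \<omega> \<partial>M)
      + of_real \<sigma> * (\<integral>\<omega>. of_real (U \<omega>) * om k \<omega> \<partial>M) - b k * (\<integral>\<omega>. xi k \<omega> * om k \<omega> \<partial>M)"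
    using i1 i2 xi_om_integrable[of k] by simp
  also have "(\<integral>\<omega>. of_real (U \<omega>) * om k \<omega> \<partial>M) = 0"
    by (rule uncorrelated_coef[OF rW error_classD(1,2) UW])
  finally show "(\<integral>\<omega>. Z_resid k \<omega> \<partial>M) = 0"
    using expectation_inner_coef[OF stationary \<beta>_L2, of k] by (simp add: c_coef_def)
  show "(\<integral>\<omega>. Z_c k \<omega> \<partial>M) = 0"
    using xi_om_integrable[of k] by (simp add: Z_c_def prob_space c_coef_def)
  have "(\<integral>\<omega>. (cmod (om k \<omega>))\<^sup>2 - w k \<partial>M) = 0"
    using om_sq_integrable[of k] by (simp add: prob_space w_eq)
  then show "(\<integral>\<omega>. Z_w k \<omega> \<partial>M) = 0"
    unfolding Z_w_def by (subst integral_complex_of_real) simp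
qed

text \<open>The residual is at most \<open>2 * sqrt \<rho>\<close> times the norm of X plus
  \<open>\<sigma> * \<bar>U \<omega>\<bar>\<close>. Here 128 comes from \<open>power8_add_le\<close>
  and 256 is \<open>2 ^ 8\<close>. \<open>B1\<close> arises from Cauchy-Schwarz for the residual
  times \<open>om k\<close>; the 8 in \<open>B2\<close> is that of \<open>power4_add_le\<close>, and
  its extra 1 pays for centring.\<close>

definition B0 :: real where "B0 = 128 * (256 * \<rho> ^ 4 * (K * \<Lambda> ^ 4)) + 128 * (\<sigma> ^ 8 * K)"
definition B1 :: real where "B1 = sqrt (B0 * K)"
definition B2 :: real where "B2 = 8 * (K + 1)"

lemma B_nonneg: "0 \<le> B0" "0 \<le> B1" "0 \<le> B2"
  using K_pos pos ge1 by (simp_all add: B0_def B1_def B2_def)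

lemma sq_norm_moment: "mean_le M (\<lambda>\<omega>. (\<integral>t. (X \<omega> t)\<^sup>2 \<partial>unit_leb) ^ 4) (K * \<Lambda> ^ 4)"
proof (rule sq_norm_fourth_moment[OF rX cX x_pos _ normX])
  show "mean_le M (\<lambda>\<omega>. cmod (l2_inner (cfun (X \<omega>)) (\<phi> k)) ^ 8) (K * x k ^ 4)" for k
    using xi_moment8[of k] by (simp add: norm_l2_inner_commute)
qed (use K_pos ge1 in auto)

text \<open>The bound is uniform in k although \<open>b k * xi k\<close> is subtracted: by Bessel's
  inequality this product is dominated by the same two norms as the noiseless response.\<close>

lemma residual_moment8: "mean_le M (\<lambda>\<omega>. cmod (of_real (Y \<omega>) - b k * xi k \<omega>) ^ 8) B0"
proof (rule mean_le_mono)
  let ?S = "\<lambda>\<omega>. \<integral>t. (X \<omega> t)\<^sup>2 \<partial>unit_leb"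
  show "mean_le M (\<lambda>\<omega>. 128 * (256 * \<rho> ^ 4 * ?S \<omega> ^ 4) + 128 * (\<sigma> ^ 8 * \<bar>U \<omega>\<bar> ^ 8)) B0"
    unfolding B0_def using pos K_pos ge1
    by (intro mean_le_add mean_le_cmult sq_norm_moment U_moment8) simp_all
  show "AE \<omega> in M. cmod (of_real (Y \<omega>) - b k * xi k \<omega>) ^ 8
      \<le> 128 * (256 * \<rho> ^ 4 * ?S \<omega> ^ 4) + 128 * (\<sigma> ^ 8 * \<bar>U \<omega>\<bar> ^ 8)"
    using random_function_L2[OF rX]
  proof eventually_elim
    case (elim \<omega>)
    let ?r = "sqrt \<rho> * sqrt (?S \<omega>)"
    have i: "\<bar>\<integral>t. \<beta> t * X \<omega> t \<partial>unit_leb\<bar> \<le> ?r"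
      by (rule order_trans[OF integral_mult_le[OF \<beta>_L2 elim]])
         (intro mult_right_mono real_sqrt_le_mono \<beta>_norm, simp)
    have "(cmod (b k))\<^sup>2 \<le> \<rho>" "(cmod (xi k \<omega>))\<^sup>2 \<le> ?S \<omega>"
      using bessel[OF \<beta>_L2, of "{k}"] \<beta>_norm bessel[OF elim, of "{k}"]
      by (simp_all add: norm_l2_inner_commute[of "\<phi> k"])
    then have "cmod (b k * xi k \<omega>) \<le> ?r"
      unfolding norm_mult by (intro mult_mono real_le_rsqrt) (use pos in auto)
    moreover have "cmod (of_real (Y \<omega>)) \<le> ?r + \<sigma> * \<bar>U \<omega>\<bar>"
      unfolding norm_of_real response_def
      using abs_triangle_ineq[of "\<integral>t. \<beta> t * X \<omega> t \<partial>unit_leb" "\<sigma> * U \<omega>"] i pos by (simp add: abs_mult)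
    ultimately have "cmod (of_real (Y \<omega>) - b k * xi k \<omega>) \<le> 2 * ?r + \<sigma> * \<bar>U \<omega>\<bar>"
      using norm_triangle_ineq4[of "of_real (Y \<omega>)" "b k * xi k \<omega>"] by linarith
    then have "cmod (of_real (Y \<omega>) - b k * xi k \<omega>) ^ 8 \<le> (2 * ?r + \<sigma> * \<bar>U \<omega>\<bar>) ^ 8"
      by (intro power_mono) auto
    also have "\<dots> \<le> 128 * (2 * ?r) ^ 8 + 128 * (\<sigma> * \<bar>U \<omega>\<bar>) ^ 8" by (rule power8_add_le)
    also have "(2 * ?r) ^ 8 = 256 * \<rho> ^ 4 * ?S \<omega> ^ 4"
    proof -
      have s8: "sqrt z ^ 8 = z ^ 4" if "0 \<le> z" for z
      proof -
        have "sqrt z ^ 8 = ((sqrt z)\<^sup>2) ^ 4" by (simp only: power_mult[symmetric]) simp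
        then show ?thesis using that by simp
      qed
      have "0 \<le> ?S \<omega>" by simp
      then show ?thesis using pos by (simp only: power_mult_distrib s8 less_imp_le) simp
    qed
    also have "(\<sigma> * \<bar>U \<omega>\<bar>) ^ 8 = \<sigma> ^ 8 * \<bar>U \<omega>\<bar> ^ 8" by (rule power_mult_distrib)
    finally show ?case .
  qed
qed simp_all

lemma Z_resid_moment: "mean_le M (\<lambda>\<omega>. cmod (Z_resid k \<omega>) ^ 4) (B1 * (w k)\<^sup>2)"
proof -
  let ?A = "\<lambda>\<omega>. cmod (of_real (Y \<omega>) - b k * xi k \<omega>)"
  have "mean_le M (\<lambda>\<omega>. ?A \<omega> ^ 4 * cmod (om k \<omega>) ^ 4) (sqrt (B0 * (K * w k ^ 4)))"
    using residual_moment8[of k] om_moment8[of k] B_nonneg K_pos w_nonneg[of k]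
    by (intro mean_le_mult) (simp_all add: power_mult[symmetric])
  moreover have "sqrt (B0 * (K * w k ^ 4)) = B1 * (w k)\<^sup>2"
  proof -
    have "sqrt (w k ^ 4) = (w k)\<^sup>2" by (rule real_sqrt_unique) (simp_all add: power_mult[symmetric])
    then show ?thesis by (simp add: B1_def real_sqrt_mult mult.assoc)
  qed
  ultimately show ?thesis by (simp add: Z_resid_def norm_mult power_mult_distrib)
qed

lemma Z_c_moment: "mean_le M (\<lambda>\<omega>. cmod (Z_c k \<omega>) ^ 4) (B2 * ((x k)\<^sup>2 * (w k)\<^sup>2))"
proof (rule mean_le_mono)
  have "mean_le M (\<lambda>\<omega>. cmod (xi k \<omega>) ^ 4 * cmod (om k \<omega>) ^ 4) (sqrt ((K * x k ^ 4) * (K * w k ^ 4)))"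
    using xi_moment8[of k] om_moment8[of k] K_pos x_nonneg[of k] w_nonneg[of k]
    by (intro mean_le_mult) (simp_all add: power_mult[symmetric])
  moreover have "sqrt ((K * x k ^ 4) * (K * w k ^ 4)) = K * ((x k)\<^sup>2 * (w k)\<^sup>2)"
    using K_pos by (intro real_sqrt_unique) (simp_all add: power_mult_distrib power_mult[symmetric] power2_eq_square[of K])
  ultimately have "mean_le M (\<lambda>\<omega>. cmod (xi k \<omega>) ^ 4 * cmod (om k \<omega>) ^ 4) (K * ((x k)\<^sup>2 * (w k)\<^sup>2))"
    by simp
  then show "mean_le M (\<lambda>\<omega>. 8 * (cmod (xi k \<omega>) ^ 4 * cmod (om k \<omega>) ^ 4) + 8 * cmod (c k) ^ 4)
      (8 * (K * ((x k)\<^sup>2 * (w k)\<^sup>2)) + 8 * cmod (c k) ^ 4)"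
    using K_pos by (intro mean_le_add mean_le_cmult mean_le_const) simp_all
  have "cmod (Z_c k \<omega>) ^ 4 \<le> 8 * (cmod (xi k \<omega>) ^ 4 * cmod (om k \<omega>) ^ 4) + 8 * cmod (c k) ^ 4" for \<omega>
  proof -
    have "cmod (Z_c k \<omega>) ^ 4 \<le> (cmod (xi k \<omega> * om k \<omega>) + cmod (c k)) ^ 4"
      unfolding Z_c_def by (intro power_mono norm_triangle_ineq4) simp
    also note power4_add_le
    finally show ?thesis by (simp add: norm_mult power_mult_distrib)
  qed
  then show "AE \<omega> in M. cmod (Z_c k \<omega>) ^ 4 \<le> 8 * (cmod (xi k \<omega>) ^ 4 * cmod (om k \<omega>) ^ 4) + 8 * cmod (c k) ^ 4"
    by simp
  \<comment> \<open>The centring constant is controlled by the same product of variances as the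
    random part, so it merely enlarges \<open>B2\<close>.\<close>
  have "((cmod (c k))\<^sup>2)\<^sup>2 \<le> (x k * w k)\<^sup>2" by (intro power_mono c_sq_le) simp
  then have "cmod (c k) ^ 4 \<le> (x k)\<^sup>2 * (w k)\<^sup>2" by (simp add: power_mult_distrib)
  then show "8 * (K * ((x k)\<^sup>2 * (w k)\<^sup>2)) + 8 * cmod (c k) ^ 4 \<le> B2 * ((x k)\<^sup>2 * (w k)\<^sup>2)"
    unfolding B2_def by (simp add: distrib_right)
qed measurable

lemma Z_w_moment: "mean_le M (\<lambda>\<omega>. cmod (Z_w k \<omega>) ^ 4) (B2 * w k ^ 4)"
proof (rule mean_le_mono)
  show "mean_le M (\<lambda>\<omega>. 8 * cmod (om k \<omega>) ^ 8 + 8 * w k ^ 4) (8 * (K * w k ^ 4) + 8 * w k ^ 4)"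
    using K_pos by (intro mean_le_add mean_le_cmult mean_le_const om_moment8) simp_all
  have "cmod (Z_w k \<omega>) ^ 4 \<le> 8 * cmod (om k \<omega>) ^ 8 + 8 * w k ^ 4" for \<omega>
  proof -
    have "cmod (Z_w k \<omega>) ^ 4 \<le> ((cmod (om k \<omega>))\<^sup>2 + w k) ^ 4"
      unfolding Z_w_def norm_of_real
      using abs_triangle_ineq4[of "(cmod (om k \<omega>))\<^sup>2" "w k"] w_nonneg[of k]
      by (intro power_mono) auto
    also note power4_add_le
    finally show ?thesis by (simp add: power_mult[symmetric])
  qed
  then show "AE \<omega> in M. cmod (Z_w k \<omega>) ^ 4 \<le> 8 * cmod (om k \<omega>) ^ 8 + 8 * w k ^ 4" by simp
  show "8 * (K * w k ^ 4) + 8 * w k ^ 4 \<le> B2 * w k ^ 4" by (simp add: B2_def distrib_right)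
qed measurable

end

section \<open>Deterministic bounds for the estimator\<close>

lemma infsum_finite_support:
  fixes f :: "'b \<Rightarrow> 'c::{comm_monoid_add, t2_space}"
  assumes "finite F" "\<And>k. k \<notin> F \<Longrightarrow> f k = 0"
  shows "(\<Sum>\<^sub>\<infinity>k. f k) = (\<Sum>k\<in>F. f k)"
  using infsum_cong_neutral[of F UNIV f f] assms by auto

text \<open>A counting argument: by Bessel's inequality any finitely many \<open>w_hat n W k\<close>
  add up to at most the average squared norm S of the sample, so at most \<open>S / \<alpha>\<close>
  of them reach \<alpha>.\<close>

lemma finite_w_hat_ge:
  assumes W: "\<And>i. i < n \<Longrightarrow> cfun (W i) \<in> L2" and \<alpha>: "0 < \<alpha>"
  shows "finite {k. \<alpha> \<le> w_hat n W k}"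
proof (rule ccontr)
  assume inf: "infinite {k. \<alpha> \<le> w_hat n W k}"
  define S where "S = (\<Sum>i<n. \<integral>t. (cmod (cfun (W i) t))\<^sup>2 \<partial>unit_leb) / real n"
  obtain N where N: "S / \<alpha> < real N" using reals_Archimedean2 by blast
  obtain F where F: "finite F" "card F = N" "F \<subseteq> {k. \<alpha> \<le> w_hat n W k}"
    using infinite_arbitrarily_large[OF inf] by blast
  have "real N * \<alpha> \<le> (\<Sum>k\<in>F. w_hat n W k)"
    using F sum_bounded_below[of F \<alpha> "w_hat n W"] by auto
  also have "\<dots> = (\<Sum>i<n. \<Sum>k\<in>F. (cmod (l2_inner (cfun (W i)) (\<phi> k)))\<^sup>2) / real n"
    unfolding w_hat_def sum_divide_distrib[symmetric] by (subst sum.swap) simp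
  also have "\<dots> \<le> S"
    unfolding S_def by (intro divide_right_mono sum_mono bessel W F(1)) auto
  finally show False using N \<alpha> by (simp add: pos_divide_less_eq)
qed

lemma w_hat_nonneg: "0 \<le> w_hat n W k"
  by (simp add: w_hat_def sum_nonneg)

context
  fixes n :: nat and \<alpha> \<nu> :: real and X W :: "nat \<Rightarrow> real \<Rightarrow> real" and Y :: "nat \<Rightarrow> real"
  assumes W: "\<And>i. i < n \<Longrightarrow> cfun (W i) \<in> L2" and \<alpha>: "0 < \<alpha>" and n: "0 < n"
begin

abbreviation (input) weight :: "int \<Rightarrow> complex" where
  "weight k \<equiv> cnj (c_hat n X W k) / complex_of_real (w_hat n W k) * of_bool (w_hat n W k \<ge> \<alpha>)"

lemma l2_inner_W_hat:
  "l2_inner (W_hat n \<alpha> X W i) (\<phi> k) = weight k * l2_inner (cfun (W i)) (\<phi> k)"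
proof -
  let ?F = "{k. \<alpha> \<le> w_hat n W k}"
  define cf where "cf = (\<lambda>j. weight j * l2_inner (cfun (W i)) (\<phi> j))"
  have fin: "finite ?F" by (rule finite_w_hat_ge[OF W \<alpha>])
  have "W_hat n \<alpha> X W i = (\<lambda>t. \<Sum>j\<in>?F. cf j * \<phi> j t)"
    unfolding W_hat_def cf_def using fin by (intro ext infsum_finite_support) auto
  then have "l2_inner (W_hat n \<alpha> X W i) (\<phi> k) = (if k \<in> ?F then cf k else 0)"
    by (simp only: l2_inner_trig_phi[OF fin])
  then show ?thesis by (simp add: cf_def)
qed

lemma lam_hat_eq:
  "lam_hat n \<alpha> X W k = of_bool (w_hat n W k \<ge> \<alpha>) * ((cmod (c_hat n X W k))\<^sup>2 / w_hat n W k)"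
proof -
  have "(\<Sum>i<n. (cmod (z * l2_inner (cfun (W i)) (\<phi> k)))\<^sup>2) / real n = (cmod z)\<^sup>2 * w_hat n W k" for z
    by (simp add: w_hat_def norm_mult power_mult_distrib sum_distrib_left)
  then have "lam_hat n \<alpha> X W k = (cmod (weight k))\<^sup>2 * w_hat n W k"
    unfolding lam_hat_def l2_inner_W_hat .
  also have "\<dots> = of_bool (w_hat n W k \<ge> \<alpha>) * ((cmod (c_hat n X W k))\<^sup>2 / w_hat n W k)"
    using w_hat_nonneg[of n W k] \<alpha>
    by (cases "w_hat n W k \<ge> \<alpha>") (auto simp: norm_divide power_divide power2_eq_square)
  finally show ?thesis .
qed

lemma g_hat_eq:
  "g_hat n \<alpha> Y X W k = weight k * ((\<Sum>i<n. of_real (Y i) * l2_inner (cfun (W i)) (\<phi> k)) / of_nat n)"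
proof -
  have "(\<Sum>i<n. of_real (Y i) * (z * l2_inner (cfun (W i)) (\<phi> k))) / of_nat n
      = z * ((\<Sum>i<n. of_real (Y i) * l2_inner (cfun (W i)) (\<phi> k)) / of_nat n)" for z
    by (simp add: sum_distrib_left mult.left_commute)
  then show ?thesis unfolding g_hat_def l2_inner_W_hat .
qed

text \<open>\<open>g_hat\<close> carries the factor
  \<open>cnj (c_hat n X W k) / w_hat n W k\<close>, and \<open>lam_hat\<close> is
  \<open>c_hat n X W k\<close> times the same factor. It cancels in the quotient and leaves a plain
  ratio.\<close>

lemma norm2_error:
  assumes \<beta>: "cfun \<beta> \<in> L2"
  shows "norm2 \<nu> (\<lambda>t. beta_hat \<nu> n \<alpha> Y X W t - complex_of_real (\<beta> t))
       = (\<Sum>\<^sub>\<infinity>k. ennreal (\<gamma> k powr \<nu> * (cmod (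
           (if w_hat n W k \<ge> \<alpha> \<and> (cmod (c_hat n X W k))\<^sup>2 / w_hat n W k \<ge> \<alpha> * \<gamma> k powr \<nu>
            then ((\<Sum>i<n. of_real (Y i) * l2_inner (cfun (W i)) (\<phi> k)) / of_nat n) / c_hat n X W k
            else 0) - l2_inner (cfun \<beta>) (\<phi> k)))\<^sup>2))"
proof -
  let ?F = "{k. \<alpha> \<le> w_hat n W k}"
  define e where "e k = g_hat n \<alpha> Y X W k / complex_of_real (lam_hat n \<alpha> X W k)
       * of_bool (lam_hat n \<alpha> X W k / \<gamma> k powr \<nu> \<ge> \<alpha>)" for k
  have fin: "finite ?F" by (rule finite_w_hat_ge[OF W \<alpha>])
  have b: "beta_hat \<nu> n \<alpha> Y X W = (\<lambda>t. \<Sum>k\<in>?F. e k * \<phi> k t)"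
    unfolding beta_hat_def e_def using fin
    by (intro ext infsum_finite_support) (auto simp: lam_hat_eq)
  have ik: "l2_inner (\<lambda>t. beta_hat \<nu> n \<alpha> Y X W t - cfun \<beta> t) (\<phi> k) = e k - l2_inner (cfun \<beta>) (\<phi> k)" for k
    unfolding b l2_inner_diff_phi[OF trig_in_L2 \<beta>] l2_inner_trig_phi[OF fin]
    by (auto simp: e_def lam_hat_eq)
  have "e k = (if w_hat n W k \<ge> \<alpha> \<and> (cmod (c_hat n X W k))\<^sup>2 / w_hat n W k \<ge> \<alpha> * \<gamma> k powr \<nu>
            then ((\<Sum>i<n. of_real (Y i) * l2_inner (cfun (W i)) (\<phi> k)) / of_nat n) / c_hat n X W k
            else 0)" for k
  proof (cases "w_hat n W k \<ge> \<alpha>")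
    case True
    have g: "0 < \<gamma> k powr \<nu>" using \<gamma>_pos[of k] by simp
    have wp: "0 < w_hat n W k" using True \<alpha> by simp
    have iff: "\<alpha> \<le> (cmod (c_hat n X W k))\<^sup>2 / w_hat n W k / \<gamma> k powr \<nu>
        \<longleftrightarrow> \<alpha> * \<gamma> k powr \<nu> \<le> (cmod (c_hat n X W k))\<^sup>2 / w_hat n W k"
      by (rule pos_le_divide_eq[OF g])
    let ?C = "c_hat n X W k"
    \<comment> \<open>If \<open>?C\<close> is 0, both sides are 0 because division by zero gives
      0.\<close>
    have "(cnj ?C / of_real (w_hat n W k) * G) / of_real ((cmod ?C)\<^sup>2 / w_hat n W k) = G / ?C" for G
    proof (cases "?C = 0")
      case False
      have "complex_of_real ((cmod ?C)\<^sup>2 / w_hat n W k) = ?C * cnj ?C / of_real (w_hat n W k)"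
        by (simp only: of_real_divide complex_norm_square)
      then show ?thesis using False wp by simp
    qed simp
    moreover have "weight k = cnj ?C / of_real (w_hat n W k)" using True by simp
    moreover have lam: "lam_hat n \<alpha> X W k = (cmod ?C)\<^sup>2 / w_hat n W k"
      using True by (simp add: lam_hat_eq)
    ultimately have "g_hat n \<alpha> Y X W k / of_real (lam_hat n \<alpha> X W k)
        = ((\<Sum>i<n. of_real (Y i) * l2_inner (cfun (W i)) (\<phi> k)) / of_nat n) / ?C"
      by (simp only: g_hat_eq)
    then show ?thesis
      unfolding e_def lam iff using True by simp
  \<comment> \<open>Below the first threshold \<open>lam_hat\<close> is 0, hence so is
    \<open>e k\<close>.\<close>
  qed (simp add: e_def lam_hat_eq)
  then show ?thesis
    unfolding norm2_def ik by simp
qed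

end

text \<open>On the event kept by both thresholds either \<open>w_hat\<close> is at least half of its mean, and then
  the threshold bounds the denominator from below, or a deviation of \<open>w_hat\<close> is paid for. At high
  frequencies keeping the coefficient forces a deviation of \<open>c_hat\<close> in addition.\<close>

lemma variance_pointwise:
  fixes C cc G bb :: complex and wh ww \<alpha> g la :: real
  assumes \<alpha>: "0 < \<alpha>" and g: "1 \<le> g" and ww: "0 < ww" and la: "(cmod cc)\<^sup>2 = la * ww"
    and wh: "\<alpha> \<le> wh" and keep: "\<alpha> * g \<le> (cmod C)\<^sup>2 / wh"
  shows "g * (cmod (G / C - bb))\<^sup>2
    \<le> 4 / (\<alpha>\<^sup>2 * ww\<^sup>2) * ((cmod (G - bb * C))\<^sup>2 * (wh - ww)\<^sup>2)
      + 16 / (\<alpha>\<^sup>2 * ww\<^sup>2) * ((cmod (G - bb * C))\<^sup>2 * (cmod (C - cc))\<^sup>2)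
      + (if la > \<alpha> * g / 8 then 2 / (\<alpha> * ww) * (cmod (G - bb * C))\<^sup>2 else 0)"
proof -
  define N where "N = (cmod (G - bb * C))\<^sup>2"
  have N0: "0 \<le> N" by (simp add: N_def)
  have whp: "0 < wh" using wh \<alpha> by simp
  have C2: "\<alpha> * g * wh \<le> (cmod C)\<^sup>2" using keep whp by (simp add: pos_le_divide_eq)
  have "0 < \<alpha> * g * wh" using \<alpha> g whp by simp
  with C2 have "(cmod C)\<^sup>2 \<noteq> 0" by linarith
  then have C0: "C \<noteq> 0" by simp
  have "G / C - bb = (G - bb * C) / C" using C0 by (simp add: field_simps)
  then have "g * (cmod (G / C - bb))\<^sup>2 = g * N / (cmod C)\<^sup>2"
    by (simp add: N_def norm_divide power_divide)
  also have "\<dots> \<le> g * N / (\<alpha> * g * wh)"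
    using C2 C0 \<alpha> g whp N0 by (intro divide_left_mono mult_pos_pos) auto
  also have "\<dots> = N / (\<alpha> * wh)" using g by simp
  finally have le: "g * (cmod (G / C - bb))\<^sup>2 \<le> N / (\<alpha> * wh)" .
  show ?thesis
  proof (cases "wh < ww / 2")
    case True
    \<comment> \<open>Only the threshold bounds \<open>wh\<close> from below here, but a deviation
      of more than \<open>ww / 2\<close> has occurred and supplies the factor
      \<open>4 * (wh - ww)\<^sup>2 / ww\<^sup>2\<close>, which is at least 1.\<close>
    have "N / (\<alpha> * wh) \<le> N / (\<alpha> * \<alpha>)"
      using wh \<alpha> whp N0 by (intro divide_left_mono mult_left_mono) auto
    also have "\<dots> = 4 / (\<alpha>\<^sup>2 * ww\<^sup>2) * (N * (ww / 2)\<^sup>2)"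
      using ww \<alpha> by (simp add: power2_eq_square)
    also have "\<dots> \<le> 4 / (\<alpha>\<^sup>2 * ww\<^sup>2) * (N * (wh - ww)\<^sup>2)"
    proof -
      have "\<bar>ww / 2\<bar> \<le> \<bar>wh - ww\<bar>" using True ww by linarith
      then have "(ww / 2)\<^sup>2 \<le> (wh - ww)\<^sup>2" by (simp only: abs_le_square_iff)
      then show ?thesis using N0 by (intro mult_left_mono) auto
    qed
    finally have "N / (\<alpha> * wh) \<le> 4 / (\<alpha>\<^sup>2 * ww\<^sup>2) * (N * (wh - ww)\<^sup>2)" .
    moreover have "0 \<le> 16 / (\<alpha>\<^sup>2 * ww\<^sup>2) * (N * (cmod (C - cc))\<^sup>2)"
      and "0 \<le> (if la > \<alpha> * g / 8 then 2 / (\<alpha> * ww) * N else 0)"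
      using N0 \<alpha> ww by simp_all
    ultimately show ?thesis using le unfolding N_def by linarith
  next
    case False
    then have "N / (\<alpha> * wh) \<le> N / (\<alpha> * (ww / 2))"
      using \<alpha> ww whp N0 by (intro divide_left_mono mult_left_mono mult_pos_pos) auto
    then have le2: "g * (cmod (G / C - bb))\<^sup>2 \<le> 2 / (\<alpha> * ww) * N" using le by (simp add: mult.commute)
    have n1: "0 \<le> 4 / (\<alpha>\<^sup>2 * ww\<^sup>2) * (N * (wh - ww)\<^sup>2)"
      and n2: "0 \<le> 16 / (\<alpha>\<^sup>2 * ww\<^sup>2) * (N * (cmod (C - cc))\<^sup>2)"
      using N0 by simp_all
    show ?thesis
    proof (cases "la > \<alpha> * g / 8")
      case True
      show ?thesis using le2 n1 n2 unfolding N_def if_P[OF True] by linarith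
    next
      case high: False
      \<comment> \<open>The 8 is 2 * 4: as \<open>wh\<close> is at least \<open>ww / 2\<close>, the
        kept \<open>C\<close> has squared modulus at least \<open>4 * ?q\<close>, while that of
        \<open>cc\<close> is at most \<open>?q\<close>. The two are therefore at least
        \<open>sqrt ?q\<close> apart.\<close>
      let ?q = "\<alpha> * g * ww / 8"
      have q: "0 \<le> ?q" using \<alpha> g ww by simp
      have "4 * ?q \<le> \<alpha> * g * wh"
        using mult_left_mono[of "ww / 2" wh "\<alpha> * g"] False \<alpha> g by simp
      then have "(2 * sqrt ?q)\<^sup>2 \<le> (cmod C)\<^sup>2" using C2 q by (simp add: power_mult_distrib)
      then have 1: "2 * sqrt ?q \<le> cmod C" by (rule power2_le_imp_le) simp
      have "(cmod cc)\<^sup>2 \<le> (sqrt ?q)\<^sup>2"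
        using high la mult_right_mono[of la "\<alpha> * g / 8" ww] ww q by simp
      then have 2: "cmod cc \<le> sqrt ?q" by (rule power2_le_imp_le) (use q in simp)
      have "sqrt ?q \<le> cmod (C - cc)" using 1 2 norm_triangle_ineq2[of C cc] by linarith
      then have "(sqrt ?q)\<^sup>2 \<le> (cmod (C - cc))\<^sup>2"
        by (rule power_mono) (rule real_sqrt_ge_zero[OF q])
      then have "\<alpha> * g * ww \<le> 8 * (cmod (C - cc))\<^sup>2" using q by simp
      moreover have "\<alpha> * ww \<le> \<alpha> * g * ww"
        using \<alpha> g ww by simp
      ultimately have "\<alpha> * ww \<le> 8 * (cmod (C - cc))\<^sup>2" by linarith
      then have "2 / (\<alpha>\<^sup>2 * ww\<^sup>2) * (N * (\<alpha> * ww)) \<le> 2 / (\<alpha>\<^sup>2 * ww\<^sup>2) * (N * (8 * (cmod (C - cc))\<^sup>2))"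
        using N0 by (intro mult_left_mono) auto
      moreover have "2 / (\<alpha>\<^sup>2 * ww\<^sup>2) * (N * (\<alpha> * ww)) = 2 / (\<alpha> * ww) * N"
        using \<alpha> ww by (simp add: power2_eq_square)
      ultimately show ?thesis using le2 n1 unfolding N_def if_not_P[OF high] by linarith
    qed
  qed
qed

text \<open>A Chebyshev bound for the indicator of wrongly dropping a coefficient. The factor \<tau>
  in \<open>low\<close> gives \<open>8 * \<alpha> \<le> ww\<close>, so \<open>wh < \<alpha>\<close>
  puts \<open>wh\<close> below \<open>ww / 8\<close>. Otherwise either \<open>wh\<close> exceeds
  \<open>2 * ww\<close>, or the failed second threshold forces \<open>cmod C\<close> below half of
  \<open>cmod cc\<close>. Each case is a relative deviation of at least 1/2, hence the factors
  4.\<close>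

lemma bias_pointwise:
  fixes C cc :: complex and wh ww \<alpha> g la \<tau> :: real
  assumes \<alpha>: "0 < \<alpha>" and g: "1 \<le> g" and ww: "0 < ww" and la: "(cmod cc)\<^sup>2 = la * ww"
    and \<tau>: "1 \<le> \<tau>" and la_w: "la \<le> \<tau> * ww" and low: "8 * \<tau> * \<alpha> * g \<le> la"
    and drop: "\<not> (\<alpha> \<le> wh \<and> \<alpha> * g \<le> (cmod C)\<^sup>2 / wh)"
  shows "1 \<le> 4 / ww\<^sup>2 * (wh - ww)\<^sup>2 + 4 / (la * ww) * (cmod (C - cc))\<^sup>2"
proof -
  have "0 < 8 * \<tau> * \<alpha> * g" using \<tau> \<alpha> g by simp
  then have lap: "0 < la" using low by linarith
  have n1: "0 \<le> 4 / ww\<^sup>2 * (wh - ww)\<^sup>2" and n2: "0 \<le> 4 / (la * ww) * (cmod (C - cc))\<^sup>2"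
    using lap ww by simp_all
  have dev: ?thesis if "\<bar>ww / 2\<bar> \<le> \<bar>wh - ww\<bar>"
  proof -
    have "(ww / 2)\<^sup>2 \<le> (wh - ww)\<^sup>2" using that by (simp only: abs_le_square_iff)
    then have "4 / ww\<^sup>2 * (ww / 2)\<^sup>2 \<le> 4 / ww\<^sup>2 * (wh - ww)\<^sup>2" by (intro mult_left_mono) auto
    moreover have "4 / ww\<^sup>2 * (ww / 2)\<^sup>2 = 1" using ww by (simp add: power_divide)
    ultimately show ?thesis using n2 by linarith
  qed
  show ?thesis
  proof (cases "\<alpha> \<le> wh")
    case False
    have "\<tau> * (8 * \<alpha>) \<le> 8 * \<tau> * \<alpha> * g" using \<tau> \<alpha> g by simp
    also have "\<dots> \<le> \<tau> * ww" using low la_w by linarith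
    finally have "8 * \<alpha> \<le> ww" using \<tau> by simp
    then have "\<bar>ww / 2\<bar> \<le> \<bar>wh - ww\<bar>" using False ww \<alpha> by linarith
    then show ?thesis by (rule dev)
  next
    case True
    then have whp: "0 < wh" using \<alpha> by simp
    have lt: "(cmod C)\<^sup>2 < \<alpha> * g * wh"
      using drop True whp by (simp add: pos_le_divide_eq not_le)
    show ?thesis
    proof (cases "wh \<le> 2 * ww")
      case False
      then have "\<bar>ww / 2\<bar> \<le> \<bar>wh - ww\<bar>" using ww by linarith
      then show ?thesis by (rule dev)
    next
      case True
      have "\<alpha> * g \<le> la / 8"
      proof -
        have "1 * (8 * \<alpha> * g) \<le> \<tau> * (8 * \<alpha> * g)" using \<tau> \<alpha> g by (intro mult_right_mono) auto
        also have "\<dots> = 8 * \<tau> * \<alpha> * g" by simp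
        finally show ?thesis using low by linarith
      qed
      then have "\<alpha> * g * wh \<le> la / 8 * (2 * ww)"
        using True whp lap by (intro mult_mono) auto
      then have "(cmod C)\<^sup>2 \<le> (cmod cc / 2)\<^sup>2"
        using lt la by (simp add: power_divide)
      then have "cmod C \<le> cmod cc / 2" by (rule power2_le_imp_le) simp
      then have "cmod cc / 2 \<le> cmod (C - cc)"
        using norm_triangle_ineq2[of cc C] norm_minus_commute[of cc C] by linarith
      then have "(cmod cc / 2)\<^sup>2 \<le> (cmod (C - cc))\<^sup>2" by (intro power_mono) auto
      then have "4 / (la * ww) * (cmod cc / 2)\<^sup>2 \<le> 4 / (la * ww) * (cmod (C - cc))\<^sup>2"
        using lap ww by (intro mult_left_mono) auto
      moreover have "4 / (la * ww) * (cmod cc / 2)\<^sup>2 = 1"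
        using lap ww la by (simp add: power_divide)
      ultimately show ?thesis using n1 by linarith
    qed
  qed
qed

text \<open>The unordered sum is dominated by the supremum of its symmetric partial sums. These form
  an increasing sequence, so monotone convergence reduces the bound to finite sums.\<close>

lemma nn_integral_infsum_le:
  fixes f :: "int \<Rightarrow> 'b \<Rightarrow> ennreal"
  assumes [measurable]: "\<And>k. f k \<in> borel_measurable N"
    and le: "\<And>F. finite F \<Longrightarrow> (\<Sum>k\<in>F. \<integral>\<^sup>+x. f k x \<partial>N) \<le> R"
  shows "(\<integral>\<^sup>+x. (\<Sum>\<^sub>\<infinity>k. f k x) \<partial>N) \<le> R"
proof -
  have "(\<Sum>\<^sub>\<infinity>k. f k x) \<le> (SUP J. \<Sum>k\<in>{-int J..int J}. f k x)" for x
    unfolding nonneg_infsum_complete[OF zero_le]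
  proof (rule SUP_least)
    fix F assume "F \<in> {F. finite F \<and> F \<subseteq> (UNIV :: int set)}"
    then obtain J where "F \<subseteq> {-int J..int J}" using finite_subset_int_interval by blast
    then have "(\<Sum>k\<in>F. f k x) \<le> (\<Sum>k\<in>{-int J..int J}. f k x)" by (intro sum_mono2) auto
    then show "(\<Sum>k\<in>F. f k x) \<le> (SUP J. \<Sum>k\<in>{-int J..int J}. f k x)" by (rule SUP_upper2[rotated]) simp
  qed
  then have "(\<integral>\<^sup>+x. (\<Sum>\<^sub>\<infinity>k. f k x) \<partial>N) \<le> (\<integral>\<^sup>+x. (SUP J. \<Sum>k\<in>{-int J..int J}. f k x) \<partial>N)"
    by (intro nn_integral_mono)
  also have "\<dots> = (SUP J. \<integral>\<^sup>+x. (\<Sum>k\<in>{-int J..int J}. f k x) \<partial>N)"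
    by (intro nn_integral_monotone_convergence_SUP)
       (auto simp: incseq_def le_fun_def intro!: sum_mono2)
  also have "\<dots> \<le> R"
    by (intro SUP_least) (simp add: nn_integral_sum le)
  finally show ?thesis .
qed

section \<open>The risk of the estimator\<close>

definition sample_mean :: "nat \<Rightarrow> ('a \<Rightarrow> complex) \<Rightarrow> (nat \<Rightarrow> 'a) \<Rightarrow> complex" where
  "sample_mean n Z \<omega> = (\<Sum>i<n. Z (\<omega> i)) / of_nat n"

lemma sample_mean_measurable [measurable]:
  assumes [measurable]: "Z \<in> borel_measurable M"
  shows "sample_mean n Z \<in> borel_measurable (\<Pi>\<^sub>M i\<in>{..<n}. M)"
  unfolding sample_mean_def[abs_def] by measurable

lemma (in prob_space) mean_le_sqrt:
  assumes "mean_le M (\<lambda>x. f x ^ 4) A" "f \<in> borel_measurable M" "0 \<le> A"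
  shows "mean_le M (\<lambda>x. (f x)\<^sup>2) (sqrt A)"
proof -
  have "mean_le M (\<lambda>x. (f x)\<^sup>2 * 1) (sqrt (A * 1))"
    by (rule mean_le_mult) (use assms mean_le_const[of 1] in \<open>simp_all add: power_mult[symmetric]\<close>)
  then show ?thesis by simp
qed

section \<open>Reduction of the risk to moments of the deviations\<close>

context linear_model
begin

context
  fixes n :: nat and \<alpha> :: real
  assumes n: "0 < n" and \<alpha>: "0 < \<alpha>"
begin

abbreviation (input) P where "P \<equiv> \<Pi>\<^sub>M i\<in>{..<n}. M"
abbreviation (input) Nk where "Nk k \<omega> \<equiv> cmod (sample_mean n (Z_resid k) \<omega>)"
abbreviation (input) Dk where "Dk k \<omega> \<equiv> cmod (sample_mean n (Z_c k) \<omega>)"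
abbreviation (input) Vk where "Vk k \<omega> \<equiv> cmod (sample_mean n (Z_w k) \<omega>)"

lemma sample_prob_space: "prob_space P"
  by (intro prob_space_PiM prob_space_axioms)

definition variance_term :: "int \<Rightarrow> (nat \<Rightarrow> 'a) \<Rightarrow> real" where
  "variance_term k \<omega> =
     4 / (\<alpha>\<^sup>2 * (w k)\<^sup>2) * ((Nk k \<omega>)\<^sup>2 * (Vk k \<omega>)\<^sup>2)
     + 16 / (\<alpha>\<^sup>2 * (w k)\<^sup>2) * ((Nk k \<omega>)\<^sup>2 * (Dk k \<omega>)\<^sup>2)
     + (if lambda k > \<alpha> * \<gamma> k powr \<nu> / 8 then 2 / (\<alpha> * w k) * (Nk k \<omega>)\<^sup>2 else 0)"

text \<open>At frequencies with a clear signal the indicator that the coefficient is dropped is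
  replaced by the bound of \<open>bias_pointwise\<close>, elsewhere by 1.\<close>

definition bias_term :: "int \<Rightarrow> (nat \<Rightarrow> 'a) \<Rightarrow> real" where
  "bias_term k \<omega> = \<gamma> k powr \<nu> * (cmod (b k))\<^sup>2 *
     (if 8 * \<tau> * \<alpha> * \<gamma> k powr \<nu> \<le> lambda k
      then 4 / (w k)\<^sup>2 * (Vk k \<omega>)\<^sup>2 + 4 / (lambda k * w k) * (Dk k \<omega>)\<^sup>2 else 1)"

lemma term_nonneg: "0 \<le> variance_term k \<omega>" "0 \<le> bias_term k \<omega>"
  using \<alpha> w_pos[of k] lambda_pos[of k] by (simp_all add: variance_term_def bias_term_def)

lemma term_measurable [measurable]:
  "variance_term k \<in> borel_measurable P" "bias_term k \<in> borel_measurable P"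
  unfolding variance_term_def bias_term_def by measurable

text \<open>Each frequency is either kept or dropped, and its error is charged to
  \<open>variance_term\<close> or to \<open>bias_term\<close> accordingly; the other one is
  nonnegative.\<close>

lemma norm2_error_le:
  assumes L2: "\<And>i. i < n \<Longrightarrow> cfun (W (\<omega> i)) \<in> L2"
  shows "norm2 \<nu> (\<lambda>t. beta_hat \<nu> n \<alpha> (\<lambda>i. Y (\<omega> i)) (\<lambda>i. X (\<omega> i)) (\<lambda>i. W (\<omega> i)) t - complex_of_real (\<beta> t))
    \<le> (\<Sum>\<^sub>\<infinity>k. ennreal (variance_term k \<omega> + bias_term k \<omega>))"
proof (rule order_trans[OF eq_refl[OF norm2_error[OF _ \<alpha> n \<beta>_L2]] infsum_mono])
  fix k
  let ?C = "c_hat n (\<lambda>i. X (\<omega> i)) (\<lambda>i. W (\<omega> i)) k" and ?wh = "w_hat n (\<lambda>i. W (\<omega> i)) k"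
  let ?G = "(\<Sum>i<n. of_real (Y (\<omega> i)) * om k (\<omega> i)) / of_nat n" and ?g = "\<gamma> k powr \<nu>"
  have g: "1 \<le> ?g" using \<gamma>_ge_1[of k] pos by (intro ge_one_powr_ge_zero) auto
  have N: "?G - b k * ?C = sample_mean n (Z_resid k) \<omega>"
    by (simp add: sample_mean_def Z_resid_def c_hat_def left_diff_distrib sum_subtractf diff_divide_distrib
        sum_distrib_left mult.assoc)
  have D: "?C - c k = sample_mean n (Z_c k) \<omega>"
    using n by (simp add: sample_mean_def Z_c_def c_hat_def sum_subtractf diff_divide_distrib)
  have "complex_of_real (?wh - w k) = sample_mean n (Z_w k) \<omega>"
    using n by (simp add: sample_mean_def Z_w_def w_hat_def sum_subtractf diff_divide_distrib)
  then have V: "(?wh - w k)\<^sup>2 = (Vk k \<omega>)\<^sup>2"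
    by (metis norm_of_real power2_abs)
  show "ennreal (?g * (cmod ((if ?wh \<ge> \<alpha> \<and> (cmod ?C)\<^sup>2 / ?wh \<ge> \<alpha> * ?g then ?G / ?C else 0) - b k))\<^sup>2)
      \<le> ennreal (variance_term k \<omega> + bias_term k \<omega>)"
  proof (rule ennreal_leI, cases "?wh \<ge> \<alpha> \<and> (cmod ?C)\<^sup>2 / ?wh \<ge> \<alpha> * ?g")
    case True
    then have "?g * (cmod (?G / ?C - b k))\<^sup>2 \<le> variance_term k \<omega>"
      using variance_pointwise[of \<alpha> ?g "w k" "c k" "lambda k" ?wh ?C ?G "b k"]
      unfolding N D V variance_term_def using \<alpha> g w_pos c_sq_eq by simp
    then show "?g * (cmod ((if ?wh \<ge> \<alpha> \<and> (cmod ?C)\<^sup>2 / ?wh \<ge> \<alpha> * ?g then ?G / ?C else 0) - b k))\<^sup>2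
        \<le> variance_term k \<omega> + bias_term k \<omega>"
      unfolding if_P[OF True] using term_nonneg(2)[of k \<omega>] by linarith
  next
    case False
    have "?g * (cmod (b k))\<^sup>2 \<le> bias_term k \<omega>"
    proof (cases "8 * \<tau> * \<alpha> * ?g \<le> lambda k")
      case True
      have "1 \<le> 4 / (w k)\<^sup>2 * (Vk k \<omega>)\<^sup>2 + 4 / (lambda k * w k) * (Dk k \<omega>)\<^sup>2"
        using bias_pointwise[OF \<alpha> g w_pos c_sq_eq ge1(3) lambda_le_w True False] unfolding D V .
      then show ?thesis
        unfolding bias_term_def using True mult_left_mono[of 1 _ "?g * (cmod (b k))\<^sup>2"] by simp
    qed (simp add: bias_term_def)
    then show "?g * (cmod ((if ?wh \<ge> \<alpha> \<and> (cmod ?C)\<^sup>2 / ?wh \<ge> \<alpha> * ?g then ?G / ?C else 0) - b k))\<^sup>2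
        \<le> variance_term k \<omega> + bias_term k \<omega>"
      unfolding if_not_P[OF False] using term_nonneg(1)[of k \<omega>] by simp
  qed
qed (simp_all add: nonneg_summable_on_complete L2)

text \<open>The pathwise bound requires square integrable sample paths, which holds for almost every
  sample.\<close>

lemma risk_le_nn_integral:
  "risk \<nu> n \<alpha> \<sigma> M \<beta> X W U
    \<le> (\<integral>\<^sup>+\<omega>. (\<Sum>\<^sub>\<infinity>k. ennreal (variance_term k \<omega> + bias_term k \<omega>)) \<partial>P)"
  unfolding risk_def
proof (rule nn_integral_mono_AE)
  have "AE \<omega> in P. \<forall>i\<in>{..<n}. cfun (W (\<omega> i)) \<in> L2"
    using random_function_L2[OF rW]
    by (intro AE_finite_allI AE_PiM_component prob_space_axioms) auto
  then show "AE \<omega> in P. norm2 \<nu> (\<lambda>t. beta_hat \<nu> n \<alpha> (\<lambda>i. Y (\<omega> i)) (\<lambda>i. X (\<omega> i)) (\<lambda>i. W (\<omega> i)) t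
      - complex_of_real (\<beta> t)) \<le> (\<Sum>\<^sub>\<infinity>k. ennreal (variance_term k \<omega> + bias_term k \<omega>))"
    by eventually_elim (rule norm2_error_le, simp)
qed

section \<open>Expected variance and bias at one frequency\<close>

lemma residual_mean_fourth_moment: "mean_le P (\<lambda>\<omega>. Nk k \<omega> ^ 4) (6 * (B1 * (w k)\<^sup>2) / (real n)\<^sup>2)"
  unfolding sample_mean_def
  by (rule iid_mean_fourth_moment[OF Z_resid_moment Z_measurable(1) Z_centered(1) n])
     (simp add: B_nonneg)

lemma c_deviation_fourth_moment: "mean_le P (\<lambda>\<omega>. Dk k \<omega> ^ 4) (6 * (B2 * ((x k)\<^sup>2 * (w k)\<^sup>2)) / (real n)\<^sup>2)"
  unfolding sample_mean_def
  by (rule iid_mean_fourth_moment[OF Z_c_moment Z_measurable(2) Z_centered(2) n])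
     (simp add: B_nonneg)

lemma w_deviation_fourth_moment: "mean_le P (\<lambda>\<omega>. Vk k \<omega> ^ 4) (6 * (B2 * w k ^ 4) / (real n)\<^sup>2)"
  unfolding sample_mean_def
  by (rule iid_mean_fourth_moment[OF Z_w_moment Z_measurable(3) Z_centered(3) n])
     (simp add: B_nonneg)

text \<open>The caller proposes the geometric mean \<open>C\<close> and only has to verify its
  square, which keeps roots of products of powers out of the applications.\<close>

lemma mult_moment:
  assumes f: "mean_le P (\<lambda>\<omega>. f \<omega> ^ 4) A" and g: "mean_le P (\<lambda>\<omega>. g \<omega> ^ 4) B"
    and meas: "f \<in> borel_measurable P" "g \<in> borel_measurable P" and "0 \<le> A" "0 \<le> B"
    and C: "0 \<le> C" "C\<^sup>2 = A * B"
  shows "mean_le P (\<lambda>\<omega>. (f \<omega>)\<^sup>2 * (g \<omega>)\<^sup>2) C"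
proof -
  have "mean_le P (\<lambda>\<omega>. (f \<omega>)\<^sup>2 * (g \<omega>)\<^sup>2) (sqrt (A * B))"
    using assms by (intro mean_le_mult) (simp_all add: power_mult[symmetric])
  moreover have "sqrt (A * B) = C" using C by (intro real_sqrt_unique) auto
  ultimately show ?thesis by simp
qed

lemma square_moment:
  assumes f: "mean_le P (\<lambda>\<omega>. f \<omega> ^ 4) A" and meas: "f \<in> borel_measurable P" and "0 \<le> A"
    and C: "0 \<le> C" "C\<^sup>2 = A"
  shows "mean_le P (\<lambda>\<omega>. (f \<omega>)\<^sup>2) C"
proof -
  have "sqrt A = C" using C by (intro real_sqrt_unique) auto
  then show ?thesis using prob_space.mean_le_sqrt[OF sample_prob_space f meas] assms by simp
qed

lemma residual_w_deviation_moment: "mean_le P (\<lambda>\<omega>. (Nk k \<omega>)\<^sup>2 * (Vk k \<omega>)\<^sup>2) (6 * sqrt (B1 * B2) * w k ^ 3 / (real n)\<^sup>2)"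
  using B_nonneg w_nonneg[of k]
  by (intro mult_moment[OF residual_mean_fourth_moment w_deviation_fourth_moment])
     (simp_all add: power_mult_distrib power_divide power2_eq_square power3_eq_cube power4_eq_xxxx)

lemma residual_c_deviation_moment: "mean_le P (\<lambda>\<omega>. (Nk k \<omega>)\<^sup>2 * (Dk k \<omega>)\<^sup>2) (6 * sqrt (B1 * B2) * (x k * (w k)\<^sup>2) / (real n)\<^sup>2)"
  using B_nonneg w_nonneg[of k] x_nonneg[of k]
  by (intro mult_moment[OF residual_mean_fourth_moment c_deviation_fourth_moment])
     (simp_all add: power_mult_distrib power_divide power2_eq_square)

lemma residual_mean_second_moment: "mean_le P (\<lambda>\<omega>. (Nk k \<omega>)\<^sup>2) (sqrt (6 * B1) * w k / real n)"
  using B_nonneg w_nonneg[of k]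
  by (intro square_moment[OF residual_mean_fourth_moment]) (simp_all add: power_mult_distrib power_divide)

lemma c_deviation_second_moment: "mean_le P (\<lambda>\<omega>. (Dk k \<omega>)\<^sup>2) (sqrt (6 * B2) * (x k * w k) / real n)"
  using B_nonneg w_nonneg[of k] x_nonneg[of k]
  by (intro square_moment[OF c_deviation_fourth_moment]) (simp_all add: power_mult_distrib power_divide)

lemma w_deviation_second_moment: "mean_le P (\<lambda>\<omega>. (Vk k \<omega>)\<^sup>2) (sqrt (6 * B2) * (w k)\<^sup>2 / real n)"
  using B_nonneg w_nonneg[of k]
  by (intro square_moment[OF w_deviation_fourth_moment])
     (simp_all add: power_mult_distrib power_divide power2_eq_square power4_eq_xxxx)

text \<open>In the first two parts the division by \<open>(w k)\<^sup>2\<close> leaves one factor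
  \<open>w k\<close> or \<open>x k\<close>, summable over all frequencies. In the third nothing
  summable remains, so the low frequencies have to be counted.\<close>

lemma variance_term_mean:
  "mean_le P (variance_term k)
     (24 * sqrt (B1 * B2) / (\<alpha> * real n)\<^sup>2 * w k + 96 * sqrt (B1 * B2) / (\<alpha> * real n)\<^sup>2 * x k
      + (if lambda k > \<alpha> * \<gamma> k powr \<nu> / 8 then 2 * sqrt (6 * B1) / (\<alpha> * real n) else 0))"
proof -
  interpret P: prob_space P by (rule sample_prob_space)
  note w = w_pos[of k]
  have m: "mean_le P (variance_term k)
      (4 / (\<alpha>\<^sup>2 * (w k)\<^sup>2) * (6 * sqrt (B1 * B2) * w k ^ 3 / (real n)\<^sup>2)
       + 16 / (\<alpha>\<^sup>2 * (w k)\<^sup>2) * (6 * sqrt (B1 * B2) * (x k * (w k)\<^sup>2) / (real n)\<^sup>2)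
       + (if lambda k > \<alpha> * \<gamma> k powr \<nu> / 8 then 2 / (\<alpha> * w k) * (sqrt (6 * B1) * w k / real n) else 0))"
  proof (cases "lambda k > \<alpha> * \<gamma> k powr \<nu> / 8")
    case True
    show ?thesis
      unfolding variance_term_def[abs_def] if_P[OF True] using \<alpha> w B_nonneg x_nonneg[of k]
      by (intro mean_le_add mean_le_cmult residual_w_deviation_moment residual_c_deviation_moment residual_mean_second_moment) simp_all
  next
    case False
    show ?thesis
      unfolding variance_term_def[abs_def] if_not_P[OF False] add_0_right using \<alpha> w B_nonneg x_nonneg[of k]
      by (intro mean_le_add mean_le_cmult residual_w_deviation_moment residual_c_deviation_moment) simp_all
  qed
  have e1: "4 / (\<alpha>\<^sup>2 * (w k)\<^sup>2) * (6 * sqrt (B1 * B2) * w k ^ 3 / (real n)\<^sup>2)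
      = 24 * sqrt (B1 * B2) / (\<alpha> * real n)\<^sup>2 * w k"
    using w \<alpha> n by (simp add: power3_eq_cube power2_eq_square mult_ac)
  have e2: "16 / (\<alpha>\<^sup>2 * (w k)\<^sup>2) * (6 * sqrt (B1 * B2) * (x k * (w k)\<^sup>2) / (real n)\<^sup>2)
      = 96 * sqrt (B1 * B2) / (\<alpha> * real n)\<^sup>2 * x k"
    using w \<alpha> n by (simp add: power2_eq_square mult_ac)
  have e3: "2 / (\<alpha> * w k) * (sqrt (6 * B1) * w k / real n) = 2 * sqrt (6 * B1) / (\<alpha> * real n)"
    using w \<alpha> n by simp
  show ?thesis using m unfolding e1 e2 e3 .
qed

text \<open>Its three parts, relative to the weight \<open>\<gamma> k powr p\<close>, are the cost
  of a deviation of \<open>w_hat\<close>, that of a deviation of \<open>c_hat\<close>, and the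
  truncation bias, which is \<kappa> at \<open>8 * \<tau> * d * \<alpha>\<close>.\<close>

definition bias_const :: real where
  "bias_const = 4 * sqrt (6 * B2) / real n + sqrt (6 * B2) * \<Lambda> / (2 * (\<alpha> * real n))
     + (8 * \<tau> * d * \<alpha>) powr ((p - \<nu>) / (a + \<nu>))"

lemma bias_term_mean: "mean_le P (bias_term k) (\<gamma> k powr p * (cmod (b k))\<^sup>2 * bias_const)"
proof (cases "8 * \<tau> * \<alpha> * \<gamma> k powr \<nu> \<le> lambda k")
  case True
  note w = w_pos[of k] and la = lambda_pos[of k]
  let ?g = "\<gamma> k powr \<nu>"
  have g: "1 \<le> ?g" using \<gamma>_ge_1[of k] pos by (intro ge_one_powr_ge_zero) auto
  \<comment> \<open>Raising the weight from order \<nu> to order p lets the deviation terms be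
    summed against the Sobolev ball too.\<close>
  have gp: "?g \<le> \<gamma> k powr p" using \<gamma>_ge_1[of k] pos by (intro powr_mono) auto
  have "mean_le P (bias_term k) (?g * (cmod (b k))\<^sup>2 *
      (4 / (w k)\<^sup>2 * (sqrt (6 * B2) * (w k)\<^sup>2 / real n)
       + 4 / (lambda k * w k) * (sqrt (6 * B2) * (x k * w k) / real n)))"
    unfolding bias_term_def[abs_def] if_P[OF True] using w la B_nonneg x_nonneg[of k]
    by (intro mean_le_cmult mean_le_add w_deviation_second_moment c_deviation_second_moment) simp_all
  then show ?thesis
  proof (rule mean_le_mono)
    have "4 / (w k)\<^sup>2 * (sqrt (6 * B2) * (w k)\<^sup>2 / real n) = 4 * sqrt (6 * B2) / real n"
      using w by simp
    moreover have "4 / (lambda k * w k) * (sqrt (6 * B2) * (x k * w k) / real n)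
        \<le> sqrt (6 * B2) * \<Lambda> / (2 * (\<alpha> * real n))"
    proof -
      \<comment> \<open>The clear signal keeps the denominator away from 0, so the relative
        deviation of \<open>c_hat\<close> costs only the order 1 / (n \<alpha>).\<close>
      have "8 * \<alpha> \<le> lambda k"
      proof -
        have "8 * \<alpha> * (1 * 1) \<le> 8 * \<alpha> * (\<tau> * ?g)"
          using \<alpha> ge1 g by (intro mult_left_mono mult_mono) auto
        then show ?thesis using True by (simp add: mult_ac)
      qed
      then have "4 * sqrt (6 * B2) * x k / (lambda k * real n) \<le> 4 * sqrt (6 * B2) * \<Lambda> / (8 * \<alpha> * real n)"
        using B_nonneg x_le[of k] x_nonneg[of k] \<alpha> n ge1
        by (intro frac_le mult_left_mono mult_right_mono) auto
      also have "\<dots> = sqrt (6 * B2) * \<Lambda> / (2 * (\<alpha> * real n))" using \<alpha> n by simp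
      finally show ?thesis using w la n by (simp add: mult_ac)
    qed
    moreover have "0 \<le> (8 * \<tau> * d * \<alpha>) powr ((p - \<nu>) / (a + \<nu>))" by simp
    ultimately have le: "4 / (w k)\<^sup>2 * (sqrt (6 * B2) * (w k)\<^sup>2 / real n)
       + 4 / (lambda k * w k) * (sqrt (6 * B2) * (x k * w k) / real n) \<le> bias_const"
      unfolding bias_const_def by linarith
    show "?g * (cmod (b k))\<^sup>2 * (4 / (w k)\<^sup>2 * (sqrt (6 * B2) * (w k)\<^sup>2 / real n)
       + 4 / (lambda k * w k) * (sqrt (6 * B2) * (x k * w k) / real n))
       \<le> \<gamma> k powr p * (cmod (b k))\<^sup>2 * bias_const"
      using le gp w la B_nonneg x_nonneg[of k]
      by (intro mult_mono mult_right_mono) simp_all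
  qed simp_all
next
  case False
  interpret P: prob_space P by (rule sample_prob_space)
  let ?e = "(p - \<nu>) / (a + \<nu>)"
  have gpos: "0 < \<gamma> k" by (rule \<gamma>_pos)
  have an: "0 < a + \<nu>" using pos by simp
  \<comment> \<open>Without a clear signal the lower decay bound forces \<open>\<gamma> k\<close> to
    be large. Trading the weight of order \<nu> for that of order p then gains
    \<open>\<gamma> k powr (\<nu> - p)\<close>, which is at most \<kappa> at a multiple of the
    threshold.\<close>
  have "\<gamma> k powr (- a) / d < 8 * \<tau> * \<alpha> * \<gamma> k powr \<nu>"
    using lambda_bounds(1)[of k] False by linarith
  then have "\<gamma> k powr (- a) < 8 * \<tau> * \<alpha> * \<gamma> k powr \<nu> * d"
    using ge1 by (simp add: pos_divide_less_eq)
  then have "\<gamma> k powr (- a) / \<gamma> k powr \<nu> \<le> 8 * \<tau> * d * \<alpha>"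
    using gpos by (simp add: pos_divide_le_eq mult_ac)
  then have "\<gamma> k powr (- (a + \<nu>)) \<le> 8 * \<tau> * d * \<alpha>"
    by (simp add: powr_diff[symmetric])
  then have "(\<gamma> k powr (- (a + \<nu>))) powr ?e \<le> (8 * \<tau> * d * \<alpha>) powr ?e"
    using pos by (intro powr_mono2) auto
  moreover have "(\<gamma> k powr (- (a + \<nu>))) powr ?e = \<gamma> k powr (\<nu> - p)"
  proof -
    have "(a + \<nu>) * ?e = p - \<nu>" using an by simp
    then have "- (a + \<nu>) * ?e = \<nu> - p" unfolding mult_minus_left by simp
    then show ?thesis unfolding powr_powr by (simp only:)
  qed
  moreover have "0 \<le> 4 * sqrt (6 * B2) / real n + sqrt (6 * B2) * \<Lambda> / (2 * (\<alpha> * real n))"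
    using B_nonneg \<alpha> ge1 by simp
  ultimately have "\<gamma> k powr (\<nu> - p) \<le> bias_const"
    unfolding bias_const_def by linarith
  then have "\<gamma> k powr p * (cmod (b k))\<^sup>2 * \<gamma> k powr (\<nu> - p) \<le> \<gamma> k powr p * (cmod (b k))\<^sup>2 * bias_const"
    by (intro mult_left_mono) auto
  moreover have "\<gamma> k powr p * (cmod (b k))\<^sup>2 * \<gamma> k powr (\<nu> - p) = \<gamma> k powr \<nu> * (cmod (b k))\<^sup>2"
  proof -
    have "\<gamma> k powr p * \<gamma> k powr (\<nu> - p) = \<gamma> k powr \<nu>" by (simp add: powr_add[symmetric])
    then show ?thesis by (metis mult.commute mult.assoc)
  qed
  ultimately have le: "\<gamma> k powr \<nu> * (cmod (b k))\<^sup>2 \<le> \<gamma> k powr p * (cmod (b k))\<^sup>2 * bias_const" by simp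
  have "mean_le P (\<lambda>_. \<gamma> k powr \<nu> * (cmod (b k))\<^sup>2) (\<gamma> k powr \<nu> * (cmod (b k))\<^sup>2)"
    by (rule P.mean_le_const) simp
  then show ?thesis
    unfolding bias_term_def[abs_def] if_not_P[OF False] mult_1_right
    by (rule mean_le_mono) (use le in simp_all)
qed

text \<open>The upper decay bound turns the condition into
  \<open>\<gamma> k powr (a + \<nu>) < 8 * d * \<Lambda> / \<alpha>\<close>. Since \<bar>k\<bar> is
  at most the square root of \<open>\<gamma> k\<close>, a 2 appears in the exponent; the summand 1
  counts k = 0.\<close>

lemma card_low_frequencies_le:
  assumes F: "finite F"
  shows "real (card {k\<in>F. lambda k > \<alpha> * \<gamma> k powr \<nu> / 8})
       \<le> 1 + 2 * (8 * d * \<Lambda> / \<alpha>) powr (1 / (2 * (a + \<nu>)))"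
proof -
  let ?T = "(8 * d * \<Lambda> / \<alpha>) powr (1 / (2 * (a + \<nu>)))"
  have an: "0 < a + \<nu>" using pos by simp
  have T0: "0 \<le> ?T" by simp
  have "{k\<in>F. lambda k > \<alpha> * \<gamma> k powr \<nu> / 8} \<subseteq> {- \<lfloor>?T\<rfloor>..\<lfloor>?T\<rfloor>}"
  proof
    fix k assume "k \<in> {k\<in>F. lambda k > \<alpha> * \<gamma> k powr \<nu> / 8}"
    then have "\<alpha> * \<gamma> k powr \<nu> / 8 < d * \<Lambda> * \<gamma> k powr (- a)"
      using lambda_bounds(2)[of k] by simp
    then have "\<alpha> * \<gamma> k powr \<nu> / 8 * \<gamma> k powr a < d * \<Lambda> * \<gamma> k powr (- a) * \<gamma> k powr a"
      using \<gamma>_pos[of k] by (intro mult_strict_right_mono) auto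
    also have "\<dots> = d * \<Lambda>" using \<gamma>_pos[of k] by (simp add: powr_minus field_simps)
    finally have "\<gamma> k powr (a + \<nu>) < 8 * d * \<Lambda> / \<alpha>"
      using \<alpha> by (simp add: powr_add field_simps)
    then have "(\<gamma> k powr (a + \<nu>)) powr (1 / (2 * (a + \<nu>))) \<le> ?T"
      using an by (intro powr_mono2) auto
    moreover have "(a + \<nu>) * (1 / (2 * (a + \<nu>))) = 1 / 2" using an by (simp add: divide_simps)
    ultimately have "\<gamma> k powr (1 / 2) \<le> ?T" by (simp only: powr_powr)
    moreover have "\<gamma> k powr (1 / 2) = sqrt (\<gamma> k)" using \<gamma>_pos[of k] by (simp add: powr_half_sqrt)
    moreover have "\<bar>real_of_int k\<bar> \<le> sqrt (\<gamma> k)"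
    proof (rule real_le_rsqrt)
      have "1 \<le> (2 * pi)\<^sup>2" using pi_gt3 by (intro one_le_power) simp
      then have "1 * (real_of_int k)\<^sup>2 \<le> (2 * pi)\<^sup>2 * (real_of_int k)\<^sup>2" by (intro mult_right_mono) auto
      then show "\<bar>real_of_int k\<bar>\<^sup>2 \<le> \<gamma> k" unfolding \<gamma>_def by (simp add: power_mult_distrib)
    qed
    ultimately have "\<bar>real_of_int k\<bar> \<le> ?T" by linarith
    then have "\<bar>k\<bar> \<le> \<lfloor>?T\<rfloor>" by (simp add: le_floor_iff)
    then show "k \<in> {- \<lfloor>?T\<rfloor>..\<lfloor>?T\<rfloor>}" by auto
  qed
  then have "card {k\<in>F. lambda k > \<alpha> * \<gamma> k powr \<nu> / 8} \<le> card {- \<lfloor>?T\<rfloor>..\<lfloor>?T\<rfloor>}"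
    by (intro card_mono) auto
  then have "real (card {k\<in>F. lambda k > \<alpha> * \<gamma> k powr \<nu> / 8}) \<le> real (card {- \<lfloor>?T\<rfloor>..\<lfloor>?T\<rfloor>})"
    by (rule of_nat_mono)
  also have "\<dots> = 1 + 2 * real_of_int \<lfloor>?T\<rfloor>" using T0 by simp
  also have "\<dots> \<le> 1 + 2 * ?T" by simp
  finally show ?thesis .
qed

lemma risk_le:
  "risk \<nu> n \<alpha> \<sigma> M \<beta> X W U \<le> ennreal
     (120 * sqrt (B1 * B2) * \<Lambda> / (\<alpha> * real n)\<^sup>2
      + (1 + 2 * (8 * d * \<Lambda> / \<alpha>) powr (1 / (2 * (a + \<nu>)))) * (2 * sqrt (6 * B1) / (\<alpha> * real n))
      + \<rho> * bias_const)"
proof (rule order_trans[OF risk_le_nn_integral nn_integral_infsum_le])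
  let ?q = "2 * sqrt (6 * B1) / (\<alpha> * real n)" and ?s = "sqrt (B1 * B2) / (\<alpha> * real n)\<^sup>2"
  let ?low = "\<lambda>k. lambda k > \<alpha> * \<gamma> k powr \<nu> / 8"
  define t where "t k = (24 * sqrt (B1 * B2) / (\<alpha> * real n)\<^sup>2 * w k
      + 96 * sqrt (B1 * B2) / (\<alpha> * real n)\<^sup>2 * x k + (if ?low k then ?q else 0))
      + \<gamma> k powr p * (cmod (b k))\<^sup>2 * bias_const" for k
  have q0: "0 \<le> ?q" and s0: "0 \<le> ?s" and bc0: "0 \<le> bias_const"
    using B_nonneg \<alpha> ge1 by (simp_all add: bias_const_def)
  have mean: "mean_le P (\<lambda>\<omega>. variance_term k \<omega> + bias_term k \<omega>) (t k)" for k
    unfolding t_def using q0 bc0 B_nonneg w_nonneg[of k] x_nonneg[of k]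
    by (intro mean_le_add[OF variance_term_mean bias_term_mean term_nonneg]) simp_all
  have t0: "0 \<le> t k" for k
    unfolding t_def using q0 bc0 B_nonneg w_nonneg[of k] x_nonneg[of k] by simp
  fix F :: "int set" assume F: "finite F"
  have "(\<Sum>k\<in>F. \<integral>\<^sup>+\<omega>. ennreal (variance_term k \<omega> + bias_term k \<omega>) \<partial>P) \<le> (\<Sum>k\<in>F. ennreal (t k))"
    using mean by (intro sum_mono) (simp add: mean_le_def)
  also have "\<dots> = ennreal (\<Sum>k\<in>F. t k)" using t0 by simp
  \<comment> \<open>Four separate budgets: the total variances of W and X, the number of low
    frequencies, and the Sobolev ball.\<close>
  also have "(\<Sum>k\<in>F. t k) = 24 * ?s * (\<Sum>k\<in>F. w k) + 96 * ?s * (\<Sum>k\<in>F. x k)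
      + real (card {k\<in>F. ?low k}) * ?q + (\<Sum>k\<in>F. \<gamma> k powr p * (cmod (b k))\<^sup>2) * bias_const"
  proof -
    have "(\<Sum>k\<in>F. if ?low k then ?q else 0) = real (card {k\<in>F. ?low k}) * ?q"
      using F by (simp add: sum.inter_filter[symmetric])
    then show ?thesis
      by (simp add: t_def sum.distrib sum_distrib_left sum_distrib_right)
  qed
  also have "\<dots> \<le> 24 * ?s * \<Lambda> + 96 * ?s * \<Lambda>
      + (1 + 2 * (8 * d * \<Lambda> / \<alpha>) powr (1 / (2 * (a + \<nu>)))) * ?q + \<rho> * bias_const"
    using s0 q0 bc0
    by (intro add_mono mult_left_mono mult_right_mono sum_w_le sum_x_le card_low_frequencies_le sum_b_le F) simp_all
  also have "\<dots> = 120 * sqrt (B1 * B2) * \<Lambda> / (\<alpha> * real n)\<^sup>2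
      + (1 + 2 * (8 * d * \<Lambda> / \<alpha>) powr (1 / (2 * (a + \<nu>)))) * ?q + \<rho> * bias_const"
    by simp
  finally show "(\<Sum>k\<in>F. \<integral>\<^sup>+\<omega>. ennreal (variance_term k \<omega> + bias_term k \<omega>) \<partial>P)
      \<le> ennreal (120 * sqrt (B1 * B2) * \<Lambda> / (\<alpha> * real n)\<^sup>2
      + (1 + 2 * (8 * d * \<Lambda> / \<alpha>) powr (1 / (2 * (a + \<nu>)))) * ?q + \<rho> * bias_const)"
    by (auto intro: ennreal_leI)
qed simp

end

section \<open>The rate\<close>

text \<open>None of \<open>M\<close>, \<open>\<beta>\<close>, \<open>X\<close>, \<open>W\<close> and
  \<open>U\<close> occurs, neither here nor inside \<open>B1\<close> and \<open>B2\<close>. Outside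
  the locale the same number therefore serves every member of the class, which is what the supremum
  needs.\<close>

definition rate_const :: "real \<Rightarrow> real" where
  "rate_const c\<^sub>0 = 120 * sqrt (B1 * B2) * \<Lambda> / c\<^sub>0\<^sup>2
     + 2 * sqrt (6 * B1) / c\<^sub>0 * (1 + 2 * (8 * d * \<Lambda> / c\<^sub>0) powr (1 / (2 * (a + \<nu>))))
     + \<rho> * (4 * sqrt (6 * B2) + sqrt (6 * B2) * \<Lambda> / (2 * c\<^sub>0)
            + (8 * \<tau> * d * c\<^sub>0) powr ((p - \<nu>) / (a + \<nu>)))"

lemma risk_rate:
  assumes c0: "0 < c\<^sub>0" and n: "0 < n"
  shows "risk \<nu> n (c\<^sub>0 * real n powr (- 2 * (a + \<nu>) / (2 * (p + a) + 1))) \<sigma> M \<beta> X W U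
    \<le> ennreal (rate_const c\<^sub>0 * real n powr (- 2 * (p - \<nu>) / (2 * (p + a) + 1)))"
proof -
  define R where "R = 2 * (p + a) + 1"
  define \<alpha> where "\<alpha> = c\<^sub>0 * real n powr (- 2 * (a + \<nu>) / R)"
  define r where "r = real n powr (- 2 * (p - \<nu>) / R)"
  define u where "u = real n powr (- 1 / R)"
  have R: "0 < R" and n1: "1 \<le> real n" and an: "0 < a + \<nu>" using pos n by (auto simp: R_def)
  have \<alpha>: "0 < \<alpha>" using c0 n by (simp add: \<alpha>_def)
  have "- 2 * (p - \<nu>) / R \<le> 0" "- 1 / R \<le> 0" using R pos by (auto intro!: divide_nonpos_pos)
  then have r: "0 < r" "r \<le> 1" and u: "0 < u" "u \<le> 1"
    using n n1 powr_mono[of "- 2 * (p - \<nu>) / R" 0 "real n"] powr_mono[of "- 1 / R" 0 "real n"]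
    by (simp_all add: r_def u_def)
  \<comment> \<open>The exponents of \<alpha>, n, r and u add up to 0. A kept coefficient thus has
    variance of order \<open>r * u\<close>, and about \<open>1 / u\<close> low frequencies produce
    exactly the rate \<open>r\<close>.\<close>
  have \<alpha>n: "\<alpha> * real n * (r * u) = c\<^sub>0"
  proof -
    have "- 2 * (a + \<nu>) / R + 1 + (- 2 * (p - \<nu>) / R + - 1 / R) = (R - (2 * (p + a) + 1)) / R"
      using R by (simp add: field_simps)
    then have "- 2 * (a + \<nu>) / R + 1 + (- 2 * (p - \<nu>) / R + - 1 / R) = 0" by (simp add: R_def)
    moreover have "\<alpha> * real n * (r * u)
        = c\<^sub>0 * real n powr (- 2 * (a + \<nu>) / R + 1 + (- 2 * (p - \<nu>) / R + - 1 / R))"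
      unfolding powr_add using n by (simp add: \<alpha>_def r_def u_def)
    ultimately show ?thesis using n by simp
  qed
  have inv: "z / (\<alpha> * real n) = z * (r * u) / c\<^sub>0" for z
    unfolding \<alpha>n[symmetric] using \<alpha> n r u by simp
  have S0: "0 \<le> sqrt (B1 * B2)" "0 \<le> sqrt (6 * B1)" "0 \<le> sqrt (6 * B2)" using B_nonneg by simp_all
  have t1: "120 * sqrt (B1 * B2) * \<Lambda> / (\<alpha> * real n)\<^sup>2 \<le> 120 * sqrt (B1 * B2) * \<Lambda> / c\<^sub>0\<^sup>2 * r"
  proof -
    have "120 * sqrt (B1 * B2) * \<Lambda> / (\<alpha> * real n)\<^sup>2
        = 120 * sqrt (B1 * B2) * \<Lambda> / (\<alpha> * real n) / (\<alpha> * real n)"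
      by (simp add: power2_eq_square)
    also have "\<dots> = 120 * sqrt (B1 * B2) * \<Lambda> / c\<^sub>0\<^sup>2 * (r * (r * (u * u)))"
      unfolding inv by (simp add: power2_eq_square mult_ac)
    also have "\<dots> \<le> 120 * sqrt (B1 * B2) * \<Lambda> / c\<^sub>0\<^sup>2 * (r * (1 * (1 * 1)))"
      using r u S0 ge1 by (intro mult_left_mono mult_mono) auto
    finally show ?thesis by simp
  qed
  \<comment> \<open>The bound on the number of low frequencies is of order
    \<open>1 / u\<close>.\<close>
  have T: "(8 * d * \<Lambda> / \<alpha>) powr (1 / (2 * (a + \<nu>))) * u = (8 * d * \<Lambda> / c\<^sub>0) powr (1 / (2 * (a + \<nu>)))"
  proof -
    have "- 2 * (a + \<nu>) / R = - (2 * (a + \<nu>) / R)"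
      by (simp only: minus_divide_left mult_minus_left)
    then have "\<alpha> = c\<^sub>0 / real n powr (2 * (a + \<nu>) / R)"
      unfolding \<alpha>_def by (simp only: powr_minus_divide) simp
    then have "8 * d * \<Lambda> / \<alpha> = (8 * d * \<Lambda> / c\<^sub>0) * real n powr (2 * (a + \<nu>) / R)"
      by simp
    then have "(8 * d * \<Lambda> / \<alpha>) powr (1 / (2 * (a + \<nu>)))
        = (8 * d * \<Lambda> / c\<^sub>0) powr (1 / (2 * (a + \<nu>))) * real n powr (2 * (a + \<nu>) / R * (1 / (2 * (a + \<nu>))))"
      by (simp only: powr_mult powr_powr)
    also have "2 * (a + \<nu>) / R * (1 / (2 * (a + \<nu>))) = 1 / R" using an by (simp add: divide_simps)
    finally show ?thesis using n by (simp add: u_def mult.assoc powr_add[symmetric])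
  qed
  have t2: "(1 + 2 * (8 * d * \<Lambda> / \<alpha>) powr (1 / (2 * (a + \<nu>)))) * (2 * sqrt (6 * B1) / (\<alpha> * real n))
      \<le> 2 * sqrt (6 * B1) / c\<^sub>0 * (1 + 2 * (8 * d * \<Lambda> / c\<^sub>0) powr (1 / (2 * (a + \<nu>)))) * r"
  proof -
    have "(1 + 2 * (8 * d * \<Lambda> / \<alpha>) powr (1 / (2 * (a + \<nu>)))) * (2 * sqrt (6 * B1) / (\<alpha> * real n))
        = 2 * sqrt (6 * B1) / c\<^sub>0 * (u + 2 * ((8 * d * \<Lambda> / \<alpha>) powr (1 / (2 * (a + \<nu>))) * u)) * r"
    proof -
      have "(1 + 2 * t) * (q * (r * u) / c\<^sub>0) = q / c\<^sub>0 * (u + 2 * (t * u)) * r" for t q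
        by (simp add: algebra_simps add_divide_distrib)
      then show ?thesis by (simp only: inv)
    qed
    also have "\<dots> \<le> 2 * sqrt (6 * B1) / c\<^sub>0 * (1 + 2 * (8 * d * \<Lambda> / c\<^sub>0) powr (1 / (2 * (a + \<nu>)))) * r"
      unfolding T using r u S0 c0 by (intro mult_right_mono mult_left_mono add_right_mono) auto
    finally show ?thesis .
  qed
  have t3: "bias_const n \<alpha> \<le> (4 * sqrt (6 * B2) + sqrt (6 * B2) * \<Lambda> / (2 * c\<^sub>0)
            + (8 * \<tau> * d * c\<^sub>0) powr ((p - \<nu>) / (a + \<nu>))) * r"
  proof -
    \<comment> \<open>The target rate is never faster than 1 / n, because
      \<open>2 * (p - \<nu>)\<close> is at most \<open>2 * (p + a) + 1\<close>.\<close>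
    have "1 / real n \<le> r"
    proof -
      have "2 * (p - \<nu>) \<le> 1 * R" using pos by (simp add: R_def)
      then have "- 1 \<le> - 2 * (p - \<nu>) / R" using R by (simp add: pos_le_divide_eq)
      then have "real n powr (- 1) \<le> r" unfolding r_def using n1 by (intro powr_mono) auto
      then show ?thesis using n by (simp add: powr_minus divide_inverse)
    qed
    then have "4 * sqrt (6 * B2) / real n \<le> 4 * sqrt (6 * B2) * r"
      using mult_left_mono[of "1 / real n" r "4 * sqrt (6 * B2)"] S0 by simp
    moreover have "sqrt (6 * B2) * \<Lambda> / (2 * (\<alpha> * real n)) \<le> sqrt (6 * B2) * \<Lambda> / (2 * c\<^sub>0) * r"
    proof -
      have "sqrt (6 * B2) * \<Lambda> / (2 * (\<alpha> * real n)) = sqrt (6 * B2) * \<Lambda> / 2 / (\<alpha> * real n)"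
        by simp
      also have "\<dots> = sqrt (6 * B2) * \<Lambda> / (2 * c\<^sub>0) * (r * u)"
        unfolding inv by simp
      also have "\<dots> \<le> sqrt (6 * B2) * \<Lambda> / (2 * c\<^sub>0) * (r * 1)"
        using r u S0 c0 ge1 by (intro mult_left_mono) auto
      finally show ?thesis by simp
    qed
    moreover have "(8 * \<tau> * d * \<alpha>) powr ((p - \<nu>) / (a + \<nu>)) = (8 * \<tau> * d * c\<^sub>0) powr ((p - \<nu>) / (a + \<nu>)) * r"
    proof -
      have "(8 * \<tau> * d * \<alpha>) powr ((p - \<nu>) / (a + \<nu>))
          = (8 * \<tau> * d * c\<^sub>0 * real n powr (- 2 * (a + \<nu>) / R)) powr ((p - \<nu>) / (a + \<nu>))"
        by (simp add: \<alpha>_def mult.assoc)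
      also have "\<dots> = (8 * \<tau> * d * c\<^sub>0) powr ((p - \<nu>) / (a + \<nu>))
          * real n powr (- 2 * (a + \<nu>) / R * ((p - \<nu>) / (a + \<nu>)))"
        using ge1 c0 by (simp only: powr_mult powr_powr)
      also have "- 2 * (a + \<nu>) / R * ((p - \<nu>) / (a + \<nu>)) = - 2 * (p - \<nu>) / R"
        using an R by (simp add: divide_simps) (simp add: algebra_simps)
      finally show ?thesis by (simp only: r_def)
    qed
    ultimately show ?thesis unfolding bias_const_def[OF n \<alpha>] distrib_right by linarith
  qed
  have "120 * sqrt (B1 * B2) * \<Lambda> / (\<alpha> * real n)\<^sup>2
      + (1 + 2 * (8 * d * \<Lambda> / \<alpha>) powr (1 / (2 * (a + \<nu>)))) * (2 * sqrt (6 * B1) / (\<alpha> * real n))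
      + \<rho> * bias_const n \<alpha> \<le> rate_const c\<^sub>0 * r"
  proof -
    let ?X = "4 * sqrt (6 * B2) + sqrt (6 * B2) * \<Lambda> / (2 * c\<^sub>0)
            + (8 * \<tau> * d * c\<^sub>0) powr ((p - \<nu>) / (a + \<nu>))"
    have "\<rho> * bias_const n \<alpha> \<le> \<rho> * (?X * r)"
      using t3 pos by (intro mult_left_mono) auto
    then have "\<rho> * bias_const n \<alpha> \<le> \<rho> * ?X * r"
      by (simp only: mult.assoc)
    from add_mono[OF add_mono[OF t1 t2] this] show ?thesis
      unfolding rate_const_def by (simp only: distrib_right)
  qed
  then have "risk \<nu> n \<alpha> \<sigma> M \<beta> X W U \<le> ennreal (rate_const c\<^sub>0 * r)"
    using risk_le[OF n \<alpha>] by (auto intro: order_trans ennreal_leI)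
  then show ?thesis unfolding \<alpha>_def r_def R_def .
qed

end

theorem proposition4p2:
  fixes \<sigma> p \<rho> a \<nu> d \<eta> \<tau> \<Lambda> c :: real and l m :: nat
  assumes "\<sigma> > 0" "p > 0" "\<rho> > 0" "a > 0"
    and "0 \<le> \<nu>" "\<nu> < p"
    and "l \<ge> 16" "m \<ge> 32"
    and "d \<ge> 1" "\<eta> \<ge> 1" "\<tau> \<ge> 1" "\<Lambda> \<ge> 1"
    and "c > 0"
  shows "\<exists>C>0. \<forall>\<^sub>F n in sequentially.
    (SUP (M :: 'a measure, \<beta>, X, W, U) \<in>
        {(M, \<beta>, X, W, U). prob_space M
           \<and> cfun \<beta> \<in> sobolev_ball p \<rho>
           \<and> (X, W) \<in> pair_link_class M m \<eta> \<tau> (\<lambda>t. t powr ((p - \<nu>) / (a + \<nu>))) d \<nu> p \<Lambda>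
           \<and> U \<in> error_class M l \<eta>
           \<and> (\<forall>t\<in>{0..1}. (\<integral>\<omega>. U \<omega> * W \<omega> t \<partial>M) = 0)}.
      risk \<nu> n (c * real n powr (- 2 * (a + \<nu>) / (2 * (p + a) + 1))) \<sigma> M \<beta> X W U)
    \<le> ennreal (C * real n powr (- 2 * (p - \<nu>) / (2 * (p + a) + 1)))"
proof (intro exI conjI eventually_sequentiallyI[of 1] SUP_least)
  \<comment> \<open>The maximum with 1 makes the constant positive; the resulting bound holds for
    every n from 1 on.\<close>
  let ?C = "max 1 (linear_model.rate_const \<sigma> p \<rho> a \<nu> d \<eta> \<tau> \<Lambda> c)"
  show "0 < ?C" by simp
  fix n :: nat and z :: "'a measure \<times> (real \<Rightarrow> real) \<times> ('a \<Rightarrow> real \<Rightarrow> real) \<times> ('a \<Rightarrow> real \<Rightarrow> real) \<times> ('a \<Rightarrow> real)"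
  assume n: "1 \<le> n" and z: "z \<in> {(M, \<beta>, X, W, U). prob_space M
           \<and> cfun \<beta> \<in> sobolev_ball p \<rho>
           \<and> (X, W) \<in> pair_link_class M m \<eta> \<tau> (\<lambda>t. t powr ((p - \<nu>) / (a + \<nu>))) d \<nu> p \<Lambda>
           \<and> U \<in> error_class M l \<eta>
           \<and> (\<forall>t\<in>{0..1}. (\<integral>\<omega>. U \<omega> * W \<omega> t \<partial>M) = 0)}"
  obtain M \<beta> X W U where z_eq: "z = (M, \<beta>, X, W, U)" by (cases z) auto
  interpret linear_model M \<sigma> p \<rho> a \<nu> d \<eta> \<tau> \<Lambda> l m \<beta> X W U
    using z assms by (simp add: z_eq linear_model_def linear_model_axioms_def)
  have "risk \<nu> n (c * real n powr (- 2 * (a + \<nu>) / (2 * (p + a) + 1))) \<sigma> M \<beta> X W U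
      \<le> ennreal (rate_const c * real n powr (- 2 * (p - \<nu>) / (2 * (p + a) + 1)))"
    using assms n by (intro risk_rate) auto
  also have "\<dots> \<le> ennreal (?C * real n powr (- 2 * (p - \<nu>) / (2 * (p + a) + 1)))"
    by (intro ennreal_leI mult_right_mono) auto
  finally show "(case z of (M, \<beta>, X, W, U) \<Rightarrow>
      risk \<nu> n (c * real n powr (- 2 * (a + \<nu>) / (2 * (p + a) + 1))) \<sigma> M \<beta> X W U)
      \<le> ennreal (?C * real n powr (- 2 * (p - \<nu>) / (2 * (p + a) + 1)))"
    by (simp add: z_eq)
qed

end
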